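(* Let $q=e^{-\mathrm i\theta_0}$ with $0<|\theta_0|<\pi$. Let $A$ be a positive self-adjoint operator with $\ker A=\{0\}$ and $B$ a self-adjoint operator on a Hilbert space $\mathcal H$. Suppose that $\mathcal D_q(A,B)$ is a core for $B$ and that $$qR_{-\lambda q}(A)B\subseteq BR_{-\lambda}(A)\quad\text{for all }\lambda>0.$$ Then $\mathcal H_2:=\ker B$ reduces both $A$ and $B$, and with respect to $\mathcal H=\mathcal H_2\oplus\mathcal H_2^\perp$ we have $A=A_2\oplus A_0$, $B=0\oplus B_0$, where the pair $\{A_0,B_0\}$ on $\mathcal H_2^\perp$ belongs to the class $\mathcal C_0$.
   Context: $\mathcal D_q(A,B):=\{f\in\mathcal D(BA)\cap\mathcal D(AB): ABf=qBAf\}$; $R_\lambda(T)=(T-\lambda I)^{-1}$; $S\subseteq T$ means $T$ extends $S$. For a self-adjoint $T$ with trivial kernel, $T=U_T|T|$ is the polar decomposition. A pair $\{A,B\}$ of self-adjoint operators with $\ker A=\ker B=\{0\}$ belongs to class $\mathcal C_0$ if $|A|^{\mathrm it}B\subseteq e^{\theta_0t}B|A|^{\mathrm it}$ for all $t\in\mathbb R$ and $U_AB\subseteq BU_A$. *)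

theory Defs
  imports "HOL-Analysis.Analysis"
begin

text \<open>HOL-Analysis only has real inner product spaces; we introduce complex
  inner product spaces (inner product conjugate-linear in the first argument,
  linear in the second) and complex Hilbert spaces.\<close>

class complex_inner = real_normed_vector +
  fixes scaleC :: "complex \<Rightarrow> 'a \<Rightarrow> 'a"
    and cinner :: "'a \<Rightarrow> 'a \<Rightarrow> complex"
  assumes scaleC_add_right: "scaleC a (x + y) = scaleC a x + scaleC a y"
    and scaleC_add_left: "scaleC (a + b) x = scaleC a x + scaleC b x"
    and scaleC_scaleC: "scaleC a (scaleC b x) = scaleC (a * b) x"
    and scaleC_one: "scaleC 1 x = x"
    and scaleR_scaleC: "scaleR r x = scaleC (complex_of_real r) x"
    and cinner_commute: "cinner x y = cnj (cinner y x)"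
    and cinner_add_right: "cinner x (y + z) = cinner x y + cinner x z"
    and cinner_scaleC_right: "cinner x (scaleC a y) = a * cinner x y"
    and cinner_norm: "cinner x x = complex_of_real ((norm x)\<^sup>2)"

class chilbert_space = complex_inner + complete_space

definition csubspace :: "'h::complex_inner set \<Rightarrow> bool" where
  "csubspace M \<longleftrightarrow> 0 \<in> M \<and> (\<forall>x\<in>M. \<forall>y\<in>M. x + y \<in> M) \<and> (\<forall>c. \<forall>x\<in>M. scaleC c x \<in> M)"

definition closed_csubspace :: "'h::complex_inner set \<Rightarrow> bool" where
  "closed_csubspace M \<longleftrightarrow> csubspace M \<and> closed M"

definition orth_compl :: "'h::complex_inner set \<Rightarrow> 'h set" where
  "orth_compl M = {x. \<forall>m\<in>M. cinner m x = 0}"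

definition proj_onto :: "'h::complex_inner set \<Rightarrow> 'h \<Rightarrow> 'h" where
  "proj_onto M x = (THE y. y \<in> M \<and> (\<forall>m\<in>M. cinner m (x - y) = 0))"

text \<open>An operator is a relation (its graph). Operator inclusion S \<subseteq> T is graph
  inclusion. The product S T (first T, then S) has graph T O S.\<close>

definition op_dom :: "'h rel \<Rightarrow> 'h set" where
  "op_dom T = {x. \<exists>y. (x, y) \<in> T}"

definition op_ker :: "'h::zero rel \<Rightarrow> 'h set" where
  "op_ker T = {x. (x, 0) \<in> T}"

definition op_scale :: "complex \<Rightarrow> 'h::complex_inner rel \<Rightarrow> 'h rel" where
  "op_scale c T = {(x, scaleC c y) | x y. (x, y) \<in> T}"

definition op_shift :: "'h::complex_inner rel \<Rightarrow> complex \<Rightarrow> 'h rel" where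
  "op_shift T c = {(x, y - scaleC c x) | x y. (x, y) \<in> T}"

definition resolvent :: "complex \<Rightarrow> 'h::complex_inner rel \<Rightarrow> 'h rel" where
  "resolvent c T = converse (op_shift T c)"

text \<open>Linear operator in the Hilbert space K (a closed subspace of the ambient space).\<close>
definition is_op_on :: "'h::complex_inner set \<Rightarrow> 'h rel \<Rightarrow> bool" where
  "is_op_on K T \<longleftrightarrow> T \<subseteq> K \<times> K \<and> (0, 0) \<in> T \<and>
     (\<forall>x y u v. (x, y) \<in> T \<longrightarrow> (u, v) \<in> T \<longrightarrow> (x + u, y + v) \<in> T) \<and>
     (\<forall>c x y. (x, y) \<in> T \<longrightarrow> (scaleC c x, scaleC c y) \<in> T) \<and>
     (\<forall>x y z. (x, y) \<in> T \<longrightarrow> (x, z) \<in> T \<longrightarrow> y = z)"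

definition adjoint_on :: "'h::complex_inner set \<Rightarrow> 'h rel \<Rightarrow> 'h rel" where
  "adjoint_on K T = {(y, z). y \<in> K \<and> z \<in> K \<and> (\<forall>x w. (x, w) \<in> T \<longrightarrow> cinner w y = cinner x z)}"

definition selfadj_on :: "'h::complex_inner set \<Rightarrow> 'h rel \<Rightarrow> bool" where
  "selfadj_on K T \<longleftrightarrow> is_op_on K T \<and> K \<subseteq> closure (op_dom T) \<and> T = adjoint_on K T"

definition positive_on :: "'h::complex_inner set \<Rightarrow> 'h rel \<Rightarrow> bool" where
  "positive_on K T \<longleftrightarrow> selfadj_on K T \<and> (\<forall>x y. (x, y) \<in> T \<longrightarrow> 0 \<le> Re (cinner x y))"

definition bounded_total_on :: "'h::complex_inner set \<Rightarrow> 'h rel \<Rightarrow> bool" where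
  "bounded_total_on K U \<longleftrightarrow> is_op_on K U \<and> op_dom U = K \<and>
     (\<exists>C. \<forall>x y. (x, y) \<in> U \<longrightarrow> norm y \<le> C * norm x)"

definition is_core :: "'h::complex_inner set \<Rightarrow> 'h rel \<Rightarrow> bool" where
  "is_core D T \<longleftrightarrow> D \<subseteq> op_dom T \<and> closure {(x, y) \<in> T. x \<in> D} = T"

definition Dq :: "complex \<Rightarrow> 'h::complex_inner rel \<Rightarrow> 'h rel \<Rightarrow> 'h set" where
  "Dq q A B = {f. \<exists>y z. (f, y) \<in> B O A \<and> (f, z) \<in> A O B \<and> y = scaleC q z}"

definition reduces :: "'h::complex_inner set \<Rightarrow> 'h rel \<Rightarrow> bool" where
  "reduces M T \<longleftrightarrow> closed_csubspace M \<and>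
     (\<forall>x y. (x, y) \<in> T \<longrightarrow> (proj_onto M x, proj_onto M y) \<in> T)"

definition op_part :: "'h set \<Rightarrow> 'h rel \<Rightarrow> 'h rel" where
  "op_part M T = {(x, y) \<in> T. x \<in> M}"

definition op_orth_sum :: "'h::complex_inner rel \<Rightarrow> 'h rel \<Rightarrow> 'h rel" where
  "op_orth_sum T1 T2 = {(x1 + x2, y1 + y2) | x1 y1 x2 y2. (x1, y1) \<in> T1 \<and> (x2, y2) \<in> T2}"

definition zero_op_on :: "'h::zero set \<Rightarrow> 'h rel" where
  "zero_op_on M = {(x, 0) | x. x \<in> M}"

definition spectral_measure_on :: "'h::complex_inner set \<Rightarrow> (real set \<Rightarrow> 'h \<Rightarrow> 'h) \<Rightarrow> bool" where
  "spectral_measure_on K E \<longleftrightarrow>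
     (\<forall>S\<in>sets (borel :: real measure). \<exists>M. closed_csubspace M \<and> M \<subseteq> K \<and> E S = proj_onto M) \<and>
     E UNIV = proj_onto K \<and>
     (\<forall>S\<in>sets (borel :: real measure). \<forall>T\<in>sets (borel :: real measure). E (S \<inter> T) = E S \<circ> E T) \<and>
     (\<forall>F x. range F \<subseteq> sets (borel :: real measure) \<longrightarrow> disjoint_family F \<longrightarrow>
         (\<lambda>n. \<Sum>i<n. E (F i) x) \<longlonglongrightarrow> E (\<Union>i. F i) x)"

definition spec_meas :: "(real set \<Rightarrow> 'h::complex_inner \<Rightarrow> 'h) \<Rightarrow> 'h \<Rightarrow> real measure" where
  "spec_meas E x = measure_of UNIV (sets borel) (\<lambda>S. ennreal ((norm (E S x))\<^sup>2))"

text \<open>Bounded Borel functional calculus: \<langle>z, f(E) x\<rangle> = \<integral> f d\<langle>z, E x\<rangle>, the complex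
  measure \<langle>z, E(.) x\<rangle> being obtained by polarization.\<close>
definition bfc :: "'h::complex_inner set \<Rightarrow> (real set \<Rightarrow> 'h \<Rightarrow> 'h) \<Rightarrow> (real \<Rightarrow> complex) \<Rightarrow> 'h rel" where
  "bfc K E f = {(x, y). x \<in> K \<and> y \<in> K \<and>
     (\<forall>z\<in>K. cinner z y =
        (\<Sum>k<4. (inverse \<i>) ^ k * integral\<^sup>L (spec_meas E (z + scaleC (\<i> ^ k) x)) f) / 4)}"

text \<open>General (unbounded) Borel functional calculus, via truncations.\<close>
definition fc :: "'h::complex_inner set \<Rightarrow> (real set \<Rightarrow> 'h \<Rightarrow> 'h) \<Rightarrow> (real \<Rightarrow> complex) \<Rightarrow> 'h rel" where
  "fc K E f = {(x, y). x \<in> K \<and>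
     (\<exists>ys. (\<forall>n::nat. (x, ys n) \<in> bfc K E (\<lambda>s. if cmod (f s) \<le> real n then f s else 0)) \<and>
           ys \<longlonglongrightarrow> y)}"

definition spectral_measure_of :: "'h::complex_inner set \<Rightarrow> 'h rel \<Rightarrow> (real set \<Rightarrow> 'h \<Rightarrow> 'h) \<Rightarrow> bool" where
  "spectral_measure_of K T E \<longleftrightarrow> spectral_measure_on K E \<and> T = fc K E (\<lambda>s. complex_of_real s)"

definition op_abs :: "'h::complex_inner set \<Rightarrow> 'h rel \<Rightarrow> 'h rel" where
  "op_abs K T = (THE S. positive_on K S \<and> S O S = T O adjoint_on K T)"

text \<open>S^{it} for a positive self-adjoint S with trivial kernel.\<close>
definition op_ipow :: "'h::complex_inner set \<Rightarrow> 'h rel \<Rightarrow> real \<Rightarrow> 'h rel" where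
  "op_ipow K S t = fc K (SOME E. spectral_measure_of K S E)
      (\<lambda>s. if 0 < s then exp (\<i> * complex_of_real (t * ln s)) else 0)"

text \<open>U_T from the polar decomposition T = U_T |T| (T with trivial kernel).\<close>
definition polar_phase :: "'h::complex_inner set \<Rightarrow> 'h rel \<Rightarrow> 'h rel" where
  "polar_phase K T = (THE U. bounded_total_on K U \<and> T = op_abs K T O U)"

definition class_C0 :: "real \<Rightarrow> 'h::complex_inner set \<Rightarrow> 'h rel \<Rightarrow> 'h rel \<Rightarrow> bool" where
  "class_C0 \<theta>0 K A B \<longleftrightarrow>
     selfadj_on K A \<and> selfadj_on K B \<and> op_ker A = {0} \<and> op_ker B = {0} \<and>
     (\<forall>t::real. B O op_ipow K (op_abs K A) t
                 \<subseteq> op_scale (complex_of_real (exp (\<theta>0 * t))) (op_ipow K (op_abs K A) t O B)) \<and>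
     B O polar_phase K A \<subseteq> polar_phase K A O B"

end

theory Submission
  imports Defs "HOL-Probability.Probability" "HOL-Complex_Analysis.Complex_Analysis"
begin

text \<open>The resolvent hypothesis at \<open>\<lambda> = 1\<close> makes \<open>ker B\<close> invariant under \<open>(A + 1)\<inverse>\<close>, so \<open>ker B\<close> reduces \<open>A\<close>.
  On the complement, iterating the hypothesis gives
  \<open>q\<^sup>2 R\<^bsub>-\<lambda>q\<^esub>(A)\<^sup>2 B \<subseteq> B R\<^bsub>-\<lambda>\<^esub>(A)\<^sup>2\<close>, hence the same relation for
  \<open>\<lambda>q A (A + \<lambda>q)\<^sup>-\<^sup>2\<close> and \<open>\<lambda> A (A + \<lambda>)\<^sup>-\<^sup>2\<close>. Integrating against \<open>\<lambda>\<^sup>i\<^sup>t d\<lambda>/\<lambda>\<close> turns these functions of \<open>A\<close> into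
  multiples of \<open>A\<^sup>i\<^sup>t\<close>; by a contour shift the two factors differ by \<open>exp (- t \<theta>\<^sub>0)\<close>, and they do not vanish
  because the second one is \<open>\<Gamma>(1 + it) \<Gamma>(1 - it)\<close>. The spectral theorem for unbounded positive operators is
  obtained from the bounded operator \<open>(A + 1)\<inverse>\<close>, whose spectral measure is a weak limit of measures with
  Bernstein weights.\<close>

section \<open>Complex Hilbert spaces\<close>

text \<open>The hypothesis controls \<open>B\<close> only through resolvents of \<open>A\<close> at
  \<open>-\<lambda>\<close> and \<open>-\<lambda>q\<close>, so imaginary powers have to be assembled
  from these. A single resolvent will not do: as a function of \<open>ln \<lambda>\<close>,
  \<open>\<lambda>/(s + \<lambda>)\<close> tends to 1 at infinity and its Mellin integral diverges.
  The kernel \<open>\<lambda>s/(s + \<lambda>)\<^sup>2\<close> decays at both ends, depends only on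
  \<open>ln \<lambda> - ln s\<close>, and still involves resolvents alone, because
  \<open>s = (s + \<lambda>) - \<lambda>\<close>. The bound
  \<open>\<bar>\<theta>0\<bar> < pi\<close> keeps \<open>s + \<lambda>q\<close> away from zero, and
  with it the shifted line of integration inside the strip where the kernel is holomorphic. As
  \<open>B\<close> may be unbounded, integrals are compared in matrix elements against the graph of
  \<open>B\<close>; self-adjointness turns the resulting identity back into membership in the graph.
  Since \<open>op_abs\<close> and \<open>polar_phase\<close> are definite descriptions, evaluating
  them for a positive operator calls for uniqueness of positive square roots and of the phase. Since
  \<open>op_ipow\<close> selects a spectral measure by choice, the calculus is developed for an
  arbitrary measure representing the operator.\<close>

lemma scaleC_zero_left [simp]: "scaleC 0 (x::'h::complex_inner) = 0"
  using scaleR_scaleC[of 0 x] by simp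

lemma scaleC_zero_right [simp]: "scaleC a (0::'h::complex_inner) = 0"
  using scaleC_add_right[of a 0 "0::'h"] by simp

lemma scaleC_one' [simp]: "scaleC 1 (x::'h::complex_inner) = x"
  by (rule scaleC_one)

lemma scaleC_minus_left: "scaleC (- a) (x::'h::complex_inner) = - scaleC a x"
  using scaleC_add_left[of a "-a" x] by (simp add: minus_unique)

lemma scaleC_minus_right: "scaleC a (- x::'h::complex_inner) = - scaleC a x"
  using scaleC_add_right[of a x "-x"] by (simp add: minus_unique)

lemma scaleC_diff_right: "scaleC a (x - y::'h::complex_inner) = scaleC a x - scaleC a y"
  using scaleC_add_right[of a x "-y"] by (simp add: scaleC_minus_right)

lemma cinner_add_left: "cinner (x + y) (z::'h::complex_inner) = cinner x z + cinner y z"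
  by (metis cinner_add_right cinner_commute complex_cnj_add)

lemma cinner_scaleC_left: "cinner (scaleC a x) (y::'h::complex_inner) = cnj a * cinner x y"
  by (metis cinner_scaleC_right cinner_commute complex_cnj_mult)

lemma cinner_zero_right [simp]: "cinner x (0::'h::complex_inner) = 0"
  using cinner_scaleC_right[of x 0 0] by simp

lemma cinner_zero_left [simp]: "cinner (0::'h::complex_inner) x = 0"
  using cinner_scaleC_left[of 0 0 x] by simp

lemma cinner_minus_right: "cinner x (- y::'h::complex_inner) = - cinner x y"
  using cinner_scaleC_right[of x "-1" y] by (simp add: scaleC_minus_left)

lemma cinner_minus_left: "cinner (- x) (y::'h::complex_inner) = - cinner x y"
  using cinner_scaleC_left[of "-1" x y] by (simp add: scaleC_minus_left)

lemma cinner_diff_right: "cinner x (y - z::'h::complex_inner) = cinner x y - cinner x z"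
  using cinner_add_right[of x y "-z"] by (simp add: cinner_minus_right)

lemma cinner_diff_left: "cinner (x - y) (z::'h::complex_inner) = cinner x z - cinner y z"
  using cinner_add_left[of x "-y" z] by (simp add: cinner_minus_left)

lemmas cinner_simps = cinner_add_left cinner_add_right cinner_diff_left cinner_diff_right
  cinner_scaleC_left cinner_scaleC_right cinner_minus_left cinner_minus_right

lemma cinner_scaleR_right: "cinner x (r *\<^sub>R y) = of_real r * cinner x (y::'h::complex_inner)"
  by (simp add: scaleR_scaleC cinner_scaleC_right)

lemma cinner_scaleR_left: "cinner (r *\<^sub>R x) y = of_real r * cinner x (y::'h::complex_inner)"
  by (simp add: scaleR_scaleC cinner_scaleC_left)

lemma norm_sq_cinner: "(norm (x::'h::complex_inner))\<^sup>2 = Re (cinner x x)"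
  by (simp add: cinner_norm)

lemma cinner_self_eq_zero [simp]: "cinner x x = 0 \<longleftrightarrow> x = (0::'h::complex_inner)"
  by (simp add: cinner_norm)

lemma cinner_eq_zero_commute: "cinner x y = 0 \<longleftrightarrow> cinner y (x::'h::complex_inner) = 0"
  by (metis cinner_commute complex_cnj_zero)

lemma Re_cinner_commute: "Re (cinner x y) = Re (cinner y (x::'h::complex_inner))"
  by (metis cinner_commute complex_cnj(1) cnj.simps(1))

lemma mult_cnj_cmod: "z * cnj z = (complex_of_real (cmod z))\<^sup>2" "cnj z * z = (complex_of_real (cmod z))\<^sup>2"
  using complex_norm_square[of z] by (simp_all add: mult.commute)

lemma norm_scaleC: "norm (scaleC a (x::'h::complex_inner)) = cmod a * norm x"
proof -
  have "complex_of_real ((norm (scaleC a x))\<^sup>2) = of_real ((cmod a * norm x)\<^sup>2)"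
    unfolding cinner_norm[symmetric] cinner_scaleC_left cinner_scaleC_right
    by (simp add: cinner_norm power_mult_distrib mult_cnj_cmod flip: mult.assoc)
  then have "(norm (scaleC a x))\<^sup>2 = (cmod a * norm x)\<^sup>2"
    using of_real_eq_iff by blast
  then show ?thesis
    by (simp add: power2_eq_iff_nonneg)
qed

lemma norm_add_sq: "(norm (x + y))\<^sup>2 = (norm x)\<^sup>2 + 2 * Re (cinner x y) + (norm (y::'h::complex_inner))\<^sup>2"
  unfolding norm_sq_cinner by (simp add: cinner_simps Re_cinner_commute[of y x])

lemma norm_diff_sq: "(norm (x - y))\<^sup>2 = (norm x)\<^sup>2 - 2 * Re (cinner x y) + (norm (y::'h::complex_inner))\<^sup>2"
  unfolding norm_sq_cinner by (simp add: cinner_simps Re_cinner_commute[of y x])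

lemma parallelogram: "(norm (x + y))\<^sup>2 + (norm (x - y))\<^sup>2 = 2 * (norm x)\<^sup>2 + 2 * (norm (y::'h::complex_inner))\<^sup>2"
  by (simp add: norm_add_sq norm_diff_sq)

lemma Cauchy_Schwarz_cinner: "cmod (cinner x y) \<le> norm x * norm (y::'h::complex_inner)"
proof (cases "x = 0")
  case False
  define c where "c = cinner x y / of_real ((norm x)\<^sup>2)"
  have n0: "(norm x)\<^sup>2 \<noteq> 0" using False by simp
  have "0 \<le> (norm (y - scaleC c x))\<^sup>2" by simp
  also have "\<dots> = (norm y)\<^sup>2 - 2 * Re (cinner y (scaleC c x)) + (cmod c * norm x)\<^sup>2"
    by (simp add: norm_diff_sq norm_scaleC)
  also have "cinner y (scaleC c x) = of_real ((cmod (cinner x y))\<^sup>2 / (norm x)\<^sup>2)"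
    unfolding cinner_scaleC_right c_def complex_norm_square cinner_commute[of y x]
    by (simp add: field_simps mult_cnj_cmod)
  also have "(cmod c * norm x)\<^sup>2 = (cmod (cinner x y))\<^sup>2 / (norm x)\<^sup>2"
    using n0 by (simp add: c_def norm_divide power_mult_distrib power_divide norm_power)
      (simp add: field_simps power2_eq_square power4_eq_xxxx)
  finally have "(cmod (cinner x y))\<^sup>2 / (norm x)\<^sup>2 \<le> (norm y)\<^sup>2" by simp
  then have "(cmod (cinner x y))\<^sup>2 \<le> (norm x * norm y)\<^sup>2"
    using n0 by (simp add: field_simps power_mult_distrib)
  then show ?thesis
    by (meson mult_nonneg_nonneg norm_ge_zero power2_le_imp_le)
qed simp

lemma bounded_bilinear_cinner: "bounded_bilinear (cinner :: 'h::complex_inner \<Rightarrow> 'h \<Rightarrow> complex)"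
  by standard (auto simp: cinner_simps cinner_scaleR_left cinner_scaleR_right scaleR_conv_of_real
      intro!: exI[of _ 1] Cauchy_Schwarz_cinner)

lemmas tendsto_cinner = bounded_bilinear.tendsto[OF bounded_bilinear_cinner]

lemma bounded_linear_scaleC: "bounded_linear (\<lambda>x::'h::complex_inner. scaleC a x)"
  by (rule bounded_linear_intro[where K="cmod a"])
    (auto simp: scaleC_add_right scaleR_scaleC scaleC_scaleC norm_scaleC mult.commute)

lemmas tendsto_scaleC = bounded_linear.tendsto[OF bounded_linear_scaleC]

lemma cinner_ext: "(\<And>z. cinner z x = cinner z (y::'h::complex_inner)) \<Longrightarrow> x = y"
  by (metis cinner_diff_right cinner_self_eq_zero eq_iff_diff_eq_0)

section \<open>Orthogonal projections\<close>

lemma csubspace_scaleR: "csubspace M \<Longrightarrow> x \<in> M \<Longrightarrow> r *\<^sub>R x \<in> M"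
  by (simp add: csubspace_def scaleR_scaleC)

lemma csubspace_0: "csubspace M \<Longrightarrow> 0 \<in> M"
  and csubspace_add: "csubspace M \<Longrightarrow> x \<in> M \<Longrightarrow> y \<in> M \<Longrightarrow> x + y \<in> M"
  and csubspace_scaleC: "csubspace M \<Longrightarrow> x \<in> M \<Longrightarrow> scaleC c x \<in> M"
  by (auto simp: csubspace_def)

lemma csubspace_minus: "csubspace M \<Longrightarrow> x \<in> M \<Longrightarrow> - x \<in> M"
  using csubspace_scaleC[of M x "-1"] by (simp add: scaleC_minus_left)

lemma csubspace_diff: "csubspace M \<Longrightarrow> x \<in> M \<Longrightarrow> y \<in> M \<Longrightarrow> x - y \<in> M"
  using csubspace_add[of M x "-y"] csubspace_minus[of M y] by simp

lemma closed_csubspace_imp_csubspace: "closed_csubspace M \<Longrightarrow> csubspace M"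
  by (simp add: closed_csubspace_def)

text \<open>A minimizing sequence is Cauchy by the parallelogram law, because midpoints of its terms
  lie in \<open>M\<close> and cannot beat the infimum; completeness supplies the limit.\<close>

lemma closest_point_exists:
  fixes M :: "'h::chilbert_space set"
  assumes M: "closed_csubspace M"
  shows "\<exists>y\<in>M. \<forall>m\<in>M. norm (x - y) \<le> norm (x - m)"
proof -
  note sub = closed_csubspace_imp_csubspace[OF M]
  define d where "d = (INF m\<in>M. (norm (x - m))\<^sup>2)"
  have ne: "M \<noteq> {}" using csubspace_0[OF sub] by auto
  have bdd: "bdd_below ((\<lambda>m. (norm (x - m))\<^sup>2) ` M)" by (rule bdd_belowI[of _ 0]) auto
  have dle: "d \<le> (norm (x - m))\<^sup>2" if "m \<in> M" for m
    unfolding d_def by (rule cINF_lower[OF bdd that])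
  have "\<exists>m\<in>M. (norm (x - m))\<^sup>2 < d + 1 / real (Suc n)" for n
    using cINF_less_iff[OF ne bdd, of "d + 1 / real (Suc n)"] by (simp add: d_def)
  then obtain s where sM: "\<And>n. s n \<in> M" and s: "\<And>n. (norm (x - s n))\<^sup>2 < d + 1 / real (Suc n)"
    by metis
  have mid: "(norm (s n - s m))\<^sup>2 \<le> 2 / real (Suc n) + 2 / real (Suc m)" for n m
  proof -
    have "(1/2) *\<^sub>R (s n + s m) \<in> M"
      by (intro csubspace_scaleR csubspace_add sub sM)
    then have "d \<le> (norm (x - (1/2) *\<^sub>R (s n + s m)))\<^sup>2" by (rule dle)
    also have "x - (1/2) *\<^sub>R (s n + s m) = (1/2) *\<^sub>R ((x - s n) + (x - s m))"
      by (simp add: algebra_simps) (metis scaleR_half_double scaleR_add_right)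
    also have "(norm \<dots>)\<^sup>2 = (norm ((x - s n) + (x - s m)))\<^sup>2 / 4"
      by (simp add: power_mult_distrib power2_eq_square)
    finally have "4 * d \<le> (norm ((x - s n) + (x - s m)))\<^sup>2" by simp
    moreover have "(norm ((x - s n) + (x - s m)))\<^sup>2 + (norm ((x - s n) - (x - s m)))\<^sup>2
        = 2 * (norm (x - s n))\<^sup>2 + 2 * (norm (x - s m))\<^sup>2" by (rule parallelogram)
    moreover have "norm ((x - s n) - (x - s m)) = norm (s n - s m)"
      by (simp add: norm_minus_commute)
    ultimately show ?thesis using s[of n] s[of m] by simp
  qed
  have "Cauchy s"
  proof (rule CauchyI)
    fix e :: real assume e: "e > 0"
    obtain N where N: "4 / e\<^sup>2 < real N" using reals_Archimedean2 by blast
    have "norm (s m - s n) < e" if "m \<ge> N" "n \<ge> N" for m n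
    proof -
      have *: "2 / real (Suc k) \<le> 2 / real (Suc N)" if "k \<ge> N" for k
        using that by (simp add: frac_le)
      have "(norm (s m - s n))\<^sup>2 \<le> 4 / real (Suc N)"
        using mid[of m n] *[OF that(1)] *[OF that(2)] by linarith
      also have "\<dots> < e\<^sup>2"
      proof -
        have "4 < real (Suc N) * e\<^sup>2" using N e by (simp add: field_simps) (smt (verit) mult_pos_pos zero_less_power)
        then show ?thesis by (simp add: field_simps)
      qed
      finally show ?thesis using e by (meson less_imp_le power2_less_imp_less)
    qed
    then show "\<exists>N. \<forall>m\<ge>N. \<forall>n\<ge>N. norm (s m - s n) < e" by blast
  qed
  then obtain y where y: "s \<longlonglongrightarrow> y" using Cauchy_convergent convergent_def by blast
  have yM: "y \<in> M" using M y sM unfolding closed_csubspace_def closed_sequential_limits by blast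
  have "(\<lambda>n. (norm (x - s n))\<^sup>2) \<longlonglongrightarrow> (norm (x - y))\<^sup>2" by (intro tendsto_intros y)
  moreover have "(\<lambda>n. d + 1 / real (Suc n)) \<longlonglongrightarrow> d + 0"
    by (intro tendsto_intros LIMSEQ_Suc[OF lim_1_over_n])
  ultimately have "(norm (x - y))\<^sup>2 \<le> d + 0"
    by (rule LIMSEQ_le) (use s in \<open>auto intro: less_imp_le\<close>)
  then have le: "(norm (x - y))\<^sup>2 \<le> d" by simp
  have "norm (x - y) \<le> norm (x - m)" if "m \<in> M" for m
    using order_trans[OF le dle[OF that]] by (rule power2_le_imp_le) simp
  then show ?thesis using yM by blast
qed

lemma projection_exists:
  fixes M :: "'h::chilbert_space set"
  assumes M: "closed_csubspace M"
  shows "\<exists>y\<in>M. \<forall>m\<in>M. cinner m (x - y) = 0"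
proof -
  note sub = closed_csubspace_imp_csubspace[OF M]
  obtain y where y: "y \<in> M" and min: "\<And>m. m \<in> M \<Longrightarrow> norm (x - y) \<le> norm (x - m)"
    using closest_point_exists[OF M] by blast
  have "cinner m (x - y) = 0" if m: "m \<in> M" for m
  proof (cases "m = 0")
    case False
    \<comment> \<open>The coefficient of the projection of \<open>x - y\<close> on \<open>m\<close>:
      moving \<open>y\<close> by \<open>c m\<close> lowers the squared distance by
      \<open>|<m, x - y>|^2 / |m|^2\<close>, which minimality forbids unless it is zero.\<close>
    define c where "c = cinner m (x - y) / of_real ((norm m)\<^sup>2)"
    have n0: "(norm m)\<^sup>2 \<noteq> 0" using False by simp
    have "y + scaleC c m \<in> M" by (intro csubspace_add csubspace_scaleC sub y m)
    from min[OF this] have "(norm (x - y))\<^sup>2 \<le> (norm ((x - y) - scaleC c m))\<^sup>2"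
      by (simp add: algebra_simps power_mono)
    also have "\<dots> = (norm (x - y))\<^sup>2 - 2 * Re (cinner (x - y) (scaleC c m)) + (cmod c * norm m)\<^sup>2"
      by (simp only: norm_diff_sq norm_scaleC)
    also have "cinner (x - y) (scaleC c m) = of_real ((cmod (cinner m (x - y)))\<^sup>2 / (norm m)\<^sup>2)"
      unfolding cinner_scaleC_right c_def complex_norm_square cinner_commute[of "x - y" m]
      by (simp add: field_simps mult_cnj_cmod)
    also have "(cmod c * norm m)\<^sup>2 = (cmod (cinner m (x - y)))\<^sup>2 / (norm m)\<^sup>2"
      using n0 by (simp add: c_def norm_divide power_mult_distrib power_divide norm_power)
        (simp add: field_simps power2_eq_square power4_eq_xxxx)
    finally have "(cmod (cinner m (x - y)))\<^sup>2 / (norm m)\<^sup>2 \<le> 0" by simp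
    then have "(cmod (cinner m (x - y)))\<^sup>2 \<le> 0" using n0 by (simp add: field_simps)
    then show ?thesis by simp
  qed simp
  then show ?thesis using y by blast
qed

text \<open>Two candidates differ by an element of \<open>M\<close> that is orthogonal to itself.
  This is the tool for computing concrete projections: a guess with the orthogonality property is
  the projection.\<close>

lemma proj_onto_eqI:
  fixes M :: "'h::complex_inner set"
  assumes M: "csubspace M" and y: "y \<in> M" "\<And>m. m \<in> M \<Longrightarrow> cinner m (x - y) = 0"
  shows "proj_onto M x = y"
  unfolding proj_onto_def
proof (rule the_equality)
  fix z assume z: "z \<in> M \<and> (\<forall>m\<in>M. cinner m (x - z) = 0)"
  have "y - z \<in> M" using csubspace_diff[OF M] y z by blast
  then have "cinner (y - z) (x - z) - cinner (y - z) (x - y) = 0" using y z by auto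
  then have "cinner (y - z) (y - z) = 0" by (simp add: cinner_simps algebra_simps)
  then show "z = y" by simp
qed (use y in auto)

lemma proj_onto_mem: "closed_csubspace M \<Longrightarrow> proj_onto M (x::'h::chilbert_space) \<in> M"
  and proj_onto_orth: "closed_csubspace M \<Longrightarrow> m \<in> M \<Longrightarrow> cinner m (x - proj_onto M x) = 0"
proof -
  have *: "proj_onto M x \<in> M \<and> (\<forall>m\<in>M. cinner m (x - proj_onto M x) = 0)" if M: "closed_csubspace M"
    using projection_exists[OF M, of x] proj_onto_eqI[OF closed_csubspace_imp_csubspace[OF M]] by metis
  show "closed_csubspace M \<Longrightarrow> proj_onto M x \<in> M" using * by blast
  show "closed_csubspace M \<Longrightarrow> m \<in> M \<Longrightarrow> cinner m (x - proj_onto M x) = 0" using * by blast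
qed

lemma proj_onto_self: "csubspace M \<Longrightarrow> x \<in> M \<Longrightarrow> proj_onto M x = x"
  by (rule proj_onto_eqI) auto

lemma closed_csubspace_orth_compl: "closed_csubspace (orth_compl M)"
proof -
  have "closed (orth_compl M)"
    unfolding closed_sequential_limits
  proof (intro allI impI, elim conjE)
    fix s l assume s: "\<forall>n. s n \<in> orth_compl M" "s \<longlonglongrightarrow> l"
    have "cinner m l = 0" if "m \<in> M" for m
    proof -
      have "(\<lambda>n. cinner m (s n)) \<longlonglongrightarrow> cinner m l" by (intro tendsto_cinner tendsto_const s)
      moreover have "(\<lambda>n. cinner m (s n)) = (\<lambda>n. 0)" using s that by (auto simp: orth_compl_def)
      ultimately show ?thesis by (simp add: LIMSEQ_const_iff)
    qed
    then show "l \<in> orth_compl M" by (simp add: orth_compl_def)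
  qed
  then show ?thesis
    by (auto simp: closed_csubspace_def csubspace_def orth_compl_def cinner_simps)
qed

lemma closed_csubspace_UNIV: "closed_csubspace UNIV"
  by (simp add: closed_csubspace_def csubspace_def)

lemma diff_proj_in_orth_compl:
  "closed_csubspace M \<Longrightarrow> x - proj_onto M (x::'h::chilbert_space) \<in> orth_compl M"
  by (simp add: orth_compl_def proj_onto_orth)

lemma proj_onto_zero_iff:
  fixes M :: "'h::chilbert_space set"
  assumes M: "closed_csubspace M"
  shows "proj_onto M x = 0 \<longleftrightarrow> x \<in> orth_compl M"
  using diff_proj_in_orth_compl[OF M, of x] proj_onto_eqI[of M 0 x]
    closed_csubspace_imp_csubspace[OF M] csubspace_0[of M]
  by (auto simp: orth_compl_def)

lemma orth_orth_compl:
  fixes M :: "'h::chilbert_space set"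
  assumes M: "closed_csubspace M"
  shows "orth_compl (orth_compl M) = M"
proof
  show "M \<subseteq> orth_compl (orth_compl M)"
    by (auto simp: orth_compl_def cinner_eq_zero_commute)
  show "orth_compl (orth_compl M) \<subseteq> M"
  proof
    fix x assume x: "x \<in> orth_compl (orth_compl M)"
    let ?p = "proj_onto M x"
    have "x - ?p \<in> orth_compl M" by (rule diff_proj_in_orth_compl[OF M])
    then have "cinner (x - ?p) x = 0" "cinner (x - ?p) ?p = 0"
      using x proj_onto_mem[OF M, of x] by (auto simp: orth_compl_def cinner_eq_zero_commute)
    then have "cinner (x - ?p) (x - ?p) = 0" by (simp add: cinner_simps)
    then show "x \<in> M" using proj_onto_mem[OF M, of x] by simp
  qed
qed

section \<open>Bounded operators\<close>

definition bclin :: "('h::complex_inner \<Rightarrow> 'h) \<Rightarrow> bool" where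
  "bclin T \<longleftrightarrow> (\<forall>x y. T (x + y) = T x + T y) \<and> (\<forall>c x. T (scaleC c x) = scaleC c (T x)) \<and>
     (\<exists>C. \<forall>x. norm (T x) \<le> C * norm x)"

lemma bclin_add: "bclin T \<Longrightarrow> T (x + y) = T x + T y"
  and bclin_scaleC: "bclin T \<Longrightarrow> T (scaleC c x) = scaleC c (T x)"
  by (auto simp: bclin_def)

lemma bclin_scaleR: "bclin T \<Longrightarrow> T (r *\<^sub>R x) = r *\<^sub>R T x"
  by (simp add: scaleR_scaleC bclin_scaleC)

lemma bclin_zero: "bclin T \<Longrightarrow> T 0 = 0"
  using bclin_scaleC[of T 0 0] by simp

lemma bclin_minus: "bclin T \<Longrightarrow> T (- x) = - T x"
  using bclin_scaleC[of T "-1" x] by (simp add: scaleC_minus_left)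

lemma bclin_diff: "bclin T \<Longrightarrow> T (x - y) = T x - T y"
  using bclin_add[of T x "-y"] by (simp add: bclin_minus)

lemma bclin_bounded_linear: "bclin T \<Longrightarrow> bounded_linear T"
  unfolding bclin_def by (metis bounded_linear_intro mult.commute scaleR_scaleC)

lemma bclin_tendsto: "bclin T \<Longrightarrow> (f \<longlongrightarrow> a) F \<Longrightarrow> ((\<lambda>x. T (f x)) \<longlongrightarrow> T a) F"
  by (rule bounded_linear.tendsto[OF bclin_bounded_linear])

lemma bclin_comp: "bclin S \<Longrightarrow> bclin T \<Longrightarrow> bclin (\<lambda>x. S (T x))"
  using bounded_linear_compose[OF bclin_bounded_linear[of S] bclin_bounded_linear[of T]]
  by (auto simp: bclin_def bounded_linear_def bounded_linear_axioms_def mult.commute)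

lemma bclin_id: "bclin (\<lambda>x. x)"
  by (auto simp: bclin_def intro!: exI[of _ 1])

lemma bclin_add_op:
  assumes S: "bclin S" and T: "bclin T"
  shows "bclin (\<lambda>x. S x + T x)"
proof -
  have "bounded_linear (\<lambda>x. S x + T x)"
    by (intro bounded_linear_add bclin_bounded_linear S T)
  then obtain C where "\<And>x. norm (S x + T x) \<le> norm x * C" using bounded_linear.bounded by blast
  then show ?thesis
    using S T by (auto simp: bclin_def scaleC_add_right mult.commute algebra_simps)
qed

lemma bclin_scaleC_op:
  assumes T: "bclin T"
  shows "bclin (\<lambda>x. scaleC a (T x))"
proof -
  have "bounded_linear (\<lambda>x. scaleC a (T x))"
    by (intro bounded_linear_compose[OF bounded_linear_scaleC] bclin_bounded_linear T)
  then obtain C where "\<And>x. norm (scaleC a (T x)) \<le> norm x * C" using bounded_linear.bounded by blast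
  then show ?thesis
    using T by (auto simp: bclin_def scaleC_add_right scaleC_scaleC mult.commute)
qed

lemma bclin_diff_op: "bclin S \<Longrightarrow> bclin T \<Longrightarrow> bclin (\<lambda>x. S x - T x)"
  using bclin_add_op[of S "\<lambda>x. scaleC (-1) (T x)"] bclin_scaleC_op[of T "-1"]
  by (simp add: scaleC_minus_left)

text \<open>Complex scalars are essential: evaluating the vanishing form of \<open>D = S - T\<close>
  at \<open>z + x\<close> and at \<open>z + \<i>x\<close> separates the cross terms
  \<open><z, D x>\<close> and \<open><x, D z>\<close>. This gives uniqueness of the operator behind
  a quadratic form.\<close>

lemma bclin_eq_on_quadratic_form:
  assumes S: "bclin S" and T: "bclin T" and q: "\<And>x. cinner x (S x) = cinner x (T x)"
  shows "S x = T x"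
proof -
  define D where "D = (\<lambda>x. S x - T x)"
  have D: "bclin D" unfolding D_def by (rule bclin_diff_op[OF S T])
  have q0: "cinner x (D x) = 0" for x by (simp add: D_def cinner_simps q)
  have "cinner z (D x) = 0" for z x
  proof -
    have "cinner (z + x) (D (z + x)) = 0" "cinner (z + scaleC \<i> x) (D (z + scaleC \<i> x)) = 0"
      by (rule q0)+
    then have "cinner z (D x) + cinner x (D z) = 0" "\<i> * cinner z (D x) - \<i> * cinner x (D z) = 0"
      by (simp_all add: bclin_add[OF D] bclin_scaleC[OF D] cinner_simps q0)
    then have "cinner z (D x) + cinner x (D z) = 0" "cinner z (D x) = cinner x (D z)"
      by (simp_all add: right_diff_distrib[symmetric])
    then show ?thesis by (metis mult_2 mult_eq_0_iff zero_neq_numeral)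
  qed
  then have "D x = 0" using cinner_self_eq_zero by blast
  then show ?thesis by (simp add: D_def)
qed

text \<open>The same four-term expression appears in \<open>bfc\<close>, which is why operators
  given by quadratic forms can be matched with that relation.\<close>

lemma bclin_polarization:
  assumes T: "bclin T"
  shows "cinner z (T x) = (\<Sum>k<4. (inverse \<i>) ^ k *
     cinner (z + scaleC (\<i> ^ k) x) (T (z + scaleC (\<i> ^ k) x))) / 4"
proof -
  have s4: "sum f {..<4::nat} = f 0 + f 1 + f 2 + f 3" for f :: "nat \<Rightarrow> complex"
    by (simp add: numeral_eq_Suc)
  show ?thesis
    unfolding s4 bclin_add[OF T] bclin_scaleC[OF T] cinner_simps
    by (simp add: power2_eq_square power3_eq_cube complex_eq_iff)
qed

lemma bclin_selfadjoint_iff_real: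
  assumes T: "bclin T" and r: "\<And>x. Im (cinner x (T x)) = 0"
  shows "cinner (T x) y = cinner x (T y)"
proof -
  have "Im (cinner (x + y) (T (x + y))) = 0" "Im (cinner (x + scaleC \<i> y) (T (x + scaleC \<i> y))) = 0"
    by (rule r)+
  then have "Im (cinner x (T y)) + Im (cinner y (T x)) = 0" "Re (cinner x (T y)) - Re (cinner y (T x)) = 0"
    using r[of x] r[of y] by (simp_all add: bclin_add[OF T] bclin_scaleC[OF T] cinner_simps)
  then have "cinner x (T y) = cnj (cinner y (T x))" by (simp add: complex_eq_iff)
  then show ?thesis by (metis cinner_commute)
qed

theorem Riesz_representation:
  fixes \<phi> :: "'h::chilbert_space \<Rightarrow> complex"
  assumes add: "\<And>x y. \<phi> (x + y) = \<phi> x + \<phi> y" and sc: "\<And>c x. \<phi> (scaleC c x) = c * \<phi> x"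
    and bd: "\<And>x. cmod (\<phi> x) \<le> C * norm x"
  shows "\<exists>y. \<forall>x. \<phi> x = cinner y x"
proof (cases "\<forall>x. \<phi> x = 0")
  case True
  then show ?thesis by (intro exI[of _ 0]) simp
next
  case False
  define M where "M = {x. \<phi> x = 0}"
  have bl: "bounded_linear \<phi>"
    by (rule bounded_linear_intro[where K=C])
      (auto simp: add scaleR_scaleC sc scaleR_conv_of_real bd mult.commute)
  have phi0: "\<phi> 0 = 0" using sc[of 0 0] by simp
  have "closed M"
    unfolding M_def using continuous_closed_preimage_constant[OF bounded_linear.continuous_on[OF bl continuous_on_id], of UNIV 0]
    by simp
  then have M: "closed_csubspace M"
    by (auto simp: closed_csubspace_def csubspace_def M_def add sc phi0)
  obtain x0 where x0: "\<phi> x0 \<noteq> 0" using False by blast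
  define u where "u = x0 - proj_onto M x0"
  have diff: "\<phi> (x - y) = \<phi> x - \<phi> y" for x y by (rule bounded_linear.linear[OF bl, THEN linear_diff])
  have uM: "\<phi> u = \<phi> x0" using proj_onto_mem[OF M, of x0] by (simp add: u_def diff M_def)
  have u0: "u \<noteq> 0" using uM x0 phi0 by auto
  define n2 where "n2 = complex_of_real ((norm u)\<^sup>2)"
  have n2: "n2 \<noteq> 0" "cinner u u = n2" using u0 by (auto simp: n2_def cinner_norm)
  \<comment> \<open>\<open>x\<close> splits into a multiple of \<open>u\<close> and an element of
    the kernel of \<open>\<phi>\<close>, to which \<open>u\<close> is orthogonal. The coefficient is
    conjugated because \<open>cinner\<close> is conjugate-linear in its first argument.\<close>
  have "\<phi> x = cinner (scaleC (cnj (\<phi> u / n2)) u) x" for x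
  proof -
    have "x - scaleC (\<phi> x / \<phi> u) u \<in> M" using uM x0 by (simp add: M_def diff sc)
    then have "cinner (x - scaleC (\<phi> x / \<phi> u) u) u = 0" unfolding u_def by (rule proj_onto_orth[OF M])
    then have "cinner u (x - scaleC (\<phi> x / \<phi> u) u) = 0" by (simp add: cinner_eq_zero_commute)
    then have "cinner u x = \<phi> x / \<phi> u * n2" by (simp add: cinner_simps n2)
    then show ?thesis using n2 x0 uM by (simp add: cinner_scaleC_left)
  qed
  then show ?thesis by blast
qed

lemma bclin_proj_onto:
  fixes M :: "'h::chilbert_space set"
  assumes M: "closed_csubspace M"
  shows "bclin (proj_onto M)" "norm (proj_onto M x) \<le> norm x"
    "cinner (proj_onto M x) y = cinner x (proj_onto M y)"
    "cinner x (proj_onto M x) = of_real ((norm (proj_onto M x))\<^sup>2)"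
proof -
  note sub = closed_csubspace_imp_csubspace[OF M]
  have add: "proj_onto M (x + y) = proj_onto M x + proj_onto M y" for x y
  proof (rule proj_onto_eqI[OF sub])
    show "proj_onto M x + proj_onto M y \<in> M" by (intro csubspace_add sub proj_onto_mem M)
    show "cinner m (x + y - (proj_onto M x + proj_onto M y)) = 0" if "m \<in> M" for m
      using proj_onto_orth[OF M that, of x] proj_onto_orth[OF M that, of y] by (simp add: cinner_simps)
  qed
  have sc: "proj_onto M (scaleC c x) = scaleC c (proj_onto M x)" for c x
  proof (rule proj_onto_eqI[OF sub])
    show "scaleC c (proj_onto M x) \<in> M" by (intro csubspace_scaleC sub proj_onto_mem M)
    show "cinner m (scaleC c x - scaleC c (proj_onto M x)) = 0" if "m \<in> M" for m
      using proj_onto_orth[OF M that, of x] by (simp add: cinner_simps flip: right_diff_distrib)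
  qed
  have *: "cinner (proj_onto M x) y = cinner (proj_onto M x) (proj_onto M y)" for x y
    using proj_onto_orth[OF M proj_onto_mem[OF M], of x y] by (simp add: cinner_simps)
  have **: "cinner x (proj_onto M y) = cinner (proj_onto M x) (proj_onto M y)" for x y
    using *[of y x] by (metis cinner_commute)
  have n: "norm (proj_onto M x) \<le> norm x" for x
  proof (cases "proj_onto M x = 0")
    case False
    have "norm (proj_onto M x) * norm (proj_onto M x) = cmod (cinner x (proj_onto M x))"
      by (simp add: ** cinner_norm norm_power power2_eq_square norm_mult)
    also have "\<dots> \<le> norm x * norm (proj_onto M x)" by (rule Cauchy_Schwarz_cinner)
    finally show ?thesis using False by simp
  qed simp
  show "norm (proj_onto M x) \<le> norm x" by (rule n)
  show "bclin (proj_onto M)"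
    using add sc n by (auto simp: bclin_def intro!: exI[of _ 1])
  show "cinner (proj_onto M x) y = cinner x (proj_onto M y)" using * ** by simp
  show "cinner x (proj_onto M x) = of_real ((norm (proj_onto M x))\<^sup>2)" unfolding **[of x x] cinner_norm ..
qed

text \<open>The form \<open>\<langle>x, T\<^sub>n x\<rangle>\<close> determines the weak limit by polarization, and the
  Riesz theorem turns the limiting sesquilinear form into an operator.\<close>

lemma weak_limit_operator:
  fixes T :: "nat \<Rightarrow> 'h::chilbert_space \<Rightarrow> 'h"
  assumes T: "\<And>n. bclin (T n)" and bd: "\<And>n x. norm (T n x) \<le> C * norm x"
    and conv: "\<And>x. (\<lambda>n. cinner x (T n x)) \<longlonglongrightarrow> L x"
  shows "\<exists>S. bclin S \<and> (\<forall>x. cinner x (S x) = L x) \<and> (\<forall>x z. (\<lambda>n. cinner z (T n x)) \<longlonglongrightarrow> cinner z (S x))"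
proof -
  define F where "F z x = (\<Sum>k<4. (inverse \<i>) ^ k * L (z + scaleC (\<i> ^ k) x)) / 4" for z x
  have F: "(\<lambda>n. cinner z (T n x)) \<longlonglongrightarrow> F z x" for z x
    unfolding F_def bclin_polarization[OF T, of z _ x]
    by (intro tendsto_intros conv) auto
  have F': "(\<lambda>n. cinner (T n x) z) \<longlonglongrightarrow> cnj (F z x)" for z x
    using tendsto_cnj[OF F[of z x]] by (simp add: cinner_commute[symmetric])
  have "\<exists>y. \<forall>z. cnj (F z x) = cinner y z" for x
  proof (rule Riesz_representation)
    show "cnj (F (u + v) x) = cnj (F u x) + cnj (F v x)" for u v
    proof (rule LIMSEQ_unique[OF F'])
      show "(\<lambda>n. cinner (T n x) (u + v)) \<longlonglongrightarrow> cnj (F u x) + cnj (F v x)"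
        unfolding cinner_add_right by (intro tendsto_add F')
    qed
    show "cnj (F (scaleC c u) x) = c * cnj (F u x)" for c u
    proof (rule LIMSEQ_unique[OF F'])
      show "(\<lambda>n. cinner (T n x) (scaleC c u)) \<longlonglongrightarrow> c * cnj (F u x)"
        unfolding cinner_scaleC_right by (intro tendsto_mult F' tendsto_const)
    qed
    show "cmod (cnj (F u x)) \<le> (C * norm x) * norm u" for u
    proof (rule LIMSEQ_le_const2[OF tendsto_norm[OF F']])
      show "\<exists>N. \<forall>n\<ge>N. cmod (cinner (T n x) u) \<le> C * norm x * norm u"
        by (meson Cauchy_Schwarz_cinner bd mult_right_mono norm_ge_zero order_trans)
    qed
  qed
  then obtain S where "\<And>x z. cnj (F z x) = cinner (S x) z" by metis
  then have S: "cinner z (S x) = F z x" for x z by (metis cinner_commute complex_cnj_cnj)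
  have lim: "(\<lambda>n. cinner z (T n x)) \<longlonglongrightarrow> cinner z (S x)" for x z using F S by simp
  have "bclin S"
    unfolding bclin_def
  proof (intro conjI allI)
    show "S (x + y) = S x + S y" for x y
    proof (rule cinner_ext)
      fix z
      have "(\<lambda>n. cinner z (T n (x + y))) \<longlonglongrightarrow> cinner z (S x) + cinner z (S y)"
        unfolding bclin_add[OF T] cinner_add_right by (intro tendsto_add lim)
      then show "cinner z (S (x + y)) = cinner z (S x + S y)"
        using LIMSEQ_unique[OF lim] by (simp add: cinner_add_right)
    qed
    show "S (scaleC c x) = scaleC c (S x)" for c x
    proof (rule cinner_ext)
      fix z
      have "(\<lambda>n. cinner z (T n (scaleC c x))) \<longlonglongrightarrow> c * cinner z (S x)"
        unfolding bclin_scaleC[OF T] cinner_scaleC_right by (intro tendsto_mult tendsto_const lim)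
      then show "cinner z (S (scaleC c x)) = cinner z (scaleC c (S x))"
        using LIMSEQ_unique[OF lim] by (simp add: cinner_scaleC_right)
    qed
    have "norm (S x) \<le> C * norm x" for x
    proof (cases "S x = 0")
      case True
      have "0 \<le> C * norm x" using bd[of 0 x] norm_ge_zero order_trans by blast
      then show ?thesis using True by simp
    next
      case False
      have "cmod (cinner (S x) (S x)) \<le> C * norm x * norm (S x)"
      proof (rule LIMSEQ_le_const2[OF tendsto_norm[OF lim]])
        show "\<exists>N. \<forall>n\<ge>N. cmod (cinner (S x) (T n x)) \<le> C * norm x * norm (S x)"
          by (metis Cauchy_Schwarz_cinner bd mult.commute mult_right_mono norm_ge_zero order_trans)
      qed
      then have "norm (S x) * norm (S x) \<le> C * norm x * norm (S x)"
        by (simp add: cinner_norm power2_eq_square norm_mult)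
      then show ?thesis using False by simp
    qed
    then show "\<exists>C. \<forall>x. norm (S x) \<le> C * norm x" by blast
  qed
  moreover have "cinner x (S x) = L x" for x using LIMSEQ_unique[OF lim conv] .
  ultimately show ?thesis using lim by blast
qed

section \<open>Functional calculus of a spectral measure\<close>

definition bdd_borel :: "(real \<Rightarrow> complex) \<Rightarrow> bool" where
  "bdd_borel f \<longleftrightarrow> f \<in> borel_measurable borel \<and> (\<exists>C. \<forall>s. cmod (f s) \<le> C)"

lemma bdd_borelI: "f \<in> borel_measurable borel \<Longrightarrow> (\<And>s. cmod (f s) \<le> C) \<Longrightarrow> bdd_borel f"
  by (auto simp: bdd_borel_def)

lemma bdd_borel_bound: "bdd_borel f \<Longrightarrow> \<exists>C\<ge>0. \<forall>s. cmod (f s) \<le> C"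
  unfolding bdd_borel_def by (meson norm_ge_zero order_trans)

lemma bdd_borel_indicator: "S \<in> sets borel \<Longrightarrow> bdd_borel (indicator S)"
  by (rule bdd_borelI[where C=1]) (auto simp: indicator_def)

lemma bdd_borel_const: "bdd_borel (\<lambda>s. c)"
  by (rule bdd_borelI[where C="cmod c"]) auto

lemma bdd_borel_add:
  assumes f: "bdd_borel f" and g: "bdd_borel g"
  shows "bdd_borel (\<lambda>s. f s + g s)"
proof -
  obtain C D where "\<And>s. cmod (f s) \<le> C" "\<And>s. cmod (g s) \<le> D" using f g by (auto simp: bdd_borel_def)
  then have "cmod (f s + g s) \<le> C + D" for s by (meson add_mono norm_triangle_ineq order_trans)
  then show ?thesis using f g by (intro bdd_borelI[where C="C+D"]) (auto simp: bdd_borel_def)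
qed

lemma bdd_borel_mult:
  assumes f: "bdd_borel f" and g: "bdd_borel g"
  shows "bdd_borel (\<lambda>s. f s * g s)"
proof -
  obtain C D where "\<And>s. cmod (f s) \<le> C" "\<And>s. cmod (g s) \<le> D" using f g by (auto simp: bdd_borel_def)
  then have "cmod (f s * g s) \<le> C * D" for s
    by (simp add: norm_mult) (meson mult_mono norm_ge_zero order_trans)
  then show ?thesis using f g by (intro bdd_borelI[where C="C*D"]) (auto simp: bdd_borel_def)
qed

lemma bdd_borel_scale: "bdd_borel f \<Longrightarrow> bdd_borel (\<lambda>s. c * f s)"
  by (rule bdd_borel_mult[OF bdd_borel_const])

lemma bdd_borel_diff: "bdd_borel f \<Longrightarrow> bdd_borel g \<Longrightarrow> bdd_borel (\<lambda>s. f s - g s)"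
  using bdd_borel_add[of f "\<lambda>s. (-1) * g s"] bdd_borel_scale[of g "-1"] by simp

lemma bdd_borel_cnj: "bdd_borel f \<Longrightarrow> bdd_borel (\<lambda>s. cnj (f s))"
  using measurable_compose[OF _ borel_measurable_continuous_onI[of cnj], of f borel]
  by (auto simp: bdd_borel_def intro: continuous_intros)

lemma bdd_borel_sum: "finite I \<Longrightarrow> (\<And>i. i \<in> I \<Longrightarrow> bdd_borel (f i)) \<Longrightarrow> bdd_borel (\<lambda>s. \<Sum>i\<in>I. f i s)"
  by (induction I rule: finite_induct) (auto intro: bdd_borel_add bdd_borel_const)

text \<open>Simple approximants can be chosen with \<open>|F n s| \<le> 2 |f s|\<close>, so the
  limit step only meets uniformly bounded pointwise convergence, exactly what dominated convergence
  handles.\<close>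

lemma bdd_borel_induct [consumes 1, case_names indicator scale add lim]:
  assumes f: "bdd_borel f"
    and ind: "\<And>S. S \<in> sets borel \<Longrightarrow> P (indicator S)"
    and scale: "\<And>c f. bdd_borel f \<Longrightarrow> P f \<Longrightarrow> P (\<lambda>s. c * f s)"
    and add: "\<And>f g. bdd_borel f \<Longrightarrow> bdd_borel g \<Longrightarrow> P f \<Longrightarrow> P g \<Longrightarrow> P (\<lambda>s. f s + g s)"
    and lim: "\<And>F g C. (\<And>n. bdd_borel (F n)) \<Longrightarrow> (\<And>n. P (F n)) \<Longrightarrow> (\<And>n s. cmod (F n s) \<le> C)
       \<Longrightarrow> (\<And>s. (\<lambda>n. F n s) \<longlonglongrightarrow> g s) \<Longrightarrow> bdd_borel g \<Longrightarrow> P g"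
  shows "P f"
proof -
  obtain C where C: "\<And>s. cmod (f s) \<le> C" using f by (auto simp: bdd_borel_def)
  obtain F where F: "\<And>i. simple_function borel (F i)" "\<And>x. (\<lambda>i. F i x) \<longlonglongrightarrow> f x"
      "\<And>i x. dist (F i x) 0 \<le> 2 * dist (f x) 0"
    using borel_measurable_implies_sequence_metric[of f borel 0] f by (auto simp: bdd_borel_def)
  have FC: "cmod (F n s) \<le> 2 * C" for n s
    using F(3)[of n s] C[of s] by (simp add: dist_norm)
  have "bdd_borel (F n) \<and> P (F n)" for n
  proof -
    have fin: "finite (range (F n))" using F(1)[of n] by (simp add: simple_function_def)
    have meas: "F n -` {y} \<in> sets borel" for y
      using simple_functionD(2)[OF F(1)[of n], of "{y}"] by simp
    have *: "bdd_borel (\<lambda>s. \<Sum>y\<in>Y. y * indicator (F n -` {y}) s) \<and> P (\<lambda>s. \<Sum>y\<in>Y. y * indicator (F n -` {y}) s)"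
      if "finite Y" for Y
      using that
    proof (induction Y rule: finite_induct)
      case empty
      show ?case using ind[of "{}"] bdd_borel_const[of 0] by (simp add: indicator_def[abs_def])
    next
      case (insert y Y)
      have b: "bdd_borel (\<lambda>s. y * indicator (F n -` {y}) s)"
        by (intro bdd_borel_scale bdd_borel_indicator meas)
      have "P (\<lambda>s. y * indicator (F n -` {y}) s)"
        by (intro scale bdd_borel_indicator ind meas)
      then show ?case
        unfolding sum.insert[OF insert.hyps] using insert.IH b \<open>P (\<lambda>s. y * indicator (F n -` {y}) s)\<close>
        by (intro conjI bdd_borel_add[OF b] add[OF b]) auto
    qed
    have "(\<Sum>y\<in>range (F n). y * indicator (F n -` {y}) s) = F n s" for s
    proof -
      have "(\<Sum>y\<in>range (F n). y * indicator (F n -` {y}) s) = (\<Sum>y\<in>{F n s}. y * indicator (F n -` {y}) s)"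
        by (rule sum.mono_neutral_right[OF fin]) (auto simp: indicator_def)
      then show ?thesis by (simp add: indicator_def)
    qed
    then show ?thesis using *[OF fin] by simp
  qed
  then show ?thesis using lim[of F "2*C" f] FC F(2) f by blast
qed

text \<open>Common ground of two families: the measures \<open>spec_meas E\<close> of a given
  spectral measure, and the measures \<open>mu\<close> solving a moment problem, from which a
  spectral measure is still to be built. That the integral of \<open>f\<close> is a quadratic form
  in \<open>x\<close> is not assumed; it is what the existence of a representing operator
  expresses.\<close>

locale form_family =
  fixes \<mu> :: "'h::chilbert_space \<Rightarrow> real measure"
  assumes sets_mu: "\<And>x. sets (\<mu> x) = sets borel"
    and emeasure_mu: "\<And>x. emeasure (\<mu> x) UNIV \<le> ennreal ((norm x)\<^sup>2)"
begin

lemma space_mu: "space (\<mu> x) = UNIV"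
  using sets_eq_imp_space_eq[OF sets_mu] by simp

lemma finite_mu: "finite_measure (\<mu> x)"
  by standard (use emeasure_mu[of x] in \<open>auto simp: space_mu top_unique\<close>)

lemma measure_mu: "measure (\<mu> x) UNIV \<le> (norm x)\<^sup>2"
  using emeasure_mu[of x] by (simp add: measure_def enn2real_leI)

lemma measurable_mu: "bdd_borel f \<Longrightarrow> f \<in> borel_measurable (\<mu> x)"
  by (simp add: bdd_borel_def measurable_cong_sets[OF sets_mu refl])

lemma integrable_mu: "bdd_borel f \<Longrightarrow> integrable (\<mu> x) f"
proof -
  assume f: "bdd_borel f"
  then obtain C where "\<And>s. cmod (f s) \<le> C" by (auto simp: bdd_borel_def)
  then show ?thesis
    by (intro finite_measure.integrable_const_bound[OF finite_mu, of f C] measurable_mu f) auto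
qed

lemma integral_mu_bound:
  assumes f: "bdd_borel f" and C: "\<And>s. cmod (f s) \<le> C"
  shows "cmod (integral\<^sup>L (\<mu> x) f) \<le> C * (norm x)\<^sup>2"
proof -
  interpret finite_measure "\<mu> x" by (rule finite_mu)
  have C0: "0 \<le> C" using C norm_ge_zero order_trans by blast
  have "cmod (integral\<^sup>L (\<mu> x) f) \<le> (\<integral>s. cmod (f s) \<partial>\<mu> x)" by (rule integral_norm_bound)
  also have "\<dots> \<le> (\<integral>s. C \<partial>\<mu> x)"
    by (intro integral_mono integrable_norm integrable_mu f C) simp
  also have "\<dots> = C * measure (\<mu> x) UNIV" by (simp add: space_mu)
  also have "\<dots> \<le> C * (norm x)\<^sup>2" by (intro mult_left_mono measure_mu C0)
  finally show ?thesis .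
qed

lemma integral_mu_tendsto:
  assumes F: "\<And>n. bdd_borel (F n)" and C: "\<And>n s. cmod (F n s) \<le> C"
    and lim: "\<And>s. (\<lambda>n. F n s) \<longlonglongrightarrow> g s" and g: "bdd_borel g"
  shows "(\<lambda>n. integral\<^sup>L (\<mu> x) (F n)) \<longlonglongrightarrow> integral\<^sup>L (\<mu> x) g"
proof (rule integral_dominated_convergence)
  interpret finite_measure "\<mu> x" by (rule finite_mu)
  show "integrable (\<mu> x) (\<lambda>s. C)" by simp
qed (use assms in \<open>auto intro: measurable_mu\<close>)

section \<open>Operators represented by a family of measures\<close>

definition represents :: "(real \<Rightarrow> complex) \<Rightarrow> ('h \<Rightarrow> 'h) \<Rightarrow> bool" where
  "represents f T \<longleftrightarrow> bclin T \<and> (\<forall>x. cinner x (T x) = integral\<^sup>L (\<mu> x) f)"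

lemma represents_unique: "represents f S \<Longrightarrow> represents f T \<Longrightarrow> S = T"
  unfolding represents_def using bclin_eq_on_quadratic_form[of S T] by auto

lemma represents_add:
  "bdd_borel f \<Longrightarrow> bdd_borel g \<Longrightarrow> represents f S \<Longrightarrow> represents g T \<Longrightarrow>
     represents (\<lambda>s. f s + g s) (\<lambda>x. S x + T x)"
  by (auto simp: represents_def bclin_add_op cinner_add_right integrable_mu)

lemma represents_scale: "represents f S \<Longrightarrow> represents (\<lambda>s. c * f s) (\<lambda>x. scaleC c (S x))"
  by (auto simp: represents_def bclin_scaleC_op cinner_scaleC_right)

text \<open>Polarization bounds \<open><z, T x>\<close> by \<open>C/4\<close> times a sum of four
  squared norms, and that sum is 8 for unit vectors; hence the factor 2. The point is uniformity in
  \<open>f\<close> for a fixed bound \<open>C\<close>.\<close>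

lemma represents_norm:
  assumes T: "represents f T" and f: "bdd_borel f" and C: "\<And>s. cmod (f s) \<le> C"
  shows "norm (T x) \<le> 2 * C * norm x"
proof -
  have bT: "bclin T" and q: "\<And>x. cinner x (T x) = integral\<^sup>L (\<mu> x) f"
    using T by (auto simp: represents_def)
  have unit: "cmod (cinner z (T x)) \<le> 2 * C" if "norm z = 1" "norm x = 1" for x z
  proof -
    have s4: "sum g {..<4::nat} = g 0 + g 1 + g 2 + g 3" for g :: "nat \<Rightarrow> real"
      by (simp add: numeral_eq_Suc)
    have "cmod (cinner z (T x)) \<le> (\<Sum>k<4. C * (norm (z + scaleC (\<i> ^ k) x))\<^sup>2) / 4"
      unfolding bclin_polarization[OF bT, of z x] norm_divide
      by (intro divide_mono order_trans[OF norm_sum] sum_mono)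
         (auto simp: norm_mult norm_power norm_inverse q intro: integral_mu_bound[OF f C])
    also have "\<dots> = C * (\<Sum>k<4. (norm (z + scaleC (\<i> ^ k) x))\<^sup>2) / 4"
      by (simp add: sum_distrib_left)
    also have "(\<Sum>k<4. (norm (z + scaleC (\<i> ^ k) x))\<^sup>2) = 8"
    proof -
      have "(norm (z + scaleC (\<i> ^ k) x))\<^sup>2 = 2 + 2 * Re (\<i> ^ k * cinner z x)" for k
        using that by (simp add: norm_add_sq norm_scaleC norm_power cinner_scaleC_right)
      from this[of 0] this[of 1] this[of 2] this[of 3] show ?thesis
        unfolding s4 by (simp add: power3_eq_cube)
    qed
    finally show ?thesis by simp
  qed
  have C0: "0 \<le> C" using C norm_ge_zero order_trans by blast
  show ?thesis
  proof (cases "x = 0 \<or> T x = 0")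
    case True
    then show ?thesis using C0 bclin_zero[OF bT] by auto
  next
    case False
    let ?u = "(1 / norm x) *\<^sub>R x" and ?v = "(1 / norm (T x)) *\<^sub>R T x"
    have "cmod (cinner ?v (T ?u)) \<le> 2 * C" using False by (intro unit) auto
    also have "cinner ?v (T ?u) = of_real (norm (T x) / norm x)"
      using False by (simp add: bclin_scaleR[OF bT] cinner_scaleR_left cinner_scaleR_right cinner_norm
          field_simps power2_eq_square)
    finally have "norm (T x) / norm x \<le> 2 * C" by (simp add: norm_divide)
    then show ?thesis using False by (simp add: field_simps)
  qed
qed

text \<open>Dominated convergence gives the limit of the quadratic forms and
  \<open>represents_norm\<close> a uniform operator bound; these are the inputs of
  \<open>weak_limit_operator\<close>.\<close>

lemma represents_lim:
  assumes F: "\<And>n. bdd_borel (F n)" and T: "\<And>n. represents (F n) (T n)"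
    and C: "\<And>n s. cmod (F n s) \<le> C"
    and lim: "\<And>s. (\<lambda>n. F n s) \<longlonglongrightarrow> g s" and g: "bdd_borel g"
  shows "\<exists>S. represents g S \<and> (\<forall>x z. (\<lambda>n. cinner z (T n x)) \<longlonglongrightarrow> cinner z (S x))"
proof -
  have "\<exists>S. bclin S \<and> (\<forall>x. cinner x (S x) = integral\<^sup>L (\<mu> x) g) \<and>
      (\<forall>x z. (\<lambda>n. cinner z (T n x)) \<longlonglongrightarrow> cinner z (S x))"
  proof (rule weak_limit_operator)
    show "bclin (T n)" for n using T by (simp add: represents_def)
    show "norm (T n x) \<le> (2 * C) * norm x" for n x using represents_norm[OF T F C] by simp
    show "(\<lambda>n. cinner x (T n x)) \<longlonglongrightarrow> integral\<^sup>L (\<mu> x) g" for x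
      using integral_mu_tendsto[OF F C lim g] T by (simp add: represents_def)
  qed
  then show ?thesis by (auto simp: represents_def)
qed

definition opr :: "(real \<Rightarrow> complex) \<Rightarrow> 'h \<Rightarrow> 'h" where
  "opr f = (THE T. represents f T)"

lemma opr_eqI: "represents f T \<Longrightarrow> opr f = T"
  unfolding opr_def using represents_unique by blast

lemma represents_opr: "represents f T \<Longrightarrow> represents f (opr f)"
  using opr_eqI by metis

end

text \<open>The quadratic form of a spectral measure on each Borel set is represented by a projection;
  boundedly pointwise limits extend this to all bounded Borel functions.\<close>

locale spectral =
  fixes K :: "'h::chilbert_space set" and E
  assumes K: "closed_csubspace K" and E: "spectral_measure_on K E"
begin

lemma E_proj: "S \<in> sets borel \<Longrightarrow> \<exists>M. closed_csubspace M \<and> M \<subseteq> K \<and> E S = proj_onto M"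
  and E_UNIV: "E UNIV = proj_onto K"
  and E_Int: "S \<in> sets borel \<Longrightarrow> T \<in> sets borel \<Longrightarrow> E (S \<inter> T) = E S \<circ> E T"
  and E_sum: "range F \<subseteq> sets borel \<Longrightarrow> disjoint_family F \<Longrightarrow> (\<lambda>n. \<Sum>i<n. E (F i) x) \<longlonglongrightarrow> E (\<Union>i. F i) x"
  using E by (auto simp: spectral_measure_on_def)

lemma bclin_E: "S \<in> sets borel \<Longrightarrow> bclin (E S)"
  and norm_E: "S \<in> sets borel \<Longrightarrow> norm (E S x) \<le> norm x"
  and E_form: "S \<in> sets borel \<Longrightarrow> cinner x (E S x) = of_real ((norm (E S x))\<^sup>2)"
  and E_sym: "S \<in> sets borel \<Longrightarrow> cinner (E S x) y = cinner x (E S y)"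
  using E_proj[of S] bclin_proj_onto by metis+

text \<open>Applied to a sequence of empty sets, countable additivity makes \<open>n\<close> times
  \<open>E {} x\<close> converge, so its constant increment must be zero.\<close>

lemma E_empty: "E {} x = 0"
proof -
  have "(\<lambda>n. \<Sum>i<n. E {} x) \<longlonglongrightarrow> E {} x"
    using E_sum[of "\<lambda>i. {}" x] by (simp add: disjoint_family_on_def)
  then have l: "(\<lambda>n. real n *\<^sub>R E {} x) \<longlonglongrightarrow> E {} x" by (simp add: scaleR_conv_of_real sum_constant_scaleR)
  from tendsto_diff[OF LIMSEQ_Suc[OF l] l] have "(\<lambda>n. E {} x) \<longlonglongrightarrow> 0" by (simp flip: scaleR_diff_left)
  then show ?thesis by (simp add: LIMSEQ_const_iff)
qed

lemma emeasure_spec_meas: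
  assumes S: "S \<in> sets borel"
  shows "emeasure (spec_meas E x) S = ennreal ((norm (E S x))\<^sup>2)"
proof (rule emeasure_measure_of[where \<Omega>=UNIV and A="sets borel" and \<mu>="\<lambda>S. ennreal ((norm (E S x))\<^sup>2)"])
  show "spec_meas E x = measure_of UNIV (sets borel) (\<lambda>S. ennreal ((norm (E S x))\<^sup>2))"
    by (simp add: spec_meas_def)
  have "sets (spec_meas E x) = sets borel"
    unfolding spec_meas_def using sets.sigma_sets_eq[of "borel :: real measure"] by simp
  then show "S \<in> sets (spec_meas E x)" using S by simp
  show "positive (sets (spec_meas E x)) (\<lambda>S. ennreal ((norm (E S x))\<^sup>2))"
    by (simp add: positive_def E_empty)
  show "countably_additive (sets (spec_meas E x)) (\<lambda>S. ennreal ((norm (E S x))\<^sup>2))"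
    unfolding countably_additive_def \<open>sets (spec_meas E x) = sets borel\<close>
  proof (intro allI impI)
    fix F :: "nat \<Rightarrow> real set"
    assume F: "range F \<subseteq> sets borel" "disjoint_family F" "\<Union> (range F) \<in> sets borel"
    have Fi: "F i \<in> sets borel" for i using F by auto
    have "(\<lambda>n. Re (cinner x (\<Sum>i<n. E (F i) x))) \<longlonglongrightarrow> Re (cinner x (E (\<Union>i. F i) x))"
      by (intro tendsto_Re tendsto_cinner tendsto_const E_sum F)
    moreover have "Re (cinner x (\<Sum>i<n. E (F i) x)) = (\<Sum>i<n. (norm (E (F i) x))\<^sup>2)" for n
      by (induction n) (simp_all add: cinner_add_right E_form[OF Fi])
    ultimately have "(\<lambda>i. (norm (E (F i) x))\<^sup>2) sums (norm (E (\<Union>i. F i) x))\<^sup>2"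
      by (simp add: sums_def E_form[OF F(3)])
    then show "(\<Sum>i. ennreal ((norm (E (F i) x))\<^sup>2)) = ennreal ((norm (E (\<Union> (range F)) x))\<^sup>2)"
      by (intro suminf_ennreal_eq) auto
  qed
qed simp

sublocale form_family "spec_meas E"
proof
  show "sets (spec_meas E x) = sets borel" for x
    unfolding spec_meas_def using sets.sigma_sets_eq[of "borel :: real measure"] by simp
  show "emeasure (spec_meas E x) UNIV \<le> ennreal ((norm x)\<^sup>2)" for x
    using norm_E[of UNIV x] by (simp add: emeasure_spec_meas ennreal_leI power_mono)
qed

section \<open>The calculus of a spectral measure as a star-homomorphism\<close>

lemma represents_indicator:
  assumes S: "S \<in> sets borel"
  shows "represents (indicator S) (E S)"
proof -
  have "integral\<^sup>L (spec_meas E x) (indicator S) = complex_of_real (measure (spec_meas E x) S)" for x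
  proof -
    interpret finite_measure "spec_meas E x" by (rule finite_mu)
    have "integral\<^sup>L (spec_meas E x) (indicator S) = (\<integral>s. complex_of_real (indicator S s) \<partial>spec_meas E x)"
      by (intro Bochner_Integration.integral_cong) (auto simp: indicator_def)
    also have "\<dots> = of_real (measure (spec_meas E x) S)"
      using S by (simp add: integral_complex_of_real sets_mu space_mu)
    finally show ?thesis .
  qed
  moreover have "measure (spec_meas E x) S = (norm (E S x))\<^sup>2" for x
    using emeasure_spec_meas[OF S, of x] by (simp add: measure_def)
  ultimately show ?thesis
    by (simp add: represents_def bclin_E S E_form)
qed

lemma opr_indicator: "S \<in> sets borel \<Longrightarrow> opr (indicator S) = E S"
  by (rule opr_eqI[OF represents_indicator])

lemma ex_represents: "bdd_borel f \<Longrightarrow> \<exists>T. represents f T"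
proof (induction f rule: bdd_borel_induct)
  case (lim F g C)
  then obtain T where "\<And>n. represents (F n) (T n)" by metis
  from represents_lim[OF lim.hyps(1) this lim.hyps(2-4)] show ?case by blast
qed (blast intro: represents_indicator represents_scale represents_add)+

lemma opr: "bdd_borel f \<Longrightarrow> represents f (opr f)"
  using ex_represents represents_opr by blast

lemma bclin_opr: "bdd_borel f \<Longrightarrow> bclin (opr f)"
  and opr_form: "bdd_borel f \<Longrightarrow> cinner x (opr f x) = integral\<^sup>L (spec_meas E x) f"
  using opr by (auto simp: represents_def)

lemma opr_add: "bdd_borel f \<Longrightarrow> bdd_borel g \<Longrightarrow> opr (\<lambda>s. f s + g s) x = opr f x + opr g x"
  using opr_eqI[OF represents_add[OF _ _ opr opr]] by metis

lemma opr_scale: "bdd_borel f \<Longrightarrow> opr (\<lambda>s. c * f s) x = scaleC c (opr f x)"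
  using opr_eqI[OF represents_scale[OF opr]] by metis

lemma opr_diff: "bdd_borel f \<Longrightarrow> bdd_borel g \<Longrightarrow> opr (\<lambda>s. f s - g s) x = opr f x - opr g x"
  using opr_add[of f "\<lambda>s. (-1) * g s"] opr_scale[of g "-1"] bdd_borel_scale[of g "-1"]
  by (simp add: scaleC_minus_left)

lemma opr_weak_tendsto:
  assumes F: "\<And>n. bdd_borel (F n)" and C: "\<And>n s. cmod (F n s) \<le> C"
    and lim: "\<And>s. (\<lambda>n. F n s) \<longlonglongrightarrow> g s" and g: "bdd_borel g"
  shows "(\<lambda>n. cinner z (opr (F n) x)) \<longlonglongrightarrow> cinner z (opr g x)"
  using represents_lim[OF F opr[OF F] C lim g] opr_eqI by metis

lemma opr_adjoint: "bdd_borel f \<Longrightarrow> cinner (opr f x) y = cinner x (opr (\<lambda>s. cnj (f s)) y)"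
proof (induction f arbitrary: x y rule: bdd_borel_induct)
  case (indicator S)
  have "(\<lambda>s. cnj (indicator S s)) = indicator S" by (auto simp: indicator_def)
  then show ?case by (simp add: opr_indicator indicator E_sym)
next
  case (scale c f)
  then show ?case by (simp add: opr_scale bdd_borel_cnj cinner_simps)
next
  case (add f g)
  then show ?case by (simp add: opr_add bdd_borel_cnj cinner_simps)
next
  case (lim F g C)
  have "(\<lambda>n. cinner y (opr (F n) x)) \<longlonglongrightarrow> cinner y (opr g x)"
    by (intro opr_weak_tendsto[where C=C] lim)
  then have "(\<lambda>n. cinner (opr (F n) x) y) \<longlonglongrightarrow> cinner (opr g x) y"
    by (subst (1 2) cinner_commute) (rule tendsto_cnj)
  moreover have "(\<lambda>n. cinner x (opr (\<lambda>s. cnj (F n s)) y)) \<longlonglongrightarrow> cinner x (opr (\<lambda>s. cnj (g s)) y)"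
    by (rule opr_weak_tendsto[where C=C]) (auto intro: bdd_borel_cnj lim tendsto_cnj)
  ultimately show ?case unfolding lim.IH by (rule LIMSEQ_unique)
qed

text \<open>Multiplicativity is obtained one factor at a time: with an indicator as second factor,
  the rule for intersections settles the base case; \<open>opr_mult\<close> afterwards lets the
  second factor vary.\<close>

lemma opr_mult_indicator:
  "bdd_borel f \<Longrightarrow> S \<in> sets borel \<Longrightarrow> opr (\<lambda>s. f s * indicator S s) x = opr f (E S x)"
proof (induction f arbitrary: x rule: bdd_borel_induct)
  case (indicator T)
  have "(\<lambda>s. indicator T s * indicator S s) = (indicator (T \<inter> S) :: real \<Rightarrow> complex)"
    by (auto simp: indicator_def)
  then show ?case using indicator by (simp add: opr_indicator E_Int)
next
  case (scale c f)
  then show ?case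
    using opr_scale[of "\<lambda>s. f s * indicator S s" c] by (simp add: opr_scale bdd_borel_mult bdd_borel_indicator mult.assoc)
next
  case (add f g)
  then show ?case
    by (simp add: opr_add bdd_borel_mult bdd_borel_indicator distrib_right)
next
  case (lim F g C)
  show ?case
  proof (rule cinner_ext)
    fix z
    have "cmod (F n s * indicator S s) \<le> C" for n s
      using lim.hyps(2)[of n s] order_trans[OF norm_ge_zero lim.hyps(2)[of n s]] by (auto simp: indicator_def)
    then have "(\<lambda>n. cinner z (opr (\<lambda>s. F n s * indicator S s) x)) \<longlonglongrightarrow> cinner z (opr (\<lambda>s. g s * indicator S s) x)"
      by (rule opr_weak_tendsto[rotated]) (auto intro!: bdd_borel_mult bdd_borel_indicator lim tendsto_mult)
    moreover have "(\<lambda>n. cinner z (opr (F n) (E S x))) \<longlonglongrightarrow> cinner z (opr g (E S x))"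
      by (intro opr_weak_tendsto[where C=C] lim)
    ultimately show "cinner z (opr (\<lambda>s. g s * indicator S s) x) = cinner z (opr g (E S x))"
      unfolding lim.IH[OF lim.prems] by (rule LIMSEQ_unique)
  qed
qed

lemma opr_mult: "bdd_borel g \<Longrightarrow> bdd_borel f \<Longrightarrow> opr (\<lambda>s. f s * g s) x = opr f (opr g x)"
proof (induction g arbitrary: x rule: bdd_borel_induct)
  case (indicator S)
  then show ?case by (simp add: opr_mult_indicator opr_indicator)
next
  case (scale c g)
  then show ?case
    using opr_scale[of "\<lambda>s. f s * g s" c] by (simp add: opr_scale bdd_borel_mult bclin_scaleC[OF bclin_opr] mult.left_commute)
next
  case (add g h)
  then show ?case
    by (simp add: opr_add bdd_borel_mult distrib_left bclin_add[OF bclin_opr])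
next
  case (lim F g C)
  note f = \<open>bdd_borel f\<close>
  obtain D where D: "0 \<le> D" "\<And>s. cmod (f s) \<le> D" using bdd_borel_bound[OF f] by blast
  show ?case
  proof (rule cinner_ext)
    fix z
    have "cmod (f s * F n s) \<le> D * C" for n s
      unfolding norm_mult by (intro mult_mono D lim) auto
    then have "(\<lambda>n. cinner z (opr (\<lambda>s. f s * F n s) x)) \<longlonglongrightarrow> cinner z (opr (\<lambda>s. f s * g s) x)"
      by (rule opr_weak_tendsto[rotated]) (auto intro!: bdd_borel_mult f lim tendsto_mult)
    \<comment> \<open>\<open>opr (F n) x\<close> is known here to converge only weakly, so
      \<open>opr f\<close> is moved to the other argument as its adjoint before passing to the
      limit.\<close>
    moreover have "(\<lambda>n. cinner (opr (\<lambda>s. cnj (f s)) z) (opr (F n) x)) \<longlonglongrightarrow> cinner (opr (\<lambda>s. cnj (f s)) z) (opr g x)"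
      by (intro opr_weak_tendsto[where C=C] lim)
    then have "(\<lambda>n. cinner z (opr f (opr (F n) x))) \<longlonglongrightarrow> cinner z (opr f (opr g x))"
      using opr_adjoint[OF bdd_borel_cnj[OF f]] by simp
    ultimately show "cinner z (opr (\<lambda>s. f s * g s) x) = cinner z (opr f (opr g x))"
      unfolding lim.IH[OF f] by (rule LIMSEQ_unique)
  qed
qed

lemma opr_norm_sq:
  assumes f: "bdd_borel f"
  shows "of_real ((norm (opr f x))\<^sup>2) = integral\<^sup>L (spec_meas E x) (\<lambda>s. cnj (f s) * f s)"
proof -
  have "of_real ((norm (opr f x))\<^sup>2) = cinner (opr f x) (opr f x)" by (simp add: cinner_norm)
  also have "\<dots> = cinner x (opr (\<lambda>s. cnj (f s) * f s) x)"
    by (simp add: opr_adjoint f opr_mult bdd_borel_cnj)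
  also have "\<dots> = integral\<^sup>L (spec_meas E x) (\<lambda>s. cnj (f s) * f s)"
    by (intro opr_form bdd_borel_mult bdd_borel_cnj f)
  finally show ?thesis .
qed

text \<open>Weak convergence improves to norm convergence because the squared norm of
  \<open>opr (F n) x - opr g x\<close> is the integral of \<open>|F n - g|^2\<close>, which tends to
  0 by dominated convergence.\<close>

lemma opr_tendsto:
  assumes F: "\<And>n. bdd_borel (F n)" and C: "\<And>n s. cmod (F n s) \<le> C"
    and lim: "\<And>s. (\<lambda>n. F n s) \<longlonglongrightarrow> g s" and g: "bdd_borel g"
  shows "(\<lambda>n. opr (F n) x) \<longlonglongrightarrow> opr g x"
proof -
  obtain D where D: "0 \<le> D" "\<And>s. cmod (g s) \<le> D" using bdd_borel_bound[OF g] by blast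
  define G where "G n s = F n s - g s" for n s
  have G: "bdd_borel (G n)" for n unfolding G_def by (intro bdd_borel_diff F g)
  have GC: "cmod (G n s) \<le> C + D" for n s
    unfolding G_def by (intro order_trans[OF norm_triangle_ineq4] add_mono C D)
  have "(\<lambda>n. integral\<^sup>L (spec_meas E x) (\<lambda>s. cnj (G n s) * G n s)) \<longlonglongrightarrow> integral\<^sup>L (spec_meas E x) (\<lambda>s. 0)"
  proof (rule integral_mu_tendsto)
    show "cmod (cnj (G n s) * G n s) \<le> (C + D) * (C + D)" for n s
      unfolding norm_mult complex_mod_cnj by (intro mult_mono GC) (use order_trans[OF norm_ge_zero GC] in auto)
    show "(\<lambda>n. cnj (G n s) * G n s) \<longlonglongrightarrow> 0" for s
    proof -
      have "(\<lambda>n. cnj (G n s) * G n s) \<longlonglongrightarrow> cnj (g s - g s) * (g s - g s)"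
        unfolding G_def by (intro tendsto_intros lim)
      then show ?thesis by simp
    qed
    show "bdd_borel (\<lambda>s. cnj (G n s) * G n s)" for n
      by (intro bdd_borel_mult bdd_borel_cnj G)
  qed (rule bdd_borel_const)
  then have "(\<lambda>n. complex_of_real ((norm (opr (G n) x))\<^sup>2)) \<longlonglongrightarrow> of_real 0"
    by (simp add: opr_norm_sq G del: of_real_power)
  then have "(\<lambda>n. (norm (opr (G n) x))\<^sup>2) \<longlonglongrightarrow> 0" by (simp only: tendsto_of_real_iff)
  then have "(\<lambda>n. sqrt ((norm (opr (G n) x))\<^sup>2)) \<longlonglongrightarrow> sqrt 0" by (rule tendsto_real_sqrt)
  then have "(\<lambda>n. opr (G n) x) \<longlonglongrightarrow> 0" by (simp add: tendsto_norm_zero_iff)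
  then have "(\<lambda>n. opr (F n) x - opr g x) \<longlonglongrightarrow> 0"
    unfolding G_def by (simp add: opr_diff F g)
  then show ?thesis by (simp add: LIM_zero_iff)
qed

section \<open>Agreement with the relations \<open>bfc\<close> and \<open>fc\<close>\<close>

lemma opr_one: "opr (\<lambda>s. 1) = proj_onto K"
  using opr_indicator[of UNIV] E_UNIV by (simp add: indicator_def)

lemma opr_in_K: "bdd_borel f \<Longrightarrow> opr f x \<in> K"
  using opr_mult[of f "\<lambda>s. 1" x] bdd_borel_const[of 1] proj_onto_mem[OF K] by (simp add: opr_one) metis

lemma opr_comp_eq:
  "bdd_borel f \<Longrightarrow> bdd_borel g \<Longrightarrow> (\<And>s. f s * g s = h s) \<Longrightarrow> opr f (opr g x) = opr h x"
  using opr_mult[of g f x] by (simp add: ext)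

lemma opr_polarized: "bdd_borel f \<Longrightarrow> cinner z (opr f x) =
    (\<Sum>k<4. (inverse \<i>) ^ k * integral\<^sup>L (spec_meas E (z + scaleC (\<i> ^ k) x)) f) / 4"
  using bclin_polarization[OF bclin_opr, of f z x] by (simp add: opr_form)

text \<open>The relation tests only vectors of \<open>K\<close>, but \<open>y - opr f x\<close> lies
  in \<open>K\<close> and can therefore be tested against itself.\<close>

lemma bfc_eq:
  assumes f: "bdd_borel f"
  shows "bfc K E f = {(x, opr f x) | x. x \<in> K}"
proof -
  have "y = opr f x" if "x \<in> K" "y \<in> K" and *: "\<forall>z\<in>K. cinner z y =
        (\<Sum>k<4. (inverse \<i>) ^ k * integral\<^sup>L (spec_meas E (z + scaleC (\<i> ^ k) x)) f) / 4" for x y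
  proof -
    have "cinner z (y - opr f x) = 0" if "z \<in> K" for z
      using * that by (simp add: cinner_simps opr_polarized[OF f])
    moreover have "y - opr f x \<in> K"
      using csubspace_diff[OF closed_csubspace_imp_csubspace[OF K] \<open>y \<in> K\<close> opr_in_K[OF f]] .
    ultimately have "cinner (y - opr f x) (y - opr f x) = 0" by blast
    then show "y = opr f x" by simp
  qed
  moreover have "cinner z (opr f x) =
    (\<Sum>k<4. (inverse \<i>) ^ k * integral\<^sup>L (spec_meas E (z + scaleC (\<i> ^ k) x)) f) / 4" for x z
    by (rule opr_polarized[OF f])
  ultimately show ?thesis
    unfolding bfc_def using opr_in_K[OF f] by blast
qed

text \<open>Under the bound 1, all truncations from \<open>n = 1\<close> on equal \<open>f\<close>,
  so the limit defining \<open>fc\<close> is that of an eventually constant sequence. The imaginary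
  powers fall under this case.\<close>

lemma fc_bounded:
  assumes f: "bdd_borel f" and b: "\<And>s. cmod (f s) \<le> 1"
  shows "fc K E f = {(x, opr f x) | x. x \<in> K}"
proof -
  define F where "F n s = (if cmod (f s) \<le> real n then f s else 0)" for n :: nat and s
  have F: "bdd_borel (F n)" for n
  proof (rule bdd_borelI)
    have [measurable]: "f \<in> borel_measurable borel" using f by (simp add: bdd_borel_def)
    show "F n \<in> borel_measurable borel" unfolding F_def by measurable
    show "cmod (F n s) \<le> real n" for s by (simp add: F_def)
  qed
  have Ff: "F n = f" if "n \<ge> 1" for n
  proof -
    have "cmod (f s) \<le> real n" for s using b[of s] that by linarith
    then show ?thesis by (auto simp: F_def)
  qed
  have ev: "(\<lambda>n. opr (F n) x) \<longlonglongrightarrow> opr f x" for x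
    by (rule tendsto_eventually, rule eventually_sequentiallyI[of 1]) (simp add: Ff)
  have fc: "fc K E f = {(x, y). x \<in> K \<and> (\<lambda>n. opr (F n) x) \<longlonglongrightarrow> y}"
    unfolding fc_def F_def[symmetric] bfc_eq[OF F] by (auto simp: fun_eq_iff[symmetric])
  show ?thesis
    unfolding fc using ev by (auto intro: LIMSEQ_unique)
qed

end

section \<open>The spectral theorem for operators between 0 and 1\<close>

definition peval :: "('h::complex_inner \<Rightarrow> 'h) \<Rightarrow> real poly \<Rightarrow> 'h \<Rightarrow> 'h" where
  "peval R p = fold_coeffs (\<lambda>a g x. a *\<^sub>R x + R (g x)) p (\<lambda>x. 0)"

text \<open>Composing with this map lets every function see only its values on
  \<open>[0, 1]\<close>, whatever the support of the measures on the line, and makes the identity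
  function bounded.\<close>

definition clamp01 :: "real \<Rightarrow> real" where
  "clamp01 s = max 0 (min 1 s)"

lemma clamp01_bounds: "0 \<le> clamp01 s" "clamp01 s \<le> 1"
  by (auto simp: clamp01_def)

lemma clamp01_id: "0 \<le> s \<Longrightarrow> s \<le> 1 \<Longrightarrow> clamp01 s = s"
  by (simp add: clamp01_def)

lemma clamp01_measurable [measurable]: "clamp01 \<in> borel_measurable borel"
  unfolding clamp01_def by measurable

lemma continuous_clamp01: "continuous_on UNIV clamp01"
  unfolding clamp01_def by (intro continuous_intros)

lemma bdd_borel_clamp01: "bdd_borel f \<Longrightarrow> bdd_borel (\<lambda>s. f (clamp01 s))"
  by (auto simp: bdd_borel_def intro: measurable_compose[OF clamp01_measurable])

lemma bdd_borel_clamp01_power: "bdd_borel (\<lambda>s. of_real (clamp01 s ^ m))"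
  by (rule bdd_borelI[where C=1]) (auto simp: norm_power clamp01_bounds power_le_one)

lemma cinner_sum_right: "cinner x (\<Sum>i\<in>A. g i) = (\<Sum>i\<in>A. cinner x (g i :: 'h::complex_inner))"
  by (induction A rule: infinite_finite_induct) (simp_all add: cinner_add_right)

text \<open>Half-lines form an intersection-stable generator, so Dynkin's theorem reduces unions to
  disjoint ones.\<close>

lemma borel_atMost_induct [consumes 1, case_names atMost compl union empty]:
  assumes S: "S \<in> sets (borel :: real measure)"
    and "\<And>a. P {..a}"
    and "\<And>A. A \<in> sets borel \<Longrightarrow> P A \<Longrightarrow> P (- A)"
    and "\<And>A. disjoint_family A \<Longrightarrow> (\<And>i::nat. A i \<in> sets borel) \<Longrightarrow> (\<And>i. P (A i)) \<Longrightarrow> P (\<Union>i. A i)"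
    and "P {}"
  shows "P S"
proof -
  let ?G = "range (\<lambda>a::real. {..a})"
  have sb: "sigma_sets UNIV ?G = sets (borel :: real measure)"
    unfolding borel_eq_atMost by simp
  have "Int_stable ?G"
  proof (rule Int_stableI)
    fix a b assume "a \<in> ?G" "b \<in> ?G"
    then obtain u v where "a = {..u}" "b = {..v}" by auto
    then have "a \<inter> b = {..min u v}" by auto
    then show "a \<inter> b \<in> ?G" by blast
  qed
  moreover have "?G \<subseteq> Pow UNIV" by simp
  moreover have "S \<in> sigma_sets UNIV ?G" using S sb by simp
  ultimately show ?thesis
  proof (induction S rule: sigma_sets_induct_disjoint)
    case empty
    show ?case by (rule assms(5))
  next
    case (basic A) then show ?case using assms(2) by auto
  next
    case (compl A) then show ?case using assms(3)[of A] by (simp add: sb Compl_eq_Diff_UNIV)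
  next
    case (union A) then show ?case using assms(4)[of A] sb by auto
  qed
qed


text \<open>Bernstein polynomials give continuous functions of \<open>clamp01\<close>, which approximate the
  indicators of half-lines; the rest is a Dynkin argument.\<close>

lemma clamp01_induct [consumes 1, case_names power scale add lim]:
  assumes f: "bdd_borel f"
    and power: "\<And>m. P (\<lambda>s. of_real (clamp01 s ^ m))"
    and scale: "\<And>c f. bdd_borel f \<Longrightarrow> P f \<Longrightarrow> P (\<lambda>s. c * f s)"
    and add: "\<And>f g. bdd_borel f \<Longrightarrow> bdd_borel g \<Longrightarrow> P f \<Longrightarrow> P g \<Longrightarrow> P (\<lambda>s. f s + g s)"
    and lim: "\<And>F g C. (\<And>n. bdd_borel (F n)) \<Longrightarrow> (\<And>n. P (F n)) \<Longrightarrow> (\<And>n s. cmod (F n s) \<le> C)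
       \<Longrightarrow> (\<And>s. (\<lambda>n. F n s) \<longlonglongrightarrow> g s) \<Longrightarrow> bdd_borel g \<Longrightarrow> P g"
  shows "P (\<lambda>s. f (clamp01 s))"
proof -
  have zero: "P (\<lambda>s. 0)" using scale[OF bdd_borel_clamp01_power power, of 0] by simp
  have diff: "P (\<lambda>s. f s - g s)" if "bdd_borel f" "bdd_borel g" "P f" "P g" for f g
    using add[OF that(1) bdd_borel_scale[OF that(2)] that(3) scale[OF that(2,4)], of "-1"] by simp
  have sum: "P (\<lambda>s. \<Sum>i\<in>I. f i s)" if "finite I" "\<And>i. i \<in> I \<Longrightarrow> bdd_borel (f i) \<and> P (f i)" for I :: "nat set" and f
    using that by (induction I rule: finite_induct) (auto intro!: zero add bdd_borel_sum)
  have bern_b: "bdd_borel (\<lambda>s. of_real (clamp01 s ^ a * (1 - clamp01 s) ^ b))" for a b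
  proof (rule bdd_borelI)
    show "(\<lambda>s. complex_of_real (clamp01 s ^ a * (1 - clamp01 s) ^ b)) \<in> borel_measurable borel" by measurable
    fix s
    have "0 \<le> clamp01 s ^ a * (1 - clamp01 s) ^ b" "clamp01 s ^ a * (1 - clamp01 s) ^ b \<le> 1"
      using clamp01_bounds[of s] by (auto intro!: mult_le_one power_le_one)
    then show "cmod (complex_of_real (clamp01 s ^ a * (1 - clamp01 s) ^ b)) \<le> 1"
      unfolding norm_of_real by linarith
  qed
  have bern: "P (\<lambda>s. of_real (clamp01 s ^ a * (1 - clamp01 s) ^ b))" for a b
  proof (induction b arbitrary: a)
    case 0
    then show ?case using power by simp
  next
    case (Suc b)
    \<comment> \<open>\<open>x^a (1 - x)^(b+1)\<close> is the difference of the functions with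
      exponents \<open>(a, b)\<close> and \<open>(a + 1, b)\<close>, so Bernstein functions are
      reached from pure powers.\<close>
    have "P (\<lambda>s. of_real (clamp01 s ^ a * (1 - clamp01 s) ^ b) - of_real (clamp01 s ^ Suc a * (1 - clamp01 s) ^ b))"
      by (intro diff bern_b Suc)
    then show ?case by (simp add: algebra_simps)
  qed
  have cont: "P (\<lambda>s. of_real (f (clamp01 s)))"
    if f: "continuous_on UNIV f" "\<And>s. \<bar>f s\<bar> \<le> 1" for f :: "real \<Rightarrow> real"
  proof (rule lim)
    let ?F = "\<lambda>n s. \<Sum>k\<le>n. complex_of_real (f (real k / real n) * Bernstein n k (clamp01 s))"
    have tm: "bdd_borel (\<lambda>s. complex_of_real (f (real k / real n) * Bernstein n k (clamp01 s))) \<and>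
        P (\<lambda>s. complex_of_real (f (real k / real n) * Bernstein n k (clamp01 s)))" for n k
    proof -
      have eq: "(\<lambda>s. complex_of_real (f (real k / real n) * Bernstein n k (clamp01 s))) =
          (\<lambda>s. complex_of_real (f (real k / real n) * real (n choose k)) *
             of_real (clamp01 s ^ k * (1 - clamp01 s) ^ (n - k)))"
        by (simp add: Bernstein_def mult.assoc)
      show ?thesis unfolding eq by (rule conjI[OF bdd_borel_scale[OF bern_b] scale[OF bern_b bern]])
    qed
    show "bdd_borel (?F n)" for n by (rule bdd_borel_sum) (use tm in auto)
    show "P (?F n)" for n by (rule sum) (use tm in auto)
    show "cmod (?F n s) \<le> 1" for n s
    proof -
      have "cmod (complex_of_real (f (real k / real n) * Bernstein n k (clamp01 s))) \<le> 1 * Bernstein n k (clamp01 s)" for k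
        using mult_right_mono[OF f(2) Bernstein_nonneg[OF clamp01_bounds, of n k s]]
        by (simp only: norm_of_real abs_mult abs_of_nonneg[OF Bernstein_nonneg[OF clamp01_bounds]])
      then have "cmod (?F n s) \<le> (\<Sum>k\<le>n. 1 * Bernstein n k (clamp01 s))"
        by (intro order_trans[OF norm_sum] sum_mono)
      then show ?thesis by simp
    qed
    show "(\<lambda>n. ?F n s) \<longlonglongrightarrow> of_real (f (clamp01 s))" for s
    proof -
      have "(\<lambda>n. \<Sum>k\<le>n. f (real k / real n) * Bernstein n k (clamp01 s)) \<longlonglongrightarrow> f (clamp01 s)"
      proof (rule LIMSEQ_I)
        fix e :: real assume "e > 0"
        then obtain N where "\<And>n x. N \<le> n \<and> x \<in> {0..1} \<Longrightarrow> \<bar>f x - (\<Sum>k\<le>n. f (k/n) * Bernstein n k x)\<bar> < e"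
          using Bernstein_Weierstrass[OF continuous_on_subset[OF f(1)]] by (metis subset_UNIV)
        then show "\<exists>N. \<forall>n\<ge>N. norm ((\<Sum>k\<le>n. f (real k / real n) * Bernstein n k (clamp01 s)) - f (clamp01 s)) < e"
          using clamp01_bounds[of s] by (metis abs_minus_commute atLeastAtMost_iff real_norm_def)
      qed
      from tendsto_of_real[OF this, where 'a=complex] show ?thesis by simp
    qed
    show "bdd_borel (\<lambda>s. of_real (f (clamp01 s)))"
    proof (rule bdd_borelI)
      have "f \<in> borel_measurable borel" using f(1) by (rule borel_measurable_continuous_onI)
      from measurable_compose[OF clamp01_measurable this]
      have [measurable]: "(\<lambda>s. f (clamp01 s)) \<in> borel_measurable borel" .
      show "(\<lambda>s. complex_of_real (f (clamp01 s))) \<in> borel_measurable borel"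
        by measurable
      show "cmod (of_real (f (clamp01 s))) \<le> 1" for s using f(2) by simp
    qed
  qed
  have indb: "bdd_borel (\<lambda>s. indicator S (clamp01 s))" if "S \<in> sets borel" for S
    by (intro bdd_borel_clamp01 bdd_borel_indicator that)
  have ind: "P (\<lambda>s. indicator S (clamp01 s))" if "S \<in> sets borel" for S
    using that
  proof (induction S rule: borel_atMost_induct)
    case (atMost a)
    \<comment> \<open>Ramps equal to 1 up to \<open>a\<close> and falling to 0 at
      \<open>a + 1/n\<close>; for \<open>n = 0\<close> this is the constant 1.\<close>
    let ?f = "\<lambda>n s. max 0 (min 1 (1 - real n * (s - a)))"
    show ?case
    proof (rule lim[where F="\<lambda>n s. of_real (?f n (clamp01 s))" and C=1])
      show "P (\<lambda>s. of_real (?f n (clamp01 s)))" for n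
        by (rule cont) (auto intro!: continuous_intros)
      show "bdd_borel (\<lambda>s. of_real (?f n (clamp01 s)))" for n
        by (rule bdd_borelI[where C=1]) auto
      show "cmod (of_real (?f n (clamp01 s))) \<le> 1" for n s by auto
      show "(\<lambda>n. complex_of_real (?f n (clamp01 s))) \<longlonglongrightarrow> indicator {..a} (clamp01 s)" for s
      proof (cases "clamp01 s \<le> a")
        case True
        then have "?f n (clamp01 s) = 1" for n by (simp add: mult_nonneg_nonpos)
        then show ?thesis using True by simp
      next
        case False
        obtain N where N: "1 / (clamp01 s - a) < real N" using reals_Archimedean2 by blast
        have "?f n (clamp01 s) = 0" if "n \<ge> N" for n
        proof -
          have "1 / (clamp01 s - a) < real n" using N that by linarith
          then have "1 < real n * (clamp01 s - a)" using False by (simp add: field_simps)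
          then show ?thesis by simp
        qed
        then have "\<forall>\<^sub>F n in sequentially. complex_of_real (?f n (clamp01 s)) = 0"
          by (intro eventually_sequentiallyI[of N]) simp
        then show ?thesis using False by (simp add: tendsto_eventually)
      qed
    qed (rule indb, simp)
  next
    case (compl A)
    have "P (\<lambda>s. of_real (clamp01 s ^ 0) - indicator A (clamp01 s))"
      by (intro diff bdd_borel_clamp01_power power indb compl)
    moreover have "(\<lambda>s. of_real (clamp01 s ^ 0) - indicator A (clamp01 s)) = (\<lambda>s. indicator (- A) (clamp01 s) :: complex)"
      by (auto simp: indicator_def)
    ultimately show ?case by simp
  next
    case (union A)
    show ?case
    proof (rule lim[where F="\<lambda>n s. indicator (\<Union>i<n. A i) (clamp01 s)" and C=1])
      have sets: "(\<Union>i<n. A i) \<in> sets borel" for n :: nat using union by auto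
      show "bdd_borel (\<lambda>s. indicator (\<Union>i<n. A i) (clamp01 s))" for n by (rule indb[OF sets])
      have *: "(indicator (\<Union>i<n. A i) s :: complex) = (\<Sum>i<n. indicator (A i) s)" for n s
      proof (induction n)
        case (Suc n)
        have "A n \<inter> (\<Union>i<n. A i) = {}" using union(1)
          by (auto simp: disjoint_family_on_def) (metis Int_iff empty_iff less_irrefl)
        then have "indicator ((\<Union>i<n. A i) \<union> A n) s = (indicator (\<Union>i<n. A i) s + indicator (A n) s :: complex)"
          by (auto simp: indicator_def)
        then show ?case
          unfolding sum.lessThan_Suc Suc.IH[symmetric] by (simp only: lessThan_Suc UN_insert Un_commute)
      qed simp
      show "P (\<lambda>s. indicator (\<Union>i<n. A i) (clamp01 s))" for n
        unfolding * by (rule sum) (use union indb in auto)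
      show "cmod (indicator (\<Union>i<n. A i) (clamp01 s)) \<le> 1" for n s by (simp add: indicator_def)
      show "(\<lambda>n. indicator (\<Union>i<n. A i) (clamp01 s) :: complex) \<longlonglongrightarrow> indicator (\<Union>i. A i) (clamp01 s)" for s
        by (rule LIMSEQ_indicator_UN)
      show "bdd_borel (\<lambda>s. indicator (\<Union>i. A i) (clamp01 s))" by (rule indb) (use union in auto)
    qed
  next
    case empty
    then show ?case using zero by simp
  qed
  show ?thesis
    using f
  proof (induction f rule: bdd_borel_induct)
    case (indicator S) then show ?case by (rule ind)
  next
    case (scale c f) show ?case by (rule assms(3)[OF bdd_borel_clamp01[OF scale(1)] scale(2)])
  next
    case (add f g) show ?case by (rule assms(4)[OF bdd_borel_clamp01[OF add(1)] bdd_borel_clamp01[OF add(2)] add(3,4)])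
  next
    case (lim F g C)
    show ?case
      by (rule assms(5)[of "\<lambda>n s. F n (clamp01 s)" C, OF bdd_borel_clamp01[OF lim.hyps(1)] lim.IH
            lim.hyps(2) lim.hyps(3) bdd_borel_clamp01[OF lim.hyps(4)]])
  qed
qed

text \<open>The subspace is the set of fixed vectors: idempotence puts the range into it, and
  symmetry makes \<open>x - T x\<close> orthogonal to it.\<close>

lemma projection_operator:
  assumes T: "bclin T" "\<And>x. T (T x) = T x" "\<And>x y. cinner (T x) y = cinner x (T y)"
  shows "\<exists>M. closed_csubspace M \<and> T = proj_onto (M::'h::chilbert_space set)"
proof (intro exI conjI ext)
  let ?M = "{x. T x = x}"
  have "closed ?M"
  proof -
    have "continuous_on UNIV (\<lambda>x. T x - x)"
      by (intro continuous_intros bounded_linear.continuous_on[OF bclin_bounded_linear[OF T(1)]])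
    then have "closed {x \<in> UNIV. T x - x = 0}"
      by (intro continuous_closed_preimage_constant) auto
    then show ?thesis by simp
  qed
  then show M: "closed_csubspace ?M"
    by (auto simp: closed_csubspace_def csubspace_def bclin_zero[OF T(1)] bclin_add[OF T(1)] bclin_scaleC[OF T(1)])
  show "T x = proj_onto ?M x" for x
  proof (rule proj_onto_eqI[symmetric])
    show "csubspace ?M" by (rule closed_csubspace_imp_csubspace[OF M])
    show "T x \<in> ?M" by (simp add: T)
    show "cinner m (x - T x) = 0" if "m \<in> ?M" for m
    proof -
      have "cinner m (x - T x) = cinner (T m) (x - T x)" using that by simp
      also have "\<dots> = 0" by (simp add: T(3) bclin_diff[OF T(1)] T(2))
      finally show ?thesis .
    qed
  qed
qed

text \<open>The Bernstein weights have exact moments for falling factorials, not for powers; this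
  bounds the discrepancy. Factor by factor, \<open>k/n\<close> and \<open>(k - i)/(n - i)\<close>
  differ by at most \<open>m/(n - m)\<close>. The assumption \<open>2 * m < n\<close> keeps the
  second factor in \<open>[-1, 1]\<close> also when \<open>k < i\<close>.\<close>

lemma falling_ratio_diff:
  fixes n k m :: nat
  assumes n: "2 * m < n" and k: "k \<le> n"
  shows "\<bar>(real k / real n) ^ m - (\<Prod>i<m. (real k - real i) / (real n - real i))\<bar> \<le> real m * (real m / (real n - real m))"
proof -
  have "norm ((\<Prod>i<m. real k / real n) - (\<Prod>i<m. (real k - real i) / (real n - real i)))
     \<le> (\<Sum>i<m. norm (real k / real n - (real k - real i) / (real n - real i)))"
  proof (rule norm_prod_diff)
    show "norm (real k / real n) \<le> 1" for i using k n by (simp add: field_simps)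
    show "norm ((real k - real i) / (real n - real i)) \<le> 1" if "i \<in> {..<m}" for i
    proof -
      have "real n - real i > 0" "\<bar>real k - real i\<bar> \<le> real n - real i" using that k n by auto
      then show ?thesis by simp
    qed
  qed
  also have "\<dots> \<le> (\<Sum>i<m. real m / (real n - real m))"
  proof (rule sum_mono)
    fix i assume i: "i \<in> {..<m}"
    have p: "0 < real n" "0 < real n - real i" "0 < real n - real m" using i n by auto
    have "real k / real n - (real k - real i) / (real n - real i) = real i * (real n - real k) / (real n * (real n - real i))"
      using p by (simp add: field_simps)
    moreover have "0 \<le> real i * (real n - real k) / (real n * (real n - real i))"
      using p k by auto
    moreover have "real i * (real n - real k) / (real n * (real n - real i)) = (real i / (real n - real i)) * ((real n - real k) / real n)"
      by simp
    moreover have "(real i / (real n - real i)) * ((real n - real k) / real n) \<le> (real m / (real n - real m)) * 1"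
      using p i k by (intro mult_mono frac_le) auto
    ultimately show "norm (real k / real n - (real k - real i) / (real n - real i)) \<le> real m / (real n - real m)"
      unfolding real_norm_def by linarith
  qed
  finally show ?thesis by simp
qed

lemma prod_falling_binomial:
  assumes "m \<le> n"
  shows "(\<Prod>i<m. (real k - real i) / (real n - real i)) * real (n choose m) = real (k choose m)"
proof -
  have f: "(\<Prod>i<m. real j - real i) = fact m * real (j choose m)" for j
    by (simp add: binomial_gbinomial gbinomial_prod_rev atLeast0LessThan)
  have "(\<Prod>i<m. real n - real i) \<noteq> 0" using assms by (auto simp: prod_zero_iff)
  then show ?thesis
    unfolding prod_dividef using f[of n] f[of k] by (simp add: field_simps)
qed

text \<open>The Bernstein weights \<open>(n choose k) \<langle>x, R\<^sup>k (1 - R)\<^sup>n\<^sup>-\<^sup>k x\<rangle>\<close> are nonnegative, and any weak limit of the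
  discrete measures they define on \<open>{0, 1/n, ..., 1}\<close> has moments \<open>\<langle>x, R\<^sup>m x\<rangle>\<close>.\<close>

locale unit_operator =
  fixes R :: "'h::chilbert_space \<Rightarrow> 'h"
  assumes R: "bclin R" and R_sym: "\<And>x y. cinner (R x) y = cinner x (R y)"
    and R_pos: "\<And>x. 0 \<le> Re (cinner x (R x))" and R_le: "\<And>x. Re (cinner x (R x)) \<le> (norm x)\<^sup>2"
begin

section \<open>Polynomials of a bounded self-adjoint operator\<close>

lemma peval_0: "peval R 0 x = 0"
  by (simp add: peval_def)

lemma peval_pCons: "peval R (pCons a p) x = a *\<^sub>R x + R (peval R p x)"
  by (cases "p = 0 \<and> a = 0") (auto simp: peval_def bclin_zero[OF R])

lemma peval_add: "peval R (p + q) x = peval R p x + peval R q x"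
proof (induction p q rule: poly_induct2)
  case 0 show ?case by (simp add: peval_0)
next
  case (pCons a p b q)
  then show ?case by (simp add: peval_pCons bclin_add[OF R] algebra_simps)
qed

lemma peval_smult: "peval R (smult c p) x = c *\<^sub>R peval R p x"
  by (induction p) (simp_all add: peval_0 peval_pCons bclin_scaleR[OF R] algebra_simps)

lemma peval_mult: "peval R (p * q) x = peval R p (peval R q x)"
  by (induction p) (simp_all add: peval_0 peval_pCons peval_add peval_smult)

lemma peval_one: "peval R 1 x = x"
  by (simp add: one_pCons peval_pCons peval_0 bclin_zero[OF R])

lemma peval_X: "peval R [:0, 1:] x = R x"
  by (simp add: peval_pCons peval_0 bclin_zero[OF R])

lemma peval_power: "peval R ([:0, 1:] ^ m) x = (R ^^ m) x"
proof (induction m)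
  case (Suc m)
  have "peval R ([:0, 1:] ^ Suc m) x = R (peval R ([:0, 1:] ^ m) x)"
    by (simp only: power_Suc peval_mult peval_X)
  then show ?case using Suc by simp
qed (simp add: peval_one)

lemma peval_sum: "finite I \<Longrightarrow> peval R (\<Sum>i\<in>I. p i) x = (\<Sum>i\<in>I. peval R (p i) x)"
  by (induction I rule: finite_induct) (simp_all add: peval_0 peval_add)

lemma bclin_peval: "bclin (peval R p)"
proof (induction p)
  case 0
  show ?case using bclin_scaleC_op[OF bclin_id, of 0] by (simp add: peval_0[abs_def])
next
  case (pCons a p)
  have "bclin (\<lambda>x. scaleC (of_real a) x + R (peval R p x))"
    by (rule bclin_add_op[OF bclin_scaleC_op[OF bclin_id] bclin_comp[OF R pCons.IH]])
  then show ?case by (simp add: peval_pCons[abs_def] scaleR_scaleC)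
qed

lemma peval_sym: "cinner (peval R p x) y = cinner x (peval R p y)"
proof (induction p arbitrary: x y)
  case 0 then show ?case by (simp add: peval_0)
next
  case (pCons a p)
  have "R (peval R p y) = peval R p (R y)"
    by (metis peval_mult peval_X mult.commute)
  then show ?case
    by (simp add: peval_pCons cinner_simps cinner_scaleR_left cinner_scaleR_right R_sym pCons)
qed

section \<open>Positivity and moments of the Bernstein weights\<close>

definition pos_poly :: "real poly \<Rightarrow> bool" where
  "pos_poly p \<longleftrightarrow> (\<forall>x. 0 \<le> Re (cinner x (peval R p x)))"

lemma pos_poly_square: "pos_poly p \<Longrightarrow> pos_poly (q * (p * q))"
proof -
  assume p: "pos_poly p"
  have "cinner x (peval R (q * (p * q)) x) = cinner (peval R q x) (peval R p (peval R q x))" for x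
    by (simp add: peval_mult peval_sym)
  then show ?thesis using p by (simp add: pos_poly_def)
qed

text \<open>Even powers are split off as squares, since \<open>q p q\<close> is positive whenever
  \<open>p\<close> is. What remains is \<open>1\<close>, \<open>X\<close>, \<open>Y\<close> or
  \<open>X Y\<close> with \<open>Y = 1 - X\<close>, and \<open>X + Y = 1\<close> gives
  \<open>X Y = X Y X + Y X Y\<close>, a sum of two positive terms.\<close>

lemma pos_poly_Bernstein: "pos_poly ([:0, 1:] ^ k * [:1, -1:] ^ j)"
proof -
  let ?X = "[:0, 1:] :: real poly" and ?Y = "[:1, -1:] :: real poly"
  have X: "pos_poly ?X" by (simp add: pos_poly_def peval_pCons peval_0 bclin_zero[OF R] R_pos)
  have Y: "pos_poly ?Y"
    using R_le by (simp add: pos_poly_def peval_pCons peval_0 bclin_zero[OF R] bclin_minus[OF R]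
        cinner_simps norm_sq_cinner)
  have one: "pos_poly 1" by (simp add: pos_poly_def peval_one cinner_norm)
  have XY: "pos_poly (?X * ?Y)"
  proof -
    have "?X * ?Y = ?X * (?Y * ?X) + ?Y * (?X * ?Y)" by simp
    from arg_cong[OF this, of "peval R"]
    have "peval R (?X * ?Y) x = peval R (?X * (?Y * ?X)) x + peval R (?Y * (?X * ?Y)) x" for x
      using peval_add by metis
    moreover have "pos_poly (?X * (?Y * ?X))" "pos_poly (?Y * (?X * ?Y))"
      by (intro pos_poly_square X Y)+
    ultimately show ?thesis by (simp add: pos_poly_def peval_add cinner_simps del: mult_pCons_left mult_pCons_right)
  qed
  have e: "pos_poly (?X ^ (k mod 2) * ?Y ^ (j mod 2))"
    using X Y XY one by (cases "even k"; cases "even j") (simp_all add: even_iff_mod_2_eq_zero odd_iff_mod_2_eq_one)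
  have "?X ^ k * ?Y ^ j = (?X ^ (k div 2) * ?Y ^ (j div 2)) *
      ((?X ^ (k mod 2) * ?Y ^ (j mod 2)) * (?X ^ (k div 2) * ?Y ^ (j div 2)))"
  proof -
    have "?X ^ k = ?X ^ (k div 2) * ?X ^ (k div 2) * ?X ^ (k mod 2)"
      unfolding power_add[symmetric] by (rule arg_cong[where f="\<lambda>i. ?X ^ i"]) presburger
    moreover have "?Y ^ j = ?Y ^ (j div 2) * ?Y ^ (j div 2) * ?Y ^ (j mod 2)"
      unfolding power_add[symmetric] by (rule arg_cong[where f="\<lambda>i. ?Y ^ i"]) presburger
    ultimately show ?thesis by (simp only: ac_simps)
  qed
  then show ?thesis using pos_poly_square[OF e] by metis
qed

definition weight :: "'h \<Rightarrow> nat \<Rightarrow> nat \<Rightarrow> real" where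
  "weight x n k = real (n choose k) * Re (cinner x (peval R ([:0, 1:] ^ k * [:1, -1:] ^ (n - k)) x))"

lemma weight_nonneg: "0 \<le> weight x n k"
  using pos_poly_Bernstein by (simp add: weight_def pos_poly_def)

text \<open>The identity \<open>(n choose k)(k choose m) = (n choose m)(n-m choose k-m)\<close>
  reduces the weighted sum of polynomials to \<open>X^m (X + (1 - X))^(n-m) = X^m\<close>.\<close>

lemma weight_moment:
  assumes m: "m \<le> n"
  shows "(\<Sum>k\<le>n. weight x n k * (real (k choose m) / real (n choose m))) = Re (cinner x ((R ^^ m) x))"
proof -
  let ?X = "[:0, 1:] :: real poly" and ?Y = "[:1, -1:] :: real poly"
  have nz: "real (n choose m) \<noteq> 0" using m by simp
  have "(\<Sum>k\<le>n. smult (real (n choose k) * (real (k choose m) / real (n choose m))) (?X ^ k * ?Y ^ (n - k)))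
      = (\<Sum>k\<in>{m..n}. smult (real (n choose k) * (real (k choose m) / real (n choose m))) (?X ^ k * ?Y ^ (n - k)))"
    by (rule sum.mono_neutral_right) auto
  also have "\<dots> = (\<Sum>k\<in>{m..n}. smult (real ((n - m) choose (k - m))) (?X ^ k * ?Y ^ (n - k)))"
  proof (rule sum.cong[OF refl])
    fix k assume k: "k \<in> {m..n}"
    have "real (n choose k) * real (k choose m) = real (n choose m) * real ((n - m) choose (k - m))"
      using choose_mult[of m k n] k by (simp flip: of_nat_mult)
    then have "real (n choose k) * (real (k choose m) / real (n choose m)) = real ((n - m) choose (k - m))"
      using nz by (simp add: field_simps)
    then show "smult (real (n choose k) * (real (k choose m) / real (n choose m))) (?X ^ k * ?Y ^ (n - k))
       = smult (real ((n - m) choose (k - m))) (?X ^ k * ?Y ^ (n - k))" by simp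
  qed
  also have "\<dots> = (\<Sum>j\<le>n - m. smult (real ((n - m) choose j)) (?X ^ (m + j) * ?Y ^ (n - m - j)))"
    by (rule sum.reindex_bij_witness[where i="\<lambda>j. j + m" and j="\<lambda>k. k - m"]) (use m in auto)
  also have "\<dots> = ?X ^ m * (\<Sum>j\<le>n - m. of_nat ((n - m) choose j) * ?X ^ j * ?Y ^ (n - m - j))"
    unfolding sum_distrib_left
    by (rule sum.cong) (simp_all add: power_add of_nat_poly ac_simps)
  also have "\<dots> = ?X ^ m * (?X + ?Y) ^ (n - m)" by (subst binomial_ring) (rule refl)
  also have "?X + ?Y = 1" by (simp add: one_pCons)
  finally have "peval R (\<Sum>k\<le>n. smult (real (n choose k) * (real (k choose m) / real (n choose m))) (?X ^ k * ?Y ^ (n - k))) x = (R ^^ m) x"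
    by (simp add: peval_power)
  then have "Re (cinner x ((R ^^ m) x)) = Re (cinner x (\<Sum>k\<le>n. (real (n choose k) * (real (k choose m) / real (n choose m))) *\<^sub>R peval R (?X ^ k * ?Y ^ (n - k)) x))"
    by (simp add: peval_sum peval_smult)
  also have "\<dots> = (\<Sum>k\<le>n. Re (cinner x ((real (n choose k) * (real (k choose m) / real (n choose m))) *\<^sub>R peval R (?X ^ k * ?Y ^ (n - k)) x)))"
    by (simp only: cinner_sum_right Re_sum)
  also have "\<dots> = (\<Sum>k\<le>n. weight x n k * (real (k choose m) / real (n choose m)))"
    by (rule sum.cong) (simp_all add: weight_def cinner_scaleR_right)
  finally show ?thesis by simp
qed

lemma power_sym: "cinner ((R ^^ m) x) y = cinner x ((R ^^ m) y)"
  using peval_sym[of "[:0,1:] ^ m"] by (simp add: peval_power)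

text \<open>The error is \<open>\<parallel>x\<parallel>^2\<close>, the total weight, times the
  \<open>O(1/n)\<close> discrepancy between power and falling-factorial moments. Indexing by
  \<open>Suc n\<close> keeps denominators nonzero.\<close>

lemma weight_moment_limit:
  "(\<lambda>n. \<Sum>k\<le>Suc n. weight x (Suc n) k * (real k / real (Suc n)) ^ m) \<longlonglongrightarrow> Re (cinner x ((R ^^ m) x))"
proof -
  have tot: "(\<Sum>k\<le>n. weight x n k) = (norm x)\<^sup>2" for n
    using weight_moment[of 0 n x] by (simp add: norm_sq_cinner)
  have bd: "\<bar>(\<Sum>k\<le>n. weight x n k * (real k / real n) ^ m) - Re (cinner x ((R ^^ m) x))\<bar>
     \<le> (norm x)\<^sup>2 * (real m * (real m / (real n - real m)))" if n: "2 * m < n" for n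
  proof -
    have "(\<Sum>k\<le>n. weight x n k * (real k / real n) ^ m) - Re (cinner x ((R ^^ m) x)) =
       (\<Sum>k\<le>n. weight x n k * ((real k / real n) ^ m - (\<Prod>i<m. (real k - real i) / (real n - real i))))"
    proof -
      have "(\<Prod>i<m. (real k - real i) / (real n - real i)) = real (k choose m) / real (n choose m)" for k
        using prod_falling_binomial[of m n k] n by (simp add: field_simps)
      then show ?thesis
        using weight_moment[of m n x] n by (simp add: sum_subtractf right_diff_distrib)
    qed
    also have "\<bar>\<dots>\<bar> \<le> (\<Sum>k\<le>n. weight x n k * (real m * (real m / (real n - real m))))"
      by (intro order_trans[OF sum_abs] sum_mono, unfold abs_mult abs_of_nonneg[OF weight_nonneg])
        (intro mult_left_mono falling_ratio_diff[OF n] weight_nonneg, simp)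
    also have "\<dots> = (norm x)\<^sup>2 * (real m * (real m / (real n - real m)))"
      by (simp only: sum_distrib_right[symmetric] tot)
    finally show ?thesis .
  qed
  have "\<forall>\<^sub>F n in sequentially. norm ((\<Sum>k\<le>Suc n. weight x (Suc n) k * (real k / real (Suc n)) ^ m) - Re (cinner x ((R ^^ m) x)))
     \<le> (norm x)\<^sup>2 * (real m * (real m / (real (Suc n) - real m)))"
  proof (rule eventually_sequentiallyI[of "2 * m"])
    fix k assume "2 * m \<le> k"
    then have "2 * m < Suc k" by simp
    from bd[OF this] show "norm ((\<Sum>i\<le>Suc k. weight x (Suc k) i * (real i / real (Suc k)) ^ m) - Re (cinner x ((R ^^ m) x)))
     \<le> (norm x)\<^sup>2 * (real m * (real m / (real (Suc k) - real m)))"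
      unfolding real_norm_def .
  qed
  moreover have "(\<lambda>n. (norm x)\<^sup>2 * (real m * (real m / (real (Suc n) - real m)))) \<longlonglongrightarrow> 0"
    by real_asymp
  ultimately show ?thesis
    by (rule LIM_zero_cancel[OF Lim_null_comparison])
qed

text \<open>For a unit vector the weights are probabilities carried by \<open>[0, 1]\<close>, hence
  tight, and a subsequence converges weakly. The moments converge along the whole sequence, so they
  pass to the limit of the subsequence.\<close>

lemma ex_moment_distribution:
  assumes x: "norm x = 1"
  shows "\<exists>M. real_distribution M \<and> (\<forall>m. (\<integral>s. clamp01 s ^ m \<partial>M) = Re (cinner x ((R ^^ m) x)))"
proof -
  have tot: "(\<Sum>k\<le>n. weight x n k) = 1" for n
    using weight_moment[of 0 n x] x by (simp add: cinner_norm)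
  define w where "w n k = (if k \<le> n then weight x n k else 0)" for n k
  define p where "p n = embed_pmf (w n)" for n
  have pmf_p: "pmf (p n) k = w n k" for n k
    unfolding p_def
  proof (rule pmf_embed_pmf)
    show "0 \<le> w n k" for k by (simp add: w_def weight_nonneg)
    have "(\<integral>\<^sup>+k. ennreal (w n k) \<partial>count_space UNIV) = (\<integral>\<^sup>+k. ennreal (w n k) \<partial>count_space {..n})"
      by (rule nn_integral_count_space_eq) (auto simp: w_def)
    also have "\<dots> = ennreal (\<Sum>k\<le>n. w n k)"
      by (subst nn_integral_count_space_finite) (auto simp: w_def weight_nonneg intro!: sum_ennreal)
    also have "(\<Sum>k\<le>n. w n k) = 1" using tot[of n] by (simp add: w_def)
    finally show "(\<integral>\<^sup>+k. ennreal (w n k) \<partial>count_space UNIV) = 1" by simp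
  qed
  define M where "M n = distr (measure_pmf (p (Suc n))) borel (\<lambda>k. real k / real (Suc n))" for n
  have rd: "real_distribution (M n)" for n
  proof -
    have "prob_space (M n)"
      unfolding M_def by (rule prob_space.prob_space_distr[OF prob_space_measure_pmf]) simp
    then show ?thesis by (simp add: real_distribution_def real_distribution_axioms_def M_def)
  qed
  have integral: "integral\<^sup>L (M n) g = (\<Sum>k\<le>Suc n. weight x (Suc n) k * g (real k / real (Suc n)))"
    if [measurable]: "g \<in> borel_measurable borel" for g :: "real \<Rightarrow> real" and n
  proof -
    have "integral\<^sup>L (M n) g = (\<integral>k. g (real k / real (Suc n)) \<partial>measure_pmf (p (Suc n)))"
      unfolding M_def by (rule integral_distr) auto
    also have "\<dots> = (\<Sum>k\<le>Suc n. g (real k / real (Suc n)) * pmf (p (Suc n)) k)"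
      by (rule integral_measure_pmf_real) (auto simp: set_pmf_iff pmf_p w_def split: if_splits)
    also have "\<dots> = (\<Sum>k\<le>Suc n. weight x (Suc n) k * g (real k / real (Suc n)))"
      by (rule sum.cong) (auto simp: pmf_p w_def)
    finally show ?thesis .
  qed
  have "tight M"
    unfolding tight_def
  proof (intro conjI allI impI rd)
    fix e :: real assume e: "e > 0"
    \<comment> \<open>The interval is open on the left, and the weight with \<open>k = 0\<close>
      sits at the point 0; hence the left endpoint \<open>-1\<close>.\<close>
    have "measure (M n) {-1<..1} = 1" for n
    proof -
      interpret real_distribution "M n" by (rule rd)
      have "measure (M n) {-1<..1} = integral\<^sup>L (M n) (indicator {-1<..1})" by simp
      also have "\<dots> = (\<Sum>k\<le>Suc n. weight x (Suc n) k * indicator {-1<..1} (real k / real (Suc n)))"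
        by (rule integral) simp
      also have "\<dots> = (\<Sum>k\<le>Suc n. weight x (Suc n) k)"
      proof (rule sum.cong[OF refl])
        fix k assume "k \<in> {..Suc n}"
        then have "real k / real (Suc n) \<le> 1" by (simp add: field_simps)
        moreover have "-1 < real k / real (Suc n)" by (rule less_le_trans[of _ 0]) auto
        ultimately show "weight x (Suc n) k * indicator {-1<..1} (real k / real (Suc n)) = weight x (Suc n) k"
          by (simp add: indicator_def)
      qed
      finally show ?thesis unfolding tot .
    qed
    then show "\<exists>a b. a < b \<and> (\<forall>n. 1 - e < measure (M n) {a<..b})"
      using e by (intro exI[of _ "-1"] exI[of _ 1]) auto
  qed
  from tight_imp_convergent_subsubsequence[OF this strict_mono_id]
  obtain r N where r: "strict_mono r" and N: "real_distribution N" and conv: "weak_conv_m (M \<circ> r) N"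
    by (auto simp: comp_id)
  have "(\<integral>s. clamp01 s ^ m \<partial>N) = Re (cinner x ((R ^^ m) x))" for m
  proof (rule LIMSEQ_unique)
    show "(\<lambda>n. \<integral>s. clamp01 s ^ m \<partial>(M \<circ> r) n) \<longlonglongrightarrow> (\<integral>s. clamp01 s ^ m \<partial>N)"
    proof (rule weak_conv_imp_integral_bdd_continuous_conv[where B=1])
      show "real_distribution ((M \<circ> r) n)" for n using rd by simp
      show "isCont (\<lambda>s. clamp01 s ^ m) s" for s
        using continuous_clamp01 by (intro continuous_intros) (simp add: continuous_on_eq_continuous_at)
      show "norm (clamp01 s ^ m) \<le> 1" for s by (simp add: clamp01_bounds power_le_one)
    qed (use N conv in \<open>auto simp: comp_def\<close>)
    have "(\<integral>s. clamp01 s ^ m \<partial>M n) = (\<Sum>k\<le>Suc n. weight x (Suc n) k * (real k / real (Suc n)) ^ m)" for n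
      by (subst integral, simp, rule sum.cong) (auto simp: clamp01_id field_simps)
    then have "(\<lambda>n. \<integral>s. clamp01 s ^ m \<partial>M n) \<longlonglongrightarrow> Re (cinner x ((R ^^ m) x))"
      using weight_moment_limit[of x m] by presburger
    from LIMSEQ_subseq_LIMSEQ[OF this r]
    show "(\<lambda>n. \<integral>s. clamp01 s ^ m \<partial>(M \<circ> r) n) \<longlonglongrightarrow> Re (cinner x ((R ^^ m) x))" by (simp add: comp_def)
  qed
  then show ?thesis using N by blast
qed

lemma cinner_power_real: "cinner x ((R ^^ m) x) = of_real (Re (cinner x ((R ^^ m) x)))"
  by (metis Reals_cnj_iff cinner_commute complex_is_Real_iff of_real_Re power_sym)

lemma ex_moment_measure:
  "\<exists>M. sets M = sets borel \<and> emeasure M UNIV \<le> ennreal ((norm x)\<^sup>2) \<and>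
     (\<forall>m. (\<integral>s. complex_of_real (clamp01 s ^ m) \<partial>M) = cinner x ((R ^^ m) x))"
proof (cases "x = 0")
  case True
  have "(R ^^ m) 0 = 0" for m by (induction m) (simp_all add: bclin_zero[OF R])
  then show ?thesis using True by (intro exI[of _ "null_measure borel"]) simp
next
  case False
  define u where "u = (1 / norm x) *\<^sub>R x"
  have x: "x = norm x *\<^sub>R u" "norm u = 1" using False by (simp_all add: u_def)
  obtain N where N: "real_distribution N" and mom: "\<And>m. (\<integral>s. clamp01 s ^ m \<partial>N) = Re (cinner u ((R ^^ m) u))"
    using ex_moment_distribution[OF x(2)] by blast
  interpret N: real_distribution N by (rule N)
  let ?M = "density N (\<lambda>_. ennreal ((norm x)\<^sup>2))"
  have "emeasure ?M UNIV = ennreal ((norm x)\<^sup>2)"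
    using N.emeasure_space_1 by (subst emeasure_density) (auto simp: N.space_eq_univ nn_integral_cmult_indicator)
  moreover have "(\<integral>s. complex_of_real (clamp01 s ^ m) \<partial>?M) = cinner x ((R ^^ m) x)" for m
  proof -
    have "(\<integral>s. complex_of_real (clamp01 s ^ m) \<partial>?M) = (\<integral>s. (norm x)\<^sup>2 *\<^sub>R complex_of_real (clamp01 s ^ m) \<partial>N)"
      by (rule integral_density) auto
    also have "\<dots> = of_real ((norm x)\<^sup>2 * (\<integral>s. clamp01 s ^ m \<partial>N))"
      by (simp add: scaleR_conv_of_real del: of_real_power)
    also have "\<dots> = of_real ((norm x)\<^sup>2) * cinner u ((R ^^ m) u)"
      unfolding mom by (subst (2) cinner_power_real) simp
    also have "\<dots> = cinner x ((R ^^ m) x)"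
    proof -
      have "(R ^^ m) (norm x *\<^sub>R u) = norm x *\<^sub>R (R ^^ m) u"
        by (induction m) (simp_all add: bclin_scaleR[OF R])
      then have "cinner (norm x *\<^sub>R u) ((R ^^ m) (norm x *\<^sub>R u)) = of_real ((norm x)\<^sup>2) * cinner u ((R ^^ m) u)"
        by (simp add: cinner_scaleR_left cinner_scaleR_right power2_eq_square)
      then show ?thesis by (simp only: x(1)[symmetric])
    qed
    finally show ?thesis .
  qed
  ultimately show ?thesis by (intro exI[of _ ?M]) simp
qed

text \<open>The choice is made separately for each \<open>x\<close>. Coherence in \<open>x\<close>
  is carried by the moments, which are the quadratic forms of the operators
  \<open>R ^^ m\<close>.\<close>

definition mu :: "'h \<Rightarrow> real measure" where
  "mu x = (SOME M. sets M = sets borel \<and> emeasure M UNIV \<le> ennreal ((norm x)\<^sup>2) \<and>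
     (\<forall>m. (\<integral>s. complex_of_real (clamp01 s ^ m) \<partial>M) = cinner x ((R ^^ m) x)))"

lemma mu: "sets (mu x) = sets borel" "emeasure (mu x) UNIV \<le> ennreal ((norm x)\<^sup>2)"
  "(\<integral>s. complex_of_real (clamp01 s ^ m) \<partial>mu x) = cinner x ((R ^^ m) x)"
  using someI_ex[OF ex_moment_measure[of x]] unfolding mu_def[symmetric] by blast+

section \<open>Multiplicativity of the calculus and the resulting spectral measure\<close>

sublocale form_family mu
  by standard (rule mu)+

lemma bclin_power: "bclin (R ^^ m)"
  using bclin_peval[of "[:0,1:] ^ m"] by (simp add: peval_power[abs_def])

lemma represents_power: "represents (\<lambda>s. of_real (clamp01 s ^ m)) (R ^^ m)"
  by (simp only: represents_def bclin_power mu(3) simp_thms)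

text \<open>Existence and multiplication by a fixed power of \<open>R\<close> are proved by one
  induction, since a limit step needs the same operators \<open>T n\<close> for both. In that step
  the weak limit of \<open>R ^^ m\<close> applied to \<open>T n x\<close> is identified by moving
  the symmetric \<open>R ^^ m\<close> to the test vector.\<close>

lemma represents_power_mult:
  "bdd_borel f \<Longrightarrow> \<exists>T. represents (\<lambda>s. f (clamp01 s)) T \<and>
     represents (\<lambda>s. of_real (clamp01 s ^ m) * f (clamp01 s)) (\<lambda>x. (R ^^ m) (T x))"
proof (induction f rule: clamp01_induct)
  case (power k)
  show ?case
    using represents_power[of k] represents_power[of "m + k"]
    by (intro exI[of _ "R ^^ k"]) (simp add: power_add funpow_add comp_def)
next
  case (scale c f)
  then obtain T where T: "represents f T" "represents (\<lambda>s. of_real (clamp01 s ^ m) * f s) (\<lambda>x. (R ^^ m) (T x))"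
    by blast
  show ?case
    using represents_scale[OF T(1), of c] represents_scale[OF T(2), of c]
    by (intro exI[of _ "\<lambda>x. scaleC c (T x)"]) (simp add: bclin_scaleC[OF bclin_power] mult.left_commute)
next
  case (add f g)
  then obtain T S where T: "represents f T" "represents (\<lambda>s. of_real (clamp01 s ^ m) * f s) (\<lambda>x. (R ^^ m) (T x))"
    and S: "represents g S" "represents (\<lambda>s. of_real (clamp01 s ^ m) * g s) (\<lambda>x. (R ^^ m) (S x))"
    by blast
  show ?case
    using represents_add[OF add(1,2) T(1) S(1)]
      represents_add[OF bdd_borel_mult[OF bdd_borel_clamp01_power add(1)] bdd_borel_mult[OF bdd_borel_clamp01_power add(2)] T(2) S(2)]
    by (intro exI[of _ "\<lambda>x. T x + S x"]) (simp add: bclin_add[OF bclin_power] distrib_left)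
next
  case (lim F g C)
  from lim.IH have "\<forall>n. \<exists>T. represents (F n) T \<and>
     represents (\<lambda>s. of_real (clamp01 s ^ m) * F n s) (\<lambda>x. (R ^^ m) (T x))" by (rule allI)
  from choice[OF this] obtain T where T: "\<And>n. represents (F n) (T n)"
    "\<And>n. represents (\<lambda>s. of_real (clamp01 s ^ m) * F n s) (\<lambda>x. (R ^^ m) (T n x))" by blast
  obtain S where S: "represents g S" "\<And>x z. (\<lambda>n. cinner z (T n x)) \<longlonglongrightarrow> cinner z (S x)"
    using represents_lim[OF lim.hyps(1) T(1) lim.hyps(2-4)] by blast
  have "cmod (of_real (clamp01 s ^ m) * F n s) \<le> 1 * C" for n s
    unfolding norm_mult by (intro mult_mono lim.hyps(2)) (auto simp: norm_power clamp01_bounds power_le_one)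
  then have "\<exists>S'. represents (\<lambda>s. of_real (clamp01 s ^ m) * g s) S' \<and>
      (\<forall>x z. (\<lambda>n. cinner z ((R ^^ m) (T n x))) \<longlonglongrightarrow> cinner z (S' x))"
    by (intro represents_lim[OF bdd_borel_mult[OF bdd_borel_clamp01_power lim.hyps(1)] T(2)])
      (auto intro!: bdd_borel_mult bdd_borel_clamp01_power lim.hyps tendsto_mult simp del: of_real_power)
  then obtain S' where S': "represents (\<lambda>s. of_real (clamp01 s ^ m) * g s) S'"
    "\<And>x z. (\<lambda>n. cinner z ((R ^^ m) (T n x))) \<longlonglongrightarrow> cinner z (S' x)" by blast
  have eq: "S' = (\<lambda>x. (R ^^ m) (S x))"
  proof (rule ext, rule cinner_ext)
    fix x z
    have "(\<lambda>n. cinner z ((R ^^ m) (T n x))) \<longlonglongrightarrow> cinner z ((R ^^ m) (S x))"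
      using S(2)[of "(R ^^ m) z" x] by (simp add: power_sym)
    then show "cinner z (S' x) = cinner z ((R ^^ m) (S x))" by (rule LIMSEQ_unique[OF S'(2)])
  qed
  show ?case using S(1) S'(1)[unfolded eq] by blast
qed

text \<open>The second half of multiplicativity: \<open>g\<close> and its operator \<open>T\<close>
  are fixed, \<open>f\<close> varies. The base case of powers is
  \<open>represents_power_mult\<close>, and the limit step evaluates weak convergence at the vector
  \<open>T x\<close>.\<close>

lemma represents_clamp_mult:
  assumes g: "bdd_borel g" "represents (\<lambda>s. g (clamp01 s)) T"
  shows "bdd_borel f \<Longrightarrow> \<exists>S. represents (\<lambda>s. f (clamp01 s)) S \<and>
     represents (\<lambda>s. f (clamp01 s) * g (clamp01 s)) (\<lambda>x. S (T x))"
proof (induction f rule: clamp01_induct)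
  case (power m)
  obtain T' where T': "represents (\<lambda>s. g (clamp01 s)) T'"
    "represents (\<lambda>s. of_real (clamp01 s ^ m) * g (clamp01 s)) (\<lambda>x. (R ^^ m) (T' x))"
    using represents_power_mult[OF g(1)] by blast
  have "T = T'" by (rule represents_unique[OF g(2) T'(1)])
  then show ?case using represents_power[of m] T'(2) by blast
next
  case (scale c f)
  then obtain S where S: "represents f S" "represents (\<lambda>s. f s * g (clamp01 s)) (\<lambda>x. S (T x))" by blast
  show ?case
    using represents_scale[OF S(1), of c] represents_scale[OF S(2), of c]
    by (intro exI[of _ "\<lambda>x. scaleC c (S x)"]) (simp add: mult.assoc)
next
  case (add f h)
  then obtain S S' where S: "represents f S" "represents (\<lambda>s. f s * g (clamp01 s)) (\<lambda>x. S (T x))"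
    and S': "represents h S'" "represents (\<lambda>s. h s * g (clamp01 s)) (\<lambda>x. S' (T x))" by blast
  note b = bdd_borel_clamp01[OF g(1)]
  show ?case
    using represents_add[OF add(1,2) S(1) S'(1)]
      represents_add[OF bdd_borel_mult[OF add(1) b] bdd_borel_mult[OF add(2) b] S(2) S'(2)]
    by (intro exI[of _ "\<lambda>x. S x + S' x"]) (simp add: distrib_right)
next
  case (lim F h C)
  from lim.IH have "\<forall>n. \<exists>S. represents (F n) S \<and>
     represents (\<lambda>s. F n s * g (clamp01 s)) (\<lambda>x. S (T x))" by (rule allI)
  from choice[OF this] obtain S where S: "\<And>n. represents (F n) (S n)"
    "\<And>n. represents (\<lambda>s. F n s * g (clamp01 s)) (\<lambda>x. S n (T x))" by blast
  obtain V where V: "represents h V" "\<And>x z. (\<lambda>n. cinner z (S n x)) \<longlonglongrightarrow> cinner z (V x)"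
    using represents_lim[OF lim.hyps(1) S(1) lim.hyps(2-4)] by blast
  note b = bdd_borel_clamp01[OF g(1)]
  obtain D where D: "\<And>s. cmod (g (clamp01 s)) \<le> D" "0 \<le> D" using bdd_borel_bound[OF b] by blast
  have "cmod (F n s * g (clamp01 s)) \<le> C * D" for n s
    unfolding norm_mult using order_trans[OF norm_ge_zero lim.hyps(2)]
    by (intro mult_mono lim.hyps(2) D) auto
  then have "\<exists>S'. represents (\<lambda>s. h s * g (clamp01 s)) S' \<and>
      (\<forall>x z. (\<lambda>n. cinner z (S n (T x))) \<longlonglongrightarrow> cinner z (S' x))"
    by (intro represents_lim[OF bdd_borel_mult[OF lim.hyps(1) b] S(2)])
      (auto intro!: bdd_borel_mult b lim.hyps tendsto_mult)
  then obtain S' where S': "represents (\<lambda>s. h s * g (clamp01 s)) S'"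
    "\<And>x z. (\<lambda>n. cinner z (S n (T x))) \<longlonglongrightarrow> cinner z (S' x)" by blast
  have eq: "S' = (\<lambda>x. V (T x))"
    by (rule ext, rule cinner_ext, rule LIMSEQ_unique[OF S'(2) V(2)])
  show ?case using V(1) S'(1)[unfolded eq] by blast
qed

definition cop :: "(real \<Rightarrow> complex) \<Rightarrow> 'h \<Rightarrow> 'h" where
  "cop f = opr (\<lambda>s. f (clamp01 s))"

lemma cop: "bdd_borel f \<Longrightarrow> represents (\<lambda>s. f (clamp01 s)) (cop f)"
  unfolding cop_def using represents_power_mult[of f 0] represents_opr by blast

lemma cop_eqI: "represents (\<lambda>s. f (clamp01 s)) T \<Longrightarrow> cop f = T"
  unfolding cop_def by (rule opr_eqI)

lemma cop_mult: "bdd_borel f \<Longrightarrow> bdd_borel g \<Longrightarrow> cop (\<lambda>s. f s * g s) x = cop f (cop g x)"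
proof -
  assume f: "bdd_borel f" and g: "bdd_borel g"
  from represents_clamp_mult[OF g cop[OF g] f] obtain S where
    "represents (\<lambda>s. f (clamp01 s)) S" "represents (\<lambda>s. f (clamp01 s) * g (clamp01 s)) (\<lambda>x. S (cop g x))"
    by blast
  then show ?thesis using cop_eqI[of f S] cop_eqI[of "\<lambda>s. f s * g s"] by simp
qed

definition F :: "real set \<Rightarrow> 'h \<Rightarrow> 'h" where
  "F S = cop (indicator S)"

lemma F_form: "S \<in> sets borel \<Longrightarrow> cinner x (F S x) = (\<integral>s. indicator S (clamp01 s) \<partial>mu x)"
  and bclin_F: "S \<in> sets borel \<Longrightarrow> bclin (F S)"
proof -
  assume "S \<in> sets borel"
  from cop[OF bdd_borel_indicator[OF this]]
  show "cinner x (F S x) = (\<integral>s. indicator S (clamp01 s) \<partial>mu x)" "bclin (F S)"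
    unfolding represents_def F_def by (rule conjunct2[THEN spec], rule conjunct1)
qed

lemma F_Int: "S \<in> sets borel \<Longrightarrow> T \<in> sets borel \<Longrightarrow> F (S \<inter> T) x = F S (F T x)"
  using cop_mult[OF bdd_borel_indicator bdd_borel_indicator, of S T x]
  by (simp add: F_def indicator_inter_arith[abs_def])

lemma F_form_real: "S \<in> sets borel \<Longrightarrow> Im (cinner x (F S x)) = 0"
proof -
  assume S: "S \<in> sets borel"
  have "(\<integral>s. indicator S (clamp01 s) \<partial>mu x) = (\<integral>s. complex_of_real (indicator S (clamp01 s)) \<partial>mu x)"
    by (rule Bochner_Integration.integral_cong) (auto simp: indicator_def)
  then show ?thesis by (simp add: F_form[OF S])
qed

lemma F_sym: "S \<in> sets borel \<Longrightarrow> cinner (F S x) y = cinner x (F S y)"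
  by (intro bclin_selfadjoint_iff_real bclin_F F_form_real)

lemma F_proj: "S \<in> sets borel \<Longrightarrow> \<exists>M. closed_csubspace M \<and> F S = proj_onto M"
  using F_Int[of S S] by (intro projection_operator bclin_F F_sym) auto

lemma F_form_norm: "S \<in> sets borel \<Longrightarrow> cinner x (F S x) = of_real ((norm (F S x))\<^sup>2)"
  using F_proj[of S] bclin_proj_onto(4) by metis

lemma F_UNIV: "F UNIV x = x"
proof -
  have "represents (\<lambda>s. indicator UNIV (clamp01 s)) (\<lambda>x. x)"
    using represents_power[of 0] by (simp add: id_def)
  then show ?thesis unfolding F_def using cop_eqI by metis
qed

lemma F_add: "S \<in> sets borel \<Longrightarrow> T \<in> sets borel \<Longrightarrow> S \<inter> T = {} \<Longrightarrow> F (S \<union> T) x = F S x + F T x"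
proof -
  assume S: "S \<in> sets borel" and T: "T \<in> sets borel" and d: "S \<inter> T = {}"
  have "represents (\<lambda>s. indicator S (clamp01 s) + indicator T (clamp01 s)) (\<lambda>x. F S x + F T x)"
    unfolding F_def by (intro represents_add bdd_borel_clamp01 cop bdd_borel_indicator S T)
  moreover have "(\<lambda>s. indicator S (clamp01 s) + indicator T (clamp01 s)) = (\<lambda>s. indicator (S \<union> T) (clamp01 s) :: complex)"
    using d by (auto simp: indicator_def fun_eq_iff)
  ultimately show ?thesis using cop_eqI unfolding F_def by metis
qed

lemma spectral_F: "spectral UNIV F"
proof
  show "closed_csubspace UNIV" by (rule closed_csubspace_UNIV)
  show "spectral_measure_on UNIV F"
    unfolding spectral_measure_on_def
  proof (intro conjI ballI allI impI)
    show "\<exists>M. closed_csubspace M \<and> M \<subseteq> UNIV \<and> F S = proj_onto M" if "S \<in> sets borel" for S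
      using F_proj[OF that] by simp
    show "F UNIV = proj_onto UNIV"
      by (rule ext) (simp add: F_UNIV proj_onto_self[OF closed_csubspace_imp_csubspace[OF closed_csubspace_UNIV]])
    show "F (S \<inter> T) = F S \<circ> F T" if "S \<in> sets borel" "T \<in> sets borel" for S T
      using F_Int[OF that] by auto
    fix A :: "nat \<Rightarrow> real set" and x
    assume A: "range A \<subseteq> sets borel" and dis: "disjoint_family A"
    have Ai: "A i \<in> sets borel" for i using A by auto
    have UA: "(\<Union>i. A i) \<in> sets borel" "(\<Union>i<n. A i) \<in> sets borel" for n using Ai by auto
    have sum: "(\<Sum>i<n. F (A i) x) = F (\<Union>i<n. A i) x" for n
    proof (induction n)
      case 0
      have "F ({} \<union> {}) x = F {} x + F {} x" by (rule F_add) auto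
      then show ?case by simp
    next
      case (Suc n)
      have "(\<Union>i<n. A i) \<inter> A n = {}"
        using dis by (auto simp: disjoint_family_on_def) (metis Int_iff empty_iff less_irrefl)
      from F_add[OF UA(2) Ai this] show ?case using Suc by (simp add: lessThan_Suc Un_commute)
    qed
    \<comment> \<open>Countable additivity is read off the tails:
      \<open>\<parallel>F (B n) x\<parallel>^2\<close> is the integral of an indicator tending to 0
      pointwise.\<close>
    define B where "B n = (\<Union>i. A i) - (\<Union>i<n. A i)" for n :: nat
    have B: "B n \<in> sets borel" for n unfolding B_def using UA by auto
    have split: "F (\<Union>i. A i) x = F (\<Union>i<n. A i) x + F (B n) x" for n
    proof -
      have "(\<Union>i<n. A i) \<union> B n = (\<Union>i. A i)" "(\<Union>i<n. A i) \<inter> B n = {}" by (auto simp: B_def)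
      then show ?thesis using F_add[OF UA(2) B] by metis
    qed
    have "(\<lambda>n. cinner x (F (B n) x)) \<longlonglongrightarrow> (\<integral>s. 0 \<partial>mu x)"
      unfolding F_form[OF B]
    proof (rule integral_mu_tendsto[where C=1])
      show "bdd_borel (\<lambda>s. indicator (B n) (clamp01 s))" for n
        by (intro bdd_borel_clamp01 bdd_borel_indicator B)
      show "cmod (indicator (B n) (clamp01 s)) \<le> 1" for n s by (simp add: indicator_def)
      show "(\<lambda>n. indicator (B n) (clamp01 s) :: complex) \<longlonglongrightarrow> 0" for s
      proof -
        have "(\<lambda>n. indicator (\<Union>i. A i) (clamp01 s) - indicator (\<Union>i<n. A i) (clamp01 s) :: complex)
            \<longlonglongrightarrow> indicator (\<Union>i. A i) (clamp01 s) - indicator (\<Union>i. A i) (clamp01 s)"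
          by (intro tendsto_diff tendsto_const LIMSEQ_indicator_UN)
        moreover have "indicator (B n) t = (indicator (\<Union>i. A i) t - indicator (\<Union>i<n. A i) t :: complex)" for n t
          by (auto simp: B_def indicator_def)
        ultimately show ?thesis by simp
      qed
    qed (rule bdd_borel_const)
    then have "(\<lambda>n. complex_of_real ((norm (F (B n) x))\<^sup>2)) \<longlonglongrightarrow> of_real 0"
      by (simp add: F_form_norm[OF B] del: of_real_power)
    then have "(\<lambda>n. (norm (F (B n) x))\<^sup>2) \<longlonglongrightarrow> 0" by (simp only: tendsto_of_real_iff)
    then have "(\<lambda>n. sqrt ((norm (F (B n) x))\<^sup>2)) \<longlonglongrightarrow> sqrt 0" by (rule tendsto_real_sqrt)
    then have "(\<lambda>n. F (B n) x) \<longlonglongrightarrow> 0" by (simp add: tendsto_norm_zero_iff)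
    then have "(\<lambda>n. F (\<Union>i. A i) x - F (B n) x) \<longlonglongrightarrow> F (\<Union>i. A i) x - 0"
      by (intro tendsto_diff tendsto_const)
    moreover have "(\<Sum>i<n. F (A i) x) = F (\<Union>i. A i) x - F (B n) x" for n
      unfolding sum using split[of n] by simp
    ultimately show "(\<lambda>n. \<Sum>i<n. F (A i) x) \<longlonglongrightarrow> F (\<Union> (range A)) x" by simp
  qed
qed

text \<open>The calculus built from \<open>mu\<close> and the one built from the new measures
  \<open>spec_meas F\<close> agree on indicators and have the same limit behaviour. This transfers
  the first-moment identity for \<open>R\<close> to its spectral measure.\<close>

lemma opr_F_eq_cop: "bdd_borel f \<Longrightarrow> form_family.opr (spec_meas F) f = cop f"
proof -
  interpret sF: spectral UNIV F by (rule spectral_F)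
  show "bdd_borel f \<Longrightarrow> sF.opr f = cop f"
  proof (induction f rule: bdd_borel_induct)
    case (indicator S)
    show ?case by (rule trans[OF sF.opr_indicator[OF indicator] F_def])
  next
    case (scale c f)
    then show ?case
      using represents_scale[OF cop[OF scale(1)], of c] by (intro ext) (simp add: sF.opr_scale cop_eqI)
  next
    case (add f g)
    then show ?case
      using represents_add[OF bdd_borel_clamp01[OF add(1)] bdd_borel_clamp01[OF add(2)] cop[OF add(1)] cop[OF add(2)]]
      by (intro ext) (simp add: sF.opr_add cop_eqI)
  next
    case (lim H g C)
    show ?case
    proof (intro ext cinner_ext)
      fix x z
      have "(\<lambda>n. cinner z (sF.opr (H n) x)) \<longlonglongrightarrow> cinner z (sF.opr g x)"
        by (intro sF.opr_weak_tendsto[where C=C] lim)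
      moreover obtain S where S: "represents (\<lambda>s. g (clamp01 s)) S" "(\<lambda>n. cinner z (cop (H n) x)) \<longlonglongrightarrow> cinner z (S x)"
        using represents_lim[of "\<lambda>n s. H n (clamp01 s)" "\<lambda>n. cop (H n)" C "\<lambda>s. g (clamp01 s)"]
          bdd_borel_clamp01 cop lim.hyps by blast
      ultimately show "cinner z (sF.opr g x) = cinner z (cop g x)"
        unfolding lim.IH using LIMSEQ_unique cop_eqI[OF S(1)] by blast
    qed
  qed
qed

end

text \<open>The bounded calculus applies to bounded functions, so \<open>clamp01\<close> stands for
  the identity. It represents \<open>R\<close> because clamping twice is clamping once and the first
  moment is the form of \<open>R\<close>.\<close>

theorem spectral_theorem_unit_operator:
  assumes "unit_operator R"
  shows "\<exists>F. spectral UNIV F \<and> form_family.opr (spec_meas F) (\<lambda>s. of_real (clamp01 s)) = R"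
proof -
  interpret unit_operator R by fact
  have "bdd_borel (\<lambda>s. of_real (clamp01 s))" using bdd_borel_clamp01_power[of 1] by simp
  moreover have "cop (\<lambda>s. of_real (clamp01 s)) = R"
  proof (rule cop_eqI)
    have "clamp01 (clamp01 s) = clamp01 s" for s using clamp01_bounds[of s] by (rule clamp01_id)
    then show "represents (\<lambda>s. of_real (clamp01 (clamp01 s))) R"
      using represents_power[of 1] by simp
  qed
  ultimately show ?thesis using spectral_F opr_F_eq_cop by metis
qed

section \<open>Self-adjoint operators\<close>

lemma is_op_on_add: "is_op_on K T \<Longrightarrow> (x, y) \<in> T \<Longrightarrow> (u, v) \<in> T \<Longrightarrow> (x + u, y + v) \<in> T"
  and is_op_on_scaleC: "is_op_on K T \<Longrightarrow> (x, y) \<in> T \<Longrightarrow> (scaleC c x, scaleC c y) \<in> T"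
  and is_op_on_unique: "is_op_on K T \<Longrightarrow> (x, y) \<in> T \<Longrightarrow> (x, z) \<in> T \<Longrightarrow> y = z"
  and is_op_on_zero: "is_op_on K T \<Longrightarrow> (0, 0) \<in> T"
  and is_op_on_mem: "is_op_on K T \<Longrightarrow> (x, y) \<in> T \<Longrightarrow> x \<in> K \<and> y \<in> K"
  by (auto simp: is_op_on_def)

lemma is_op_on_diff: "is_op_on K T \<Longrightarrow> (x, y) \<in> T \<Longrightarrow> (u, v) \<in> T \<Longrightarrow> (x - u, y - v) \<in> T"
  using is_op_on_add[of K T x y "scaleC (-1) u" "scaleC (-1) v"] is_op_on_scaleC[of K T u v "-1"]
  by (simp add: scaleC_minus_left)

locale selfadjoint =
  fixes K :: "'h::chilbert_space set" and T
  assumes K: "closed_csubspace K" and T: "selfadj_on K T"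
begin

lemmas K_sub = closed_csubspace_imp_csubspace[OF K]

lemma op: "is_op_on K T"
  using T by (simp add: selfadj_on_def)

lemmas add = is_op_on_add[OF op] and scaleC = is_op_on_scaleC[OF op] and unique = is_op_on_unique[OF op]
  and zero = is_op_on_zero[OF op] and mem = is_op_on_mem[OF op] and diff = is_op_on_diff[OF op]

lemma sym: "(x, y) \<in> T \<Longrightarrow> (u, v) \<in> T \<Longrightarrow> cinner y u = cinner x v"
proof -
  assume xy: "(x, y) \<in> T" and "(u, v) \<in> T"
  then have "(u, v) \<in> adjoint_on K T" using T by (simp add: selfadj_on_def)
  then show ?thesis using xy by (simp add: adjoint_on_def)
qed

lemma memI: "y \<in> K \<Longrightarrow> z \<in> K \<Longrightarrow> (\<And>x w. (x, w) \<in> T \<Longrightarrow> cinner w y = cinner x z) \<Longrightarrow> (y, z) \<in> T"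
proof -
  assume "y \<in> K" "z \<in> K" "\<And>x w. (x, w) \<in> T \<Longrightarrow> cinner w y = cinner x z"
  then have "(y, z) \<in> adjoint_on K T" by (simp add: adjoint_on_def)
  then show ?thesis using T by (simp add: selfadj_on_def)
qed

lemma limit:
  assumes s: "\<And>n. (xs n, ys n) \<in> T" and x: "xs \<longlonglongrightarrow> x" and y: "ys \<longlonglongrightarrow> y"
  shows "(x, y) \<in> T"
proof (rule memI)
  have cl: "closed K" using K by (simp add: closed_csubspace_def)
  show "x \<in> K" using closed_sequentially[OF cl _ x] mem[OF s] by blast
  show "y \<in> K" using closed_sequentially[OF cl _ y] mem[OF s] by blast
  fix u w assume uw: "(u, w) \<in> T"
  have "(\<lambda>n. cinner w (xs n)) \<longlonglongrightarrow> cinner w x" "(\<lambda>n. cinner u (ys n)) \<longlonglongrightarrow> cinner u y"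
    by (intro tendsto_cinner tendsto_const x y)+
  moreover have "cinner w (xs n) = cinner u (ys n)" for n by (rule sym[OF uw s])
  ultimately show "cinner w x = cinner u y" using LIMSEQ_unique by simp
qed

text \<open>The lower bound for \<open>T + c\<close> makes its range closed, and the lower bound for
  \<open>T + cnj c\<close> makes the orthogonal complement of the range trivial. It is used with
  \<open>c > 0\<close> for positive \<open>T\<close> and with \<open>c = \<i>\<close>,
  \<open>c = -\<i>\<close> in general.\<close>

lemma surj:
  assumes d: "\<delta> > 0"
    and 1: "\<And>x y. (x, y) \<in> T \<Longrightarrow> \<delta> * norm x \<le> norm (y + scaleC c x)"
    and 2: "\<And>x y. (x, y) \<in> T \<Longrightarrow> \<delta> * norm x \<le> norm (y + scaleC (cnj c) x)"
    and k: "k \<in> K"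
  shows "\<exists>x y. (x, y) \<in> T \<and> y + scaleC c x = k"
proof -
  define M where "M = {y + scaleC c x | x y. (x, y) \<in> T}"
  have "csubspace M"
    unfolding csubspace_def
  proof (intro conjI ballI allI)
    show "0 \<in> M" using zero unfolding M_def by force
    fix u v assume "u \<in> M" "v \<in> M"
    then obtain x y x' y' where *: "(x, y) \<in> T" "u = y + scaleC c x" "(x', y') \<in> T" "v = y' + scaleC c x'"
      by (auto simp: M_def)
    then have "u + v = (y + y') + scaleC c (x + x')" by (simp add: scaleC_add_right)
    then show "u + v \<in> M" using add[OF *(1,3)] unfolding M_def by blast
  next
    fix a u assume "u \<in> M"
    then obtain x y where *: "(x, y) \<in> T" "u = y + scaleC c x" by (auto simp: M_def)
    then have "scaleC a u = scaleC a y + scaleC c (scaleC a x)"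
      by (simp add: scaleC_add_right scaleC_scaleC mult.commute)
    then show "scaleC a u \<in> M" using scaleC[OF *(1), of a] unfolding M_def by blast
  qed
  moreover have "closed M"
    unfolding closed_sequential_limits
  proof (intro allI impI, elim conjE)
    fix s l assume "\<forall>n. s n \<in> M" and sl: "s \<longlonglongrightarrow> l"
    then have "\<forall>n. \<exists>p. p \<in> T \<and> s n = snd p + scaleC c (fst p)" unfolding M_def by fastforce
    then obtain p where p: "\<And>n. p n \<in> T" "\<And>n. s n = snd (p n) + scaleC c (fst (p n))" by metis
    define xs where "xs n = fst (p n)" for n
    define ys where "ys n = snd (p n)" for n
    have xy: "(xs n, ys n) \<in> T" and s: "s n = ys n + scaleC c (xs n)" for n
      using p by (simp_all add: xs_def ys_def)
    have est: "norm (xs m - xs n) \<le> norm (s m - s n) / \<delta>" for m n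
    proof -
      have "\<delta> * norm (xs m - xs n) \<le> norm (ys m - ys n + scaleC c (xs m - xs n))"
        by (rule 1[OF diff[OF xy xy]])
      also have "ys m - ys n + scaleC c (xs m - xs n) = s m - s n"
        by (simp add: s scaleC_diff_right)
      finally show ?thesis using d by (simp add: field_simps)
    qed
    have "Cauchy s" using sl LIMSEQ_imp_Cauchy by blast
    have "Cauchy xs"
    proof (rule CauchyI)
      fix e :: real assume "e > 0"
      then obtain N where "\<And>m n. m \<ge> N \<Longrightarrow> n \<ge> N \<Longrightarrow> norm (s m - s n) < e * \<delta>"
        using CauchyD[OF \<open>Cauchy s\<close>, of "e * \<delta>"] d by auto
      then have "norm (xs m - xs n) < e" if "m \<ge> N" "n \<ge> N" for m n
        using est[of m n] that d by (meson divide_less_eq le_less_trans)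
      then show "\<exists>N. \<forall>m\<ge>N. \<forall>n\<ge>N. norm (xs m - xs n) < e" by blast
    qed
    then obtain x where x: "xs \<longlonglongrightarrow> x" using Cauchy_convergent convergent_def by blast
    have "(\<lambda>n. s n - scaleC c (xs n)) \<longlonglongrightarrow> l - scaleC c x" by (intro tendsto_diff sl tendsto_scaleC x)
    then have "ys \<longlonglongrightarrow> l - scaleC c x" by (simp add: s)
    from limit[OF xy x this] show "l \<in> M" unfolding M_def by force
  qed
  ultimately have M: "closed_csubspace M" by (simp add: closed_csubspace_def)
  define r where "r = k - proj_onto M k"
  have MK: "M \<subseteq> K"
    unfolding M_def using mem csubspace_add[OF K_sub] csubspace_scaleC[OF K_sub] by blast
  have rK: "r \<in> K"
    unfolding r_def using csubspace_diff[OF K_sub k] proj_onto_mem[OF M] MK by blast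
  \<comment> \<open>Orthogonality of \<open>r\<close> to the range of \<open>T + c\<close> says that
    \<open>r\<close> lies in the domain of the adjoint, with value \<open>- cnj c\<close> times
    \<open>r\<close>; the adjoint is \<open>T\<close> itself.\<close>
  have "(r, scaleC (- cnj c) r) \<in> T"
  proof (rule memI[OF rK csubspace_scaleC[OF K_sub rK]])
    fix x w assume "(x, w) \<in> T"
    then have "w + scaleC c x \<in> M" unfolding M_def by blast
    then have "cinner (w + scaleC c x) r = 0" unfolding r_def by (rule proj_onto_orth[OF M])
    then show "cinner w r = cinner x (scaleC (- cnj c) r)" by (simp add: cinner_simps eq_neg_iff_add_eq_0)
  qed
  from 2[OF this] have "\<delta> * norm r \<le> 0" by (simp add: scaleC_minus_left)
  then have "r = 0" using d by (simp add: mult_le_0_iff)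
  then have "k \<in> M" using proj_onto_mem[OF M, of k] by (simp add: r_def)
  then show ?thesis unfolding M_def by blast
qed

lemma cinner_real: "(x, y) \<in> T \<Longrightarrow> Im (cinner x y) = 0"
proof -
  assume "(x, y) \<in> T"
  then have "cnj (cinner x y) = cinner x y" using sym[of x y x y] cinner_commute[of y x] by simp
  then show ?thesis by (simp add: complex_eq_iff)
qed

text \<open>For \<open>b = \<i>\<close> or \<open>b = -\<i>\<close> the cross term of
  \<open>\<parallel>T x + b x\<parallel>^2\<close> vanishes, leaving
  \<open>\<parallel>T x\<parallel>^2 + \<parallel>x\<parallel>^2\<close>; so \<open>surj\<close>
  applies with constant 1.\<close>

lemma surj_i:
  assumes c: "c = \<i> \<or> c = - \<i>" and k: "k \<in> K"
  shows "\<exists>x y. (x, y) \<in> T \<and> y + scaleC c x = k"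
proof (rule surj[OF _ _ _ k])
  have *: "1 * norm x \<le> norm (y + scaleC b x)" if xy: "(x, y) \<in> T" and b: "b = \<i> \<or> b = - \<i>" for x y b
  proof -
    have "Re (cinner y (scaleC b x)) = 0"
      using cinner_real[OF xy] b cinner_commute[of y x] by (auto simp: cinner_scaleC_right)
    moreover have "cmod b = 1" using b by auto
    ultimately have "(norm (y + scaleC b x))\<^sup>2 = (norm y)\<^sup>2 + (norm x)\<^sup>2"
      unfolding norm_add_sq norm_scaleC by simp
    then have "(norm x)\<^sup>2 \<le> (norm (y + scaleC b x))\<^sup>2" by simp
    then show ?thesis unfolding mult_1 by (rule power2_le_imp_le) simp
  qed
  show "1 * norm x \<le> norm (y + scaleC c x)" if "(x, y) \<in> T" for x y using *[OF that c] .
  show "1 * norm x \<le> norm (y + scaleC (cnj c) x)" if "(x, y) \<in> T" for x y using *[OF that] c by auto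
qed simp

text \<open>Subtracting projections sends graph pairs of \<open>T\<close> to graph pairs of the
  part. This yields density, and it extends the adjoint condition from test pairs of the part to all
  test pairs of \<open>T\<close>.\<close>

lemma reduced_part:
  assumes KU: "K = UNIV" and M: "reduces M T"
  shows "selfadj_on (orth_compl M) (op_part (orth_compl M) T)"
proof -
  let ?K = "orth_compl M" and ?T = "op_part (orth_compl M) T"
  have Mc: "closed_csubspace M" and red: "\<And>x y. (x, y) \<in> T \<Longrightarrow> (proj_onto M x, proj_onto M y) \<in> T"
    using M by (auto simp: reduces_def)
  have part: "(x - proj_onto M x, y - proj_onto M y) \<in> ?T" if "(x, y) \<in> T" for x y
    using diff[OF that red[OF that]] diff_proj_in_orth_compl[OF Mc] by (simp add: op_part_def)
  have ran: "y \<in> ?K" if "(x, y) \<in> ?T" for x y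
  proof -
    have "(0, proj_onto M y) \<in> T" using that red[of x y] proj_onto_zero_iff[OF Mc, of x] by (simp add: op_part_def)
    then have "proj_onto M y = 0" using unique zero by blast
    then show ?thesis using proj_onto_zero_iff[OF Mc] by blast
  qed
  note sub = closed_csubspace_imp_csubspace[OF closed_csubspace_orth_compl[of M]]
  have opT: "is_op_on ?K ?T"
    unfolding is_op_on_def
  proof (intro conjI allI impI)
    show "?T \<subseteq> ?K \<times> ?K" using ran by (auto simp: op_part_def)
  qed (use zero add scaleC unique csubspace_0[OF sub] csubspace_add[OF sub] csubspace_scaleC[OF sub] in \<open>auto simp: op_part_def\<close>)
  have dense: "?K \<subseteq> closure (op_dom ?T)"
  proof
    fix k assume k: "k \<in> ?K"
    have "k \<in> closure (op_dom T)" using T KU by (auto simp: selfadj_on_def)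
    then obtain s where s: "\<And>n. s n \<in> op_dom T" "s \<longlonglongrightarrow> k" unfolding closure_sequential by blast
    have "(\<lambda>n. s n - proj_onto M (s n)) \<longlonglongrightarrow> k - proj_onto M k"
      by (intro tendsto_diff s bclin_tendsto[OF bclin_proj_onto(1)[OF Mc]])
    moreover have "proj_onto M k = 0" using k proj_onto_zero_iff[OF Mc] by blast
    moreover have "s n - proj_onto M (s n) \<in> op_dom ?T" for n using s(1)[of n] part by (auto simp: op_dom_def)
    ultimately show "k \<in> closure (op_dom ?T)"
      unfolding closure_sequential by (intro exI[of _ "\<lambda>n. s n - proj_onto M (s n)"]) auto
  qed
  have "?T = adjoint_on ?K ?T"
  proof (intro set_eqI iffI; clarify)
    fix y z assume yz: "(y, z) \<in> ?T"
    have "cinner w y = cinner x z" if "(x, w) \<in> ?T" for x w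
      using sym[of x w y z] that yz by (simp add: op_part_def)
    then show "(y, z) \<in> adjoint_on ?K ?T"
      using yz ran[OF yz] by (auto simp: adjoint_on_def op_part_def)
  next
    fix y z assume yz: "(y, z) \<in> adjoint_on ?K ?T"
    then have yK: "y \<in> ?K" and zK: "z \<in> ?K" and *: "\<And>x w. (x, w) \<in> ?T \<Longrightarrow> cinner w y = cinner x z"
      by (auto simp: adjoint_on_def)
    have "(y, z) \<in> T"
    proof (rule memI)
      show "y \<in> K" "z \<in> K" using KU by auto
      fix x w assume xw: "(x, w) \<in> T"
      have "cinner (proj_onto M w) y = 0" "cinner (proj_onto M x) z = 0"
        using yK zK proj_onto_mem[OF Mc] by (auto simp: orth_compl_def)
      then show "cinner w y = cinner x z" using *[OF part[OF xw]] by (simp add: cinner_simps)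
    qed
    then show "(y, z) \<in> ?T" using yK by (simp add: op_part_def)
  qed
  then show ?thesis using opT dense by (simp add: selfadj_on_def)
qed

end

section \<open>Positive operators and the bounded inverse of \<open>T + 1\<close>\<close>

locale positive = selfadjoint +
  assumes pos: "\<And>x y. (x, y) \<in> T \<Longrightarrow> 0 \<le> Re (cinner x y)"
begin

lemma pos_lower_bound:
  assumes xy: "(x, y) \<in> T" and c: "c > 0"
  shows "c * norm x \<le> norm (y + scaleC (of_real c) x)"
proof (cases "x = 0")
  case False
  have "c * (norm x)\<^sup>2 \<le> Re (cinner x (y + scaleC (of_real c) x))"
    using pos[OF xy] by (simp add: cinner_simps cinner_norm)
  also have "\<dots> \<le> norm x * norm (y + scaleC (of_real c) x)"
    using Cauchy_Schwarz_cinner complex_Re_le_cmod order_trans by blast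
  finally show ?thesis using False by (simp add: power2_eq_square)
qed simp

lemma pos_surj: "c > 0 \<Longrightarrow> k \<in> K \<Longrightarrow> \<exists>x y. (x, y) \<in> T \<and> y + scaleC (of_real c) x = k"
  by (rule surj[of c]) (simp_all add: pos_lower_bound)

lemma pos_inj: "(x, y) \<in> T \<Longrightarrow> c > 0 \<Longrightarrow> y + scaleC (of_real c) x = 0 \<Longrightarrow> x = 0"
  using pos_lower_bound[of x y c] by (simp add: mult_le_0_iff)

lemma pos_inj': "(x, y) \<in> T \<Longrightarrow> (x', y') \<in> T \<Longrightarrow> c > 0 \<Longrightarrow>
    y + scaleC (of_real c) x = y' + scaleC (of_real c) x' \<Longrightarrow> x = x'"
  using pos_inj[OF diff, of x y x' y' c] by (simp add: scaleC_diff_right algebra_simps)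

text \<open>The inverse of \<open>T + 1\<close> in \<open>K\<close> preceded by the projection onto
  \<open>K\<close>. It is thus defined on the whole space, with the orthogonal complement of
  \<open>K\<close> as its kernel.\<close>

definition Res :: "'a \<Rightarrow> 'a" where
  "Res x = (THE u. (u, proj_onto K x - u) \<in> T)"

lemma Res_eqI: "(u, proj_onto K x - u) \<in> T \<Longrightarrow> Res x = u"
  unfolding Res_def
proof (rule the_equality)
  fix v assume u: "(u, proj_onto K x - u) \<in> T" and v: "(v, proj_onto K x - v) \<in> T"
  show "v = u" by (rule pos_inj'[OF v u zero_less_one]) simp
qed

lemma Res: "(Res x, proj_onto K x - Res x) \<in> T"
proof -
  obtain u v where uv: "(u, v) \<in> T" "v + u = proj_onto K x"
    using pos_surj[of 1 "proj_onto K x"] proj_onto_mem[OF K] by auto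
  then have "(u, proj_onto K x - u) \<in> T" by (metis add_diff_cancel_right')
  then show ?thesis using Res_eqI by metis
qed

lemma Res_graph: "(x, y) \<in> T \<Longrightarrow> Res (x + y) = x"
  using mem[of x y] csubspace_add[OF K_sub, of x y] by (intro Res_eqI) (simp add: proj_onto_self[OF K_sub])

lemma unit_operator_Res: "unit_operator Res"
proof
  note P = bclin_proj_onto[OF K]
  have n: "norm (Res x) \<le> norm x" for x
  proof -
    have "norm (Res x) \<le> norm (proj_onto K x)"
      using pos_lower_bound[OF Res zero_less_one, of x] by simp
    then show ?thesis using P(2)[of x] by linarith
  qed
  show "bclin Res"
    unfolding bclin_def
  proof (intro conjI allI)
    show "Res (x + y) = Res x + Res y" for x y
      using add[OF Res Res, of x y] by (intro Res_eqI) (simp add: bclin_add[OF P(1)] algebra_simps)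
    show "Res (scaleC c x) = scaleC c (Res x)" for c x
      using scaleC[OF Res, of c x] by (intro Res_eqI) (simp add: bclin_scaleC[OF P(1)] scaleC_diff_right)
    show "\<exists>C. \<forall>x. norm (Res x) \<le> C * norm x" using n by (intro exI[of _ 1]) simp
  qed
  have form: "cinner x (Res z) = cinner (proj_onto K x) (Res z)" for x z
    using proj_onto_self[OF K_sub, of "Res z"] mem[OF Res, of z] by (simp add: P(3))
  have form': "cinner (Res z) x = cinner (Res z) (proj_onto K x)" for x z
    using form[of x z] by (metis cinner_commute)
  show "cinner (Res x) y = cinner x (Res y)" for x y
    using sym[OF Res Res, of x y] by (simp add: form[of x y] form'[of x y] cinner_simps)
  show "0 \<le> Re (cinner x (Res x))" for x
  proof -
    have "0 \<le> Re (cinner (Res x) (proj_onto K x - Res x))" by (rule pos[OF Res])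
    then show ?thesis
      using form'[of x x] Re_cinner_commute[of x "Res x"] by (simp add: cinner_simps cinner_norm) (smt (verit) zero_le_power2)
  qed
  show "Re (cinner x (Res x)) \<le> (norm x)\<^sup>2" for x
  proof -
    have "Re (cinner x (Res x)) \<le> norm x * norm (Res x)"
      using Cauchy_Schwarz_cinner complex_Re_le_cmod order_trans by blast
    also have "\<dots> \<le> norm x * norm x" by (intro mult_left_mono n) simp
    finally show ?thesis by (simp add: power2_eq_square)
  qed
qed

lemma Res_zero_iff: "Res x = 0 \<longleftrightarrow> x \<in> orth_compl K"
proof -
  have "Res x = 0 \<longleftrightarrow> proj_onto K x = 0"
  proof
    assume "Res x = 0"
    then show "proj_onto K x = 0" using Res[of x] unique[OF zero] by simp
  next
    assume "proj_onto K x = 0"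
    then show "Res x = 0" using zero by (intro Res_eqI) simp
  qed
  then show ?thesis using proj_onto_zero_iff[OF K] by simp
qed

end

lemma positiveI: "closed_csubspace K \<Longrightarrow> positive_on K T \<Longrightarrow> positive K T"
  by unfold_locales (auto simp: positive_on_def)

section \<open>The spectral theorem for positive self-adjoint operators\<close>

definition id_trunc :: "nat \<Rightarrow> real \<Rightarrow> complex" where
  "id_trunc n s = (if cmod (complex_of_real s) \<le> real n then complex_of_real s else 0)"

lemma bdd_borel_id_trunc: "bdd_borel (id_trunc n)"
  by (rule bdd_borelI[where C="real n"]) (auto simp: id_trunc_def[abs_def])

lemma id_trunc_eventually: "\<forall>\<^sub>F n in sequentially. id_trunc n s = of_real s"
proof -
  obtain N where "\<bar>s\<bar> \<le> real N" using real_arch_simple by blast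
  then show ?thesis by (intro eventually_sequentiallyI[of N]) (auto simp: id_trunc_def)
qed

lemma (in spectral) fc_id: "fc K E (\<lambda>s. complex_of_real s) = {(x, y). x \<in> K \<and> (\<lambda>n. opr (id_trunc n) x) \<longlonglongrightarrow> y}"
  unfolding fc_def id_trunc_def[symmetric] bfc_eq[OF bdd_borel_id_trunc, unfolded id_trunc_def[abs_def], folded id_trunc_def]
  by (auto simp: fun_eq_iff[symmetric] bfc_eq[OF bdd_borel_id_trunc])

context positive
begin

text \<open>With \<open>R = (T + 1)\<inverse>\<close> and its spectral measure \<open>F\<close>, the spectral measure of \<open>T\<close> is the image of \<open>F\<close>
  under \<open>r \<mapsto> 1/r - 1\<close>; the point \<open>r = 0\<close> carries the orthogonal complement of \<open>K\<close>.\<close>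

theorem ex_spectral_measure: "\<exists>E. spectral_measure_of K T E"
proof -
  interpret R: unit_operator Res by (rule unit_operator_Res)
  obtain F where F: "spectral UNIV F" "form_family.opr (spec_meas F) (\<lambda>s. of_real (clamp01 s)) = Res"
    using spectral_theorem_unit_operator[OF unit_operator_Res] by blast
  interpret sF: spectral UNIV F by (rule F)
  define cl where "cl s = complex_of_real (clamp01 s)" for s
  have bcl: "bdd_borel cl" using bdd_borel_clamp01_power[of 1] by (simp add: cl_def[abs_def])
  have ocl: "sF.opr cl = Res" using F(2) by (simp add: cl_def[abs_def])
  have clpos: "clamp01 r > 0 \<longleftrightarrow> r > 0" for r by (auto simp: clamp01_def)
  \<comment> \<open>The preimage of \<open>S\<close> under the map from spectral values of the
    resolvent to those of \<open>T\<close>, with \<open>r \<le> 0\<close> removed.\<close>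
  define G where "G S = {r. 0 < r \<and> 1 / clamp01 r - 1 \<in> S}" for S :: "real set"
  have G: "G S \<in> sets borel" if [measurable]: "S \<in> sets borel" for S
    unfolding G_def by measurable
  define E where "E S = F (G S)" for S
  have GU: "G UNIV = {0<..}" by (auto simp: G_def)
  \<comment> \<open>\<open>F {..0}\<close> maps into the kernel of \<open>Res\<close>, and
    \<open>F {0<..}\<close> kills that kernel; as the kernel is the complement of \<open>K\<close>,
    the projection \<open>F {0<..}\<close> is the one onto \<open>K\<close>.\<close>
  have F0: "F {0<..} x = proj_onto K x" for x
  proof -
    have ker: "F {0<..} k = 0" if "k \<in> orth_compl K" for k
    proof -
      have Rk: "Res k = 0" using that Res_zero_iff by blast
      \<comment> \<open>A bounded partial inverse: \<open>h n * cl\<close> is the indicator of the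
        half-line above \<open>1/(n+1)\<close>, so \<open>Res k = 0\<close> forces the spectral
        projection of that half-line to kill \<open>k\<close>.\<close>
      define h where "h n r = (if 1 / real (Suc n) < r then 1 / cl r else 0)" for n r
      have hb: "bdd_borel (h n)" for n
      proof (rule bdd_borelI[where C="real (Suc n)"])
        have [measurable]: "cl \<in> borel_measurable borel" using bcl by (simp add: bdd_borel_def)
        show "h n \<in> borel_measurable borel" unfolding h_def by measurable
        show "cmod (h n r) \<le> real (Suc n)" for r
        proof (cases "1 / real (Suc n) < r")
          case True
          have "0 < 1 / real (Suc n)" by simp
          then have "1 / real (Suc n) \<le> clamp01 r" using True by (auto simp: clamp01_def min_def)
          moreover from this have "0 < clamp01 r" using \<open>0 < 1 / real (Suc n)\<close> by linarith
          ultimately have "1 / clamp01 r \<le> real (Suc n)" by (simp add: field_simps)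
          then show ?thesis using True \<open>0 < clamp01 r\<close> by (simp add: h_def cl_def norm_divide)
        qed (simp add: h_def)
      qed
      have "F {1 / real (Suc n)<..} k = 0" for n
      proof -
        have "h n s * cl s = indicator {1 / real (Suc n)<..} s" for s
        proof (cases "1 / real (Suc n) < s")
          case True
          then have "0 < s" using less_trans[of 0 "1 / real (Suc n)" s] by simp
          then have "cl s \<noteq> 0" using clpos[of s] by (simp add: cl_def)
          then show ?thesis using True by (simp add: h_def)
        qed (simp add: h_def)
        then have "sF.opr (indicator {1 / real (Suc n)<..}) k = sF.opr (h n) (Res k)"
          using sF.opr_mult[OF bcl hb, of n k] by (simp add: ocl)
        then show ?thesis using Rk bclin_zero[OF sF.bclin_opr[OF hb]] by (simp add: sF.opr_indicator)
      qed
      moreover have "(\<lambda>n. sF.opr (indicator {1 / real (Suc n)<..}) k) \<longlonglongrightarrow> sF.opr (indicator {0<..}) k"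
      proof (rule sF.opr_tendsto[where C=1])
        show "(\<lambda>n. indicator {1 / real (Suc n)<..} s :: complex) \<longlonglongrightarrow> indicator {0<..} s" for s
        proof (cases "s > 0")
          case True
          have "\<forall>\<^sub>F n in sequentially. 1 / real (Suc n) < s"
            using order_tendstoD(2)[OF LIMSEQ_Suc[OF lim_1_over_n] True] by simp
          then show ?thesis using True by (auto intro!: tendsto_eventually elim!: eventually_mono)
        next
          case False
          have "\<not> 1 / real (Suc n) < s" for n using False by (smt (verit) divide_pos_pos of_nat_0_less_iff zero_less_Suc)
          then show ?thesis using False by simp
        qed
      qed (auto intro: bdd_borel_indicator simp: indicator_def)
      ultimately show ?thesis by (simp add: sF.opr_indicator LIMSEQ_const_iff)
    qed
    have comp: "x - F {0<..} x \<in> orth_compl K"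
    proof -
      have "x - F {0<..} x = F {..0} x"
      proof -
        have "sF.opr (\<lambda>s. indicator {0<..} s + indicator {..0} s) x = F {0<..} x + F {..0} x"
          by (simp add: sF.opr_add bdd_borel_indicator sF.opr_indicator)
        moreover have "(\<lambda>s. indicator {0<..} s + indicator {..0} s) = (\<lambda>s::real. 1::complex)"
          by (auto simp: indicator_def fun_eq_iff)
        ultimately have "F {0<..} x + F {..0} x = x"
          using sF.opr_one proj_onto_self[OF closed_csubspace_imp_csubspace[OF closed_csubspace_UNIV], of x] by simp
        then show ?thesis by (metis add_diff_cancel_left')
      qed
      moreover have "Res (F {..0} x) = 0"
      proof -
        have "cl s * indicator {..0} s = 0 * indicator {..0} s" for s by (auto simp: cl_def clamp01_def indicator_def)
        then have "sF.opr cl (sF.opr (indicator {..0}) x) = sF.opr (\<lambda>s. 0 * indicator {..0} s) x"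
          by (intro sF.opr_comp_eq bcl bdd_borel_indicator) auto
        then show ?thesis using sF.opr_scale[of "indicator {..0}" 0 x] by (simp add: ocl sF.opr_indicator bdd_borel_indicator)
      qed
      ultimately show ?thesis using Res_zero_iff by simp
    qed
    show ?thesis
    proof (rule proj_onto_eqI[symmetric, OF K_sub])
      show "cinner m (x - F {0<..} x) = 0" if "m \<in> K" for m using comp that by (simp add: orth_compl_def)
      have "cinner k (F {0<..} x) = 0" if "k \<in> orth_compl K" for k
        using ker[OF that] sF.E_sym[of "{0<..}" k x] by simp
      then have "F {0<..} x \<in> orth_compl (orth_compl K)" by (simp add: orth_compl_def)
      then show "F {0<..} x \<in> K" using orth_orth_compl[OF K] by simp
    qed
  qed
  have "spectral_measure_on K E"
    unfolding spectral_measure_on_def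
  proof (intro conjI ballI allI impI)
    show "E UNIV = proj_onto K" using F0 by (auto simp: E_def GU)
    show "\<exists>M. closed_csubspace M \<and> M \<subseteq> K \<and> E S = proj_onto M" if S: "S \<in> sets borel" for S
    proof -
      obtain M where M: "closed_csubspace M" "F (G S) = proj_onto M" using sF.E_proj[OF G[OF S]] by blast
      have "m \<in> K" if "m \<in> M" for m
      proof -
        have "m = F (G S) m" using that M by (simp add: proj_onto_self closed_csubspace_imp_csubspace)
        also have "G S = {0<..} \<inter> G S" by (auto simp: G_def)
        also have "F ({0<..} \<inter> G S) m = F {0<..} (F (G S) m)" using sF.E_Int[OF _ G[OF S], of "{0<..}"] by simp
        finally show ?thesis using F0 proj_onto_mem[OF K] by metis
      qed
      then show ?thesis using M by (auto simp: E_def)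
    qed
    show "E (S \<inter> S') = E S \<circ> E S'" if "S \<in> sets borel" "S' \<in> sets borel" for S S'
    proof -
      have "G (S \<inter> S') = G S \<inter> G S'" by (auto simp: G_def)
      then show ?thesis using sF.E_Int[OF G G] that by (simp add: E_def)
    qed
    fix A :: "nat \<Rightarrow> real set" and x assume A: "range A \<subseteq> sets borel" "disjoint_family A"
    have "disjoint_family (\<lambda>i. G (A i))" using A(2) unfolding disjoint_family_on_def G_def by blast
    moreover have "range (\<lambda>i. G (A i)) \<subseteq> sets borel" using A(1) G by auto
    moreover have "G (\<Union>i. A i) = (\<Union>i. G (A i))" by (auto simp: G_def)
    ultimately show "(\<lambda>n. \<Sum>i<n. E (A i) x) \<longlonglongrightarrow> E (\<Union> (range A)) x"
      using sF.E_sum[of "\<lambda>i. G (A i)" x] by (simp add: E_def)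
  qed
  then interpret sE: spectral K E using K by unfold_locales
  define pull where "pull f r = (if 0 < r then f (1 / clamp01 r - 1) else 0)" for f :: "real \<Rightarrow> complex" and r
  have pull: "bdd_borel (pull f)" if f: "bdd_borel f" for f
  proof -
    obtain C where C: "0 \<le> C" "\<And>s. cmod (f s) \<le> C" using bdd_borel_bound[OF f] by blast
    have [measurable]: "f \<in> borel_measurable borel" using f by (simp add: bdd_borel_def)
    have "(\<lambda>r. f (1 / clamp01 r - 1)) \<in> borel_measurable borel"
      by (rule measurable_compose[of "\<lambda>r. 1 / clamp01 r - 1" borel borel f]) measurable
    then show ?thesis using C by (intro bdd_borelI[where C=C]) (auto simp: pull_def[abs_def])
  qed
  have sE_pull: "bdd_borel f \<Longrightarrow> sE.opr f x = sF.opr (pull f) x" for f x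
  proof (induction f arbitrary: x rule: bdd_borel_induct)
    case (indicator S)
    have "pull (indicator S) = indicator (G S)" by (auto simp: pull_def G_def indicator_def)
    have "sE.opr (indicator S) x = F (G S) x" using sE.opr_indicator[OF indicator] by (simp only: E_def)
    then show ?case by (simp only: \<open>pull (indicator S) = indicator (G S)\<close> sF.opr_indicator[OF G[OF indicator]])
  next
    case (scale c f)
    have "pull (\<lambda>s. c * f s) = (\<lambda>r. c * pull f r)" by (auto simp: pull_def)
    then show ?case using scale by (simp add: sE.opr_scale sF.opr_scale pull)
  next
    case (add f g)
    have "pull (\<lambda>s. f s + g s) = (\<lambda>r. pull f r + pull g r)" by (auto simp: pull_def)
    then show ?case using add by (simp add: sE.opr_add sF.opr_add pull)
  next
    case (lim H g C)
    have C: "0 \<le> C" using order_trans[OF norm_ge_zero lim.hyps(2)] .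
    have "(\<lambda>n. sE.opr (H n) x) \<longlonglongrightarrow> sE.opr g x" by (intro sE.opr_tendsto[where C=C] lim)
    moreover have "(\<lambda>n. sF.opr (pull (H n)) x) \<longlonglongrightarrow> sF.opr (pull g) x"
      by (rule sF.opr_tendsto[where C=C]) (auto intro: pull lim simp: pull_def C)
    ultimately show ?case unfolding lim.IH by (rule LIMSEQ_unique)
  qed
  \<comment> \<open>Multiplying the truncated identity by the resolvent makes it bounded, as
    \<open>r (1/r - 1) = 1 - r\<close>; the limit \<open>indicator {0<..} - cl\<close> represents
    the projection onto \<open>K\<close> minus \<open>Res\<close>.\<close>
  have key: "(\<lambda>n. sF.opr (\<lambda>r. cl r * pull (id_trunc n) r) x) \<longlonglongrightarrow> proj_onto K x - Res x" for x
  proof -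
    have "(\<lambda>n. sF.opr (\<lambda>r. cl r * pull (id_trunc n) r) x) \<longlonglongrightarrow> sF.opr (\<lambda>r. indicator {0<..} r - cl r) x"
    proof (rule sF.opr_tendsto[where C=1])
      show "bdd_borel (\<lambda>r. cl r * pull (id_trunc n) r)" for n by (intro bdd_borel_mult bcl pull bdd_borel_id_trunc)
      show "bdd_borel (\<lambda>r. indicator {0<..} r - cl r)" by (intro bdd_borel_diff bcl bdd_borel_indicator) simp
      have *: "cl r * of_real (1 / clamp01 r - 1) = of_real (1 - clamp01 r)" if "r > 0" for r
      proof -
        have "clamp01 r * (1 / clamp01 r - 1) = 1 - clamp01 r"
          using clpos[of r] that by (simp add: right_diff_distrib)
        then show ?thesis unfolding cl_def of_real_mult[symmetric] by simp
      qed
      show "cmod (cl r * pull (id_trunc n) r) \<le> 1" for n r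
      proof (cases "r > 0 \<and> cmod (complex_of_real (1 / clamp01 r - 1)) \<le> real n")
        case True
        then have "cl r * pull (id_trunc n) r = of_real (1 - clamp01 r)"
          using *[of r] unfolding pull_def id_trunc_def by simp
        then show ?thesis using clamp01_bounds[of r] by (simp del: of_real_diff)
      qed (auto simp: pull_def id_trunc_def)
      show "(\<lambda>n. cl r * pull (id_trunc n) r) \<longlonglongrightarrow> indicator {0<..} r - cl r" for r
      proof (cases "r > 0")
        case True
        have "\<forall>\<^sub>F n in sequentially. cl r * pull (id_trunc n) r = indicator {0<..} r - cl r"
          using id_trunc_eventually[of "1 / clamp01 r - 1"]
        proof eventually_elim
          case (elim n)
          then show ?case using *[OF True] True unfolding pull_def elim by (simp add: cl_def)
        qed
        then show ?thesis by (rule tendsto_eventually)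
      next
        case False
        then show ?thesis by (simp add: pull_def cl_def clamp01_def)
      qed
    qed
    moreover have "sF.opr (\<lambda>r. indicator {0<..} r - cl r) x = proj_onto K x - Res x"
      by (subst sF.opr_diff) (auto intro: bdd_borel_indicator bcl simp: sF.opr_indicator F0 ocl)
    ultimately show ?thesis by simp
  qed
  have Res_opr: "Res (sE.opr (id_trunc n) x) = sF.opr (\<lambda>r. cl r * pull (id_trunc n) r) x"
    and opr_Res: "sE.opr (id_trunc n) (Res x) = sF.opr (\<lambda>r. cl r * pull (id_trunc n) r) x" for n x
    using sF.opr_mult[OF pull[OF bdd_borel_id_trunc] bcl, of n x] sF.opr_mult[OF bcl pull[OF bdd_borel_id_trunc], of n x]
    by (simp_all add: sE_pull[OF bdd_borel_id_trunc] ocl mult.commute)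
  have "T = fc K E (\<lambda>s. complex_of_real s)"
    unfolding sE.fc_id
  \<comment> \<open>For \<open>x\<close> and \<open>y\<close> in \<open>K\<close>, membership of
    \<open>(x, y)\<close> in \<open>T\<close> amounts to \<open>Res (x + y) = x\<close>. Both
    inclusions reduce to \<open>key\<close>, applied to \<open>x + y\<close> and to \<open>x\<close>
    respectively, because \<open>Res\<close> commutes with the truncations.\<close>
  proof (intro set_eqI iffI; clarify)
    fix x y assume xy: "(x, y) \<in> T"
    have x: "Res (x + y) = x" by (rule Res_graph[OF xy])
    have "proj_onto K (x + y) = x + y" using mem[OF xy] csubspace_add[OF K_sub] by (intro proj_onto_self[OF K_sub]) auto
    then have "(\<lambda>n. sE.opr (id_trunc n) (Res (x + y))) \<longlonglongrightarrow> y"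
      unfolding opr_Res using key[of "x + y"] x by simp
    then show "x \<in> K \<and> (\<lambda>n. sE.opr (id_trunc n) x) \<longlonglongrightarrow> y" using mem[OF xy] x by simp
  next
    fix x y assume x: "x \<in> K" and y: "(\<lambda>n. sE.opr (id_trunc n) x) \<longlonglongrightarrow> y"
    have cl: "closed K" using K by (simp add: closed_csubspace_def)
    have yK: "y \<in> K" by (rule closed_sequentially[OF cl _ y]) (use sE.opr_in_K bdd_borel_id_trunc in blast)
    have "(\<lambda>n. Res (sE.opr (id_trunc n) x)) \<longlonglongrightarrow> Res y" by (intro bclin_tendsto[OF R.R] y)
    moreover have "(\<lambda>n. Res (sE.opr (id_trunc n) x)) \<longlonglongrightarrow> x - Res x"
      unfolding Res_opr using key[of x] proj_onto_self[OF K_sub x] by simp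
    ultimately have "Res y = x - Res x" by (rule LIMSEQ_unique)
    then have "Res (x + y) = x" by (simp add: bclin_add[OF R.R])
    moreover have "proj_onto K (x + y) = x + y" using x yK csubspace_add[OF K_sub] by (intro proj_onto_self[OF K_sub]) auto
    ultimately show "(x, y) \<in> T" using Res[of "x + y"] by simp
  qed
  then show ?thesis using \<open>spectral_measure_on K E\<close> by (auto simp: spectral_measure_of_def)
qed

end

section \<open>Resolvents inside the spectral calculus\<close>

locale positive_spectral = positive + spectral +
  assumes T_fc: "T = fc K E (\<lambda>s. complex_of_real s)" and ker: "op_ker T = {0}"
begin

lemma T_iff: "(x, y) \<in> T \<longleftrightarrow> x \<in> K \<and> (\<lambda>n. opr (id_trunc n) x) \<longlonglongrightarrow> y"
  using T_fc fc_id by auto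

text \<open>When \<open>s f(s)\<close> is bounded, the truncations multiplied by \<open>f\<close>
  converge boundedly to it, so \<open>opr f\<close> maps into the domain of
  \<open>T\<close>.\<close>

lemma T_oprI:
  assumes x: "x \<in> K" and f: "bdd_borel f" and g: "bdd_borel g" and fg: "\<And>s. g s = of_real s * f s"
  shows "(opr f x, opr g x) \<in> T"
  unfolding T_iff
proof
  show "opr f x \<in> K" by (rule opr_in_K[OF f])
  obtain C where C: "0 \<le> C" "\<And>s. cmod (g s) \<le> C" using bdd_borel_bound[OF g] by blast
  have "(\<lambda>n. opr (\<lambda>s. id_trunc n s * f s) x) \<longlonglongrightarrow> opr g x"
  proof (rule opr_tendsto[where C=C])
    show "bdd_borel (\<lambda>s. id_trunc n s * f s)" for n by (intro bdd_borel_mult bdd_borel_id_trunc f)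
    show "cmod (id_trunc n s * f s) \<le> C" for n s using C(2)[of s] C(1) by (auto simp: id_trunc_def fg)
    show "(\<lambda>n. id_trunc n s * f s) \<longlonglongrightarrow> g s" for s
      by (rule tendsto_eventually, rule eventually_mono[OF id_trunc_eventually[of s]]) (simp add: fg)
  qed (rule g)
  then show "(\<lambda>n. opr (id_trunc n) (opr f x)) \<longlonglongrightarrow> opr g x" by (simp add: opr_mult f bdd_borel_id_trunc)
qed

text \<open>On \<open>[-n, 0]\<close> the identity is minus the square of the real function
  \<open>r = sqrt (- s)\<close>. Positivity of \<open>T\<close> on the spectral subspace therefore
  forces \<open>opr r x = 0\<close>, so the spectral vector lies in the kernel of \<open>T\<close>;
  this also disposes of the point 0.\<close>

lemma E_nonpos: "x \<in> K \<Longrightarrow> E {..0} x = 0"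
proof -
  assume x: "x \<in> K"
  have zero: "E {- real n..0} x = 0" for n
  proof -
    define r where "r s = complex_of_real (sqrt (- s)) * indicator {- real n..0} s" for s
    define g where "g s = complex_of_real s * indicator {- real n..0} s" for s
    have r: "bdd_borel r"
    proof (rule bdd_borelI[where C="sqrt (real n)"])
      show "r \<in> borel_measurable borel" unfolding r_def by measurable
      show "cmod (r s) \<le> sqrt (real n)" for s by (auto simp: r_def indicator_def)
    qed
    have g: "bdd_borel g"
      by (rule bdd_borelI[where C="real n"]) (auto simp: g_def[abs_def] indicator_def)
    have rr: "r s * r s = - 1 * g s" for s
      by (auto simp: r_def g_def indicator_def simp flip: of_real_mult)
    have b: "bdd_borel (indicator {- real n..0})" by (intro bdd_borel_indicator) simp
    have mem: "(E {- real n..0} x, opr g x) \<in> T"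
      using T_oprI[OF x b g] by (simp add: g_def opr_indicator)
    have og: "opr g x = - opr r (opr r x)"
      using opr_comp_eq[OF r r rr] opr_scale[OF g, of "-1"] by (simp add: scaleC_minus_left)
    have Eg: "cinner (E {- real n..0} x) (opr g x) = cinner x (opr g x)"
    proof -
      have "opr (indicator {- real n..0}) (opr g x) = opr g x"
        by (rule opr_comp_eq[OF b g]) (auto simp: g_def indicator_def)
      then show ?thesis by (simp add: E_sym opr_indicator)
    qed
    have "(\<lambda>s. cnj (r s)) = r" by (auto simp: r_def indicator_def)
    then have "cinner x (opr r (opr r x)) = cinner (opr r x) (opr r x)" by (simp add: opr_adjoint[OF r])
    then have "cinner x (opr g x) = - of_real ((norm (opr r x))\<^sup>2)"
      unfolding og cinner_minus_right cinner_norm by simp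
    then have "0 \<le> - (norm (opr r x))\<^sup>2" using pos[OF mem] unfolding Eg by simp
    then have "opr r x = 0" by simp
    then have "opr g x = 0" using og bclin_zero[OF bclin_opr[OF r]] by simp
    then show ?thesis using mem ker by (auto simp: op_ker_def)
  qed
  have "(\<lambda>n. opr (indicator {- real n..0}) x) \<longlonglongrightarrow> opr (indicator {..0}) x"
  proof (rule opr_tendsto[where C=1])
    show "(\<lambda>n. indicator {- real n..0} s :: complex) \<longlonglongrightarrow> indicator {..0} s" for s
    proof -
      obtain N where "- s \<le> real N" using real_arch_simple by blast
      then show ?thesis
        by (intro tendsto_eventually eventually_sequentiallyI[of N]) (auto simp: indicator_def)
    qed
  qed (auto intro: bdd_borel_indicator simp: indicator_def)
  then show ?thesis by (simp add: opr_indicator zero LIMSEQ_const_iff)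
qed

lemma E_pos: "x \<in> K \<Longrightarrow> E {0<..} x = x"
proof -
  assume x: "x \<in> K"
  have "opr (\<lambda>s. indicator {0<..} s + indicator {..0} s) x = E {0<..} x + E {..0} x"
    by (simp add: opr_add bdd_borel_indicator opr_indicator)
  moreover have "(\<lambda>s. indicator {0<..} s + indicator {..0} s) = (\<lambda>s::real. 1::complex)"
    by (auto simp: indicator_def fun_eq_iff)
  ultimately show ?thesis using opr_one E_nonpos[OF x] proj_onto_self[OF K_sub x] by simp
qed

text \<open>Values of \<open>f\<close> at \<open>s \<le> 0\<close> are set to 0, so
  \<open>s f + c f\<close> is the indicator of the positive half-line, which acts as the identity on
  \<open>K\<close> by \<open>E_pos\<close>.\<close>

lemma T_resolvent:
  assumes x: "x \<in> K" and f: "bdd_borel f" and fc: "\<And>s. s > 0 \<Longrightarrow> f s * (of_real s + c) = 1" and f0: "\<And>s. s \<le> 0 \<Longrightarrow> f s = 0"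
  shows "(opr f x, x - scaleC c (opr f x)) \<in> T"
proof -
  have cf: "bdd_borel (\<lambda>s. c * f s)" and i: "bdd_borel (indicator {0<..})"
    by (intro bdd_borel_scale f, intro bdd_borel_indicator) simp
  have "(opr f x, opr (\<lambda>s. indicator {0<..} s - c * f s) x) \<in> T"
  proof (rule T_oprI[OF x f])
    show "bdd_borel (\<lambda>s. indicator {0<..} s - c * f s)" by (intro bdd_borel_diff i cf)
    show "indicator {0<..} s - c * f s = of_real s * f s" for s
      using fc[of s] f0[of s] by (cases "s > 0") (auto simp: algebra_simps)
  qed
  moreover have "opr (\<lambda>s. indicator {0<..} s - c * f s) x = x - scaleC c (opr f x)"
    by (simp add: opr_diff[OF i cf] opr_scale[OF f] opr_indicator E_pos[OF x])
  ultimately show ?thesis by simp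
qed

end

section \<open>Uniqueness of positive square roots and the polar decomposition\<close>

text \<open>With \<open>D = X - Y\<close> and \<open>S = X + Y\<close> one has \<open>SD + DS = 0\<close>. For an approximate eigenvector \<open>u\<close> of \<open>D\<close>
  with eigenvalue \<open>\<mu>\<close> this makes \<open>\<mu> \<langle>u, S u\<rangle>\<close> small, hence also \<open>\<langle>u, D u\<rangle>\<close>, which is close to \<open>\<mu> \<parallel>u\<parallel>\<^sup>2\<close>.
  So neither \<open>\<parallel>D\<parallel>\<close> nor \<open>- \<parallel>D\<parallel>\<close> is an approximate eigenvalue, which for a self-adjoint \<open>D\<close> forces \<open>D = 0\<close>.\<close>

lemma bounded_positive_sqrt_unique:
  fixes X Y :: "'h::complex_inner \<Rightarrow> 'h"
  assumes X: "bclin X" "\<And>x y. cinner (X x) y = cinner x (X y)" "\<And>x. 0 \<le> Re (cinner x (X x))"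
    and Y: "bclin Y" "\<And>x y. cinner (Y x) y = cinner x (Y y)" "\<And>x. 0 \<le> Re (cinner x (Y x))"
    and XY: "\<And>x. X (X x) = Y (Y x)"
  shows "X x = Y x"
proof -
  define D where "D x = X x - Y x" for x
  define S where "S x = X x + Y x" for x
  have D: "bclin D" unfolding D_def by (rule bclin_diff_op[OF X(1) Y(1)])
  have S: "bclin S" unfolding S_def by (rule bclin_add_op[OF X(1) Y(1)])
  have Dsym: "cinner (D x) y = cinner x (D y)" for x y by (simp add: D_def cinner_simps X(2) Y(2))
  have Ssym: "cinner (S x) y = cinner x (S y)" for x y by (simp add: S_def cinner_simps X(2) Y(2))
  have anti: "Re (cinner (S u) (D u)) = 0" for u
  proof -
    have "S (D u) + D (S u) = 0"
      by (simp add: S_def D_def bclin_add[OF X(1)] bclin_add[OF Y(1)] bclin_diff[OF X(1)] bclin_diff[OF Y(1)] XY)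
    then have "cinner u (S (D u)) + cinner u (D (S u)) = 0" by (simp flip: cinner_add_right)
    then have "cinner (S u) (D u) + cinner (D u) (S u) = 0" by (simp add: Ssym Dsym)
    then have "Re (cinner (S u) (D u)) + Re (cinner (D u) (S u)) = 0" by (metis plus_complex.sel(1) zero_complex.sel(1))
    then show ?thesis by (simp add: Re_cinner_commute[of "D u"])
  qed
  obtain s where s: "0 \<le> s" "\<And>x. norm (S x) \<le> s * norm x"
  proof -
    obtain s where "\<And>x. norm (S x) \<le> s * norm x" using S by (auto simp: bclin_def)
    then have "norm (S x) \<le> max 0 s * norm x" for x by (meson max.cobounded2 mult_right_mono norm_ge_zero order_trans)
    then show ?thesis using that[of "max 0 s"] by simp
  qed
  \<comment> \<open>The constant collects two errors: \<open>s / |\<mu>|\<close> comes from bounding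
    \<open><u, S u>\<close> through \<open>anti\<close>, and 1 from replacing \<open>D u\<close> by
    \<open>\<mu> u\<close>; dividing by \<open>|\<mu>|\<close> isolates the norm.\<close>
  have est: "norm u \<le> (s / \<bar>\<mu>\<bar> + 1) / \<bar>\<mu>\<bar> * norm (D u - \<mu> *\<^sub>R u)" if mu: "\<mu> \<noteq> 0" for u and \<mu> :: real
  proof (cases "u = 0")
    case False
    define e where "e = D u - \<mu> *\<^sub>R u"
    have Du: "D u = \<mu> *\<^sub>R u + e" by (simp add: e_def)
    have pos: "0 \<le> Re (cinner u (S u))" using X(3)[of u] Y(3)[of u] by (simp add: S_def cinner_simps)
    have "\<mu> * Re (cinner u (S u)) = - Re (cinner (S u) e)"
      using anti[of u] by (simp add: Du cinner_simps cinner_scaleR_right Re_cinner_commute[of "S u" u])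
    then have "\<bar>\<mu>\<bar> * Re (cinner u (S u)) = \<bar>Re (cinner (S u) e)\<bar>"
      using pos by (metis abs_minus abs_mult abs_of_nonneg)
    also have "\<dots> \<le> norm (S u) * norm e"
      using Cauchy_Schwarz_cinner abs_Re_le_cmod order_trans by blast
    also have "\<dots> \<le> s * norm u * norm e" by (intro mult_right_mono s) simp
    finally have 1: "Re (cinner u (S u)) \<le> s / \<bar>\<mu>\<bar> * norm u * norm e"
      using mu by (simp add: field_simps)
    have "\<bar>\<mu>\<bar> * (norm u)\<^sup>2 = \<bar>Re (cinner u (\<mu> *\<^sub>R u))\<bar>"
      by (simp add: cinner_scaleR_right cinner_norm abs_mult flip: of_real_power)
    also have "\<dots> = \<bar>Re (cinner u (D u)) - Re (cinner u e)\<bar>" by (simp add: Du cinner_simps)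
    also have "\<dots> \<le> \<bar>Re (cinner u (D u))\<bar> + \<bar>Re (cinner u e)\<bar>" by (rule abs_triangle_ineq4)
    also have "\<bar>Re (cinner u (D u))\<bar> \<le> Re (cinner u (S u))"
      using X(3)[of u] Y(3)[of u] by (simp add: S_def D_def cinner_simps)
    also have "\<bar>Re (cinner u e)\<bar> \<le> norm u * norm e"
      using Cauchy_Schwarz_cinner abs_Re_le_cmod order_trans by blast
    finally have "\<bar>\<mu>\<bar> * (norm u)\<^sup>2 \<le> (s / \<bar>\<mu>\<bar> + 1) * norm e * norm u"
      using 1 by (simp add: algebra_simps)
    then have "\<bar>\<mu>\<bar> * norm u \<le> (s / \<bar>\<mu>\<bar> + 1) * norm e"
      using False by (simp add: power2_eq_square)
    then have "norm u \<le> (s / \<bar>\<mu>\<bar> + 1) * norm e / \<bar>\<mu>\<bar>"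
      using mu by (subst pos_le_divide_eq) (auto simp: mult.commute)
    then show ?thesis by (simp add: e_def)
  qed (use s in simp)
  have "D x = 0"
  proof (rule ccontr)
    assume "D x \<noteq> 0"
    have bl: "bounded_linear D" by (rule bclin_bounded_linear[OF D])
    define L where "L = onorm D"
    have L: "norm (D y) \<le> L * norm y" for y unfolding L_def by (rule onorm[OF bl])
    have L0: "L > 0" using onorm_pos_lt[OF bl] \<open>D x \<noteq> 0\<close> unfolding L_def by blast
    define C where "C = (s / L + 1) / L"
    have C: "C > 0" using L0 s(1) by (simp add: C_def add_nonneg_pos)
    \<comment> \<open>The estimate at \<open>L\<close> and at \<open>-L\<close> combined through
      \<open>D^2 - L^2 = (D + L)(D - L)\<close>: working with \<open>D^2\<close> treats both signs
      at once.\<close>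
    have 2: "norm u \<le> C * C * norm (D (D u) - L\<^sup>2 *\<^sub>R u)" for u
    proof -
      have "norm u \<le> C * norm (D u - L *\<^sub>R u)" using est[of L u] L0 by (simp add: C_def)
      also have "norm (D u - L *\<^sub>R u) \<le> C * norm (D (D u - L *\<^sub>R u) - (- L) *\<^sub>R (D u - L *\<^sub>R u))"
        using est[of "- L" "D u - L *\<^sub>R u"] L0 unfolding C_def by simp
      also have "D (D u - L *\<^sub>R u) - (- L) *\<^sub>R (D u - L *\<^sub>R u) = D (D u) - L\<^sup>2 *\<^sub>R u"
        by (simp add: bclin_diff[OF D] bclin_scaleR[OF D] algebra_simps power2_eq_square)
      finally show ?thesis using C by (simp add: mult.assoc)
    qed
    \<comment> \<open>Half of the gap \<open>1/(L^2 C^4)\<close> that estimate \<open>2\<close>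
      enforces below \<open>L^2\<close>. A positive gap bounds
      \<open>\<parallel>D u\<parallel>\<close> by a constant below the operator norm, a
      contradiction.\<close>
    define \<eta> where "\<eta> = 1 / (2 * L\<^sup>2 * (C * C)\<^sup>2)"
    have eta: "\<eta> > 0" using L0 C by (simp add: \<eta>_def)
    have 3: "(norm (D u))\<^sup>2 \<le> (L\<^sup>2 - \<eta>) * (norm u)\<^sup>2" for u
    proof -
      have "(norm (D (D u) - L\<^sup>2 *\<^sub>R u))\<^sup>2 = (norm (D (D u)))\<^sup>2 - 2 * L\<^sup>2 * (norm (D u))\<^sup>2 + (L\<^sup>2 * norm u)\<^sup>2"
      proof -
        have "cinner (D (D u)) u = of_real ((norm (D u))\<^sup>2)" by (simp add: Dsym cinner_norm)
        then show ?thesis by (simp add: norm_diff_sq cinner_scaleR_right flip: of_real_power)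
      qed
      also have "(norm (D (D u)))\<^sup>2 \<le> L\<^sup>2 * (norm (D u))\<^sup>2"
        using power_mono[OF L[of "D u"] norm_ge_zero, of 2] by (simp add: power_mult_distrib)
      also have "(L\<^sup>2 * norm u)\<^sup>2 = L\<^sup>2 * (L\<^sup>2 * (norm u)\<^sup>2)" by (simp add: power2_eq_square)
      finally have a: "(norm (D (D u) - L\<^sup>2 *\<^sub>R u))\<^sup>2 \<le> L\<^sup>2 * (L\<^sup>2 * (norm u)\<^sup>2 - (norm (D u))\<^sup>2)"
        by (simp add: algebra_simps)
      have "(norm u)\<^sup>2 \<le> (C * C)\<^sup>2 * (norm (D (D u) - L\<^sup>2 *\<^sub>R u))\<^sup>2"
        using power_mono[OF 2[of u] norm_ge_zero, of 2] by (simp add: power_mult_distrib)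
      also have "\<dots> \<le> (C * C)\<^sup>2 * (L\<^sup>2 * (L\<^sup>2 * (norm u)\<^sup>2 - (norm (D u))\<^sup>2))"
        by (intro mult_left_mono a) simp
      finally have "(norm u)\<^sup>2 * (1 / (L\<^sup>2 * (C * C)\<^sup>2)) \<le> L\<^sup>2 * (norm u)\<^sup>2 - (norm (D u))\<^sup>2"
        using L0 C by (simp add: field_simps)
      moreover have "\<eta> * (norm u)\<^sup>2 \<le> (norm u)\<^sup>2 * (1 / (L\<^sup>2 * (C * C)\<^sup>2))"
        using L0 C by (simp add: \<eta>_def field_simps)
      ultimately show ?thesis by (simp add: algebra_simps)
    qed
    have "0 \<le> L\<^sup>2 - \<eta>"
    proof (rule ccontr)
      assume "\<not> 0 \<le> L\<^sup>2 - \<eta>"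
      then have "(L\<^sup>2 - \<eta>) * (norm x)\<^sup>2 \<le> 0" by (simp add: mult_nonpos_nonneg)
      then have "(norm (D x))\<^sup>2 \<le> 0" using 3[of x] by linarith
      then show False using \<open>D x \<noteq> 0\<close> by simp
    qed
    have "onorm D \<le> sqrt (L\<^sup>2 - \<eta>)"
    proof (rule onorm_bound)
      show "norm (D u) \<le> sqrt (L\<^sup>2 - \<eta>) * norm u" for u
      proof -
        have "norm (D u) = sqrt ((norm (D u))\<^sup>2)" by simp
        also have "\<dots> \<le> sqrt ((L\<^sup>2 - \<eta>) * (norm u)\<^sup>2)" by (intro real_sqrt_le_mono 3)
        finally show ?thesis by (simp add: real_sqrt_mult)
      qed
    qed (use \<open>0 \<le> L\<^sup>2 - \<eta>\<close> in simp)
    moreover have "sqrt (L\<^sup>2 - \<eta>) < L" using eta L0 by (intro real_less_lsqrt) auto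
    ultimately show False unfolding L_def by simp
  qed
  then show ?thesis by (simp add: D_def)
qed

section \<open>Bounded transforms of an unbounded positive operator\<close>

context positive
begin

text \<open>\<open>Gop\<close> is \<open>(1 + T^2)^(-1)\<close> and \<open>Xop\<close> below is
  \<open>T (1 + T^2)^(-1)\<close>, both preceded by the projection onto \<open>K\<close>. The
  description of \<open>Gop\<close> mentions \<open>T\<close> only through \<open>T O T\<close>, so
  operators with equal squares share it.\<close>

definition Gop :: "'a \<Rightarrow> 'a" where
  "Gop x = (THE g. (g, proj_onto K x - g) \<in> T O T)"

definition Xop :: "'a \<Rightarrow> 'a" where
  "Xop x = (THE h. (Gop x, h) \<in> T)"

lemma square_unique:
  assumes "(g, k - g) \<in> T O T" "(g', k - g') \<in> T O T"
  shows "g = g'"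
proof -
  obtain h h' where h: "(g, h) \<in> T" "(h, k - g) \<in> T" and h': "(g', h') \<in> T" "(h', k - g') \<in> T"
    using assms by auto
  have d: "(g - g', h - h') \<in> T" "(h - h', - (g - g')) \<in> T"
    using diff[OF h(1) h'(1)] diff[OF h(2) h'(2)] by (simp_all add: algebra_simps)
  have "cinner (h - h') (h - h') = cinner (g - g') (- (g - g'))" by (rule sym[OF d(1) d(2)])
  then have "complex_of_real ((norm (h - h'))\<^sup>2 + (norm (g - g'))\<^sup>2) = 0"
    unfolding cinner_minus_right cinner_norm by simp
  then have "(norm (h - h'))\<^sup>2 + (norm (g - g'))\<^sup>2 = 0" by (simp only: of_real_eq_0_iff)
  then show ?thesis by (simp add: sum_power2_eq_zero_iff)
qed

lemma Gop_eqI: "(g, proj_onto K x - g) \<in> T O T \<Longrightarrow> Gop x = g"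
  unfolding Gop_def using square_unique by blast

text \<open>Factor \<open>1 + T^2 = (T + \<i>)(T - \<i>)\<close> and solve the two equations in turn
  by \<open>surj_i\<close>.\<close>

lemma square_surj:
  assumes k: "k \<in> K"
  shows "\<exists>g h. (g, h) \<in> T \<and> (h, k - g) \<in> T"
proof -
  obtain u v where uv: "(u, v) \<in> T" "v + scaleC \<i> u = k" using surj_i[of \<i>, OF _ k] by auto
  obtain g h where gh: "(g, h) \<in> T" "h + scaleC (- \<i>) g = u"
    using surj_i[of "- \<i>" u] mem[OF uv(1)] by auto
  have h: "h = u + scaleC \<i> g" using gh(2) by (auto simp: scaleC_minus_left)
  have "(u + scaleC \<i> g, v + scaleC \<i> h) \<in> T" by (intro add scaleC uv gh)
  moreover have "v + scaleC \<i> h = k - g"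
    using uv(2)[symmetric] by (simp add: h scaleC_add_right scaleC_scaleC scaleC_minus_left algebra_simps)
  ultimately show ?thesis using gh(1) h by auto
qed

lemma Xop: "(Gop x, Xop x) \<in> T" "(Xop x, proj_onto K x - Gop x) \<in> T"
proof -
  obtain g h where gh: "(g, h) \<in> T" "(h, proj_onto K x - g) \<in> T"
    using square_surj[OF proj_onto_mem[OF K]] by blast
  then have "Gop x = g" by (intro Gop_eqI) auto
  moreover have "Xop x = h" unfolding Xop_def using calculation gh(1) unique by blast
  ultimately show "(Gop x, Xop x) \<in> T" "(Xop x, proj_onto K x - Gop x) \<in> T" using gh by auto
qed

lemma Gop_Xop_eqI: "(g, h) \<in> T \<Longrightarrow> (h, proj_onto K x - g) \<in> T \<Longrightarrow> Gop x = g \<and> Xop x = h"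
  using Gop_eqI[of g x] Xop(1)[of x] unique by blast

text \<open>\<open>Xop x\<close> solves the equation that characterizes \<open>Gop y\<close>:
  \<open>T\<close> sends it to \<open>x - Gop x\<close>, and that in turn to
  \<open>y - Xop x\<close>.\<close>

lemma Gop_commute:
  assumes xy: "(x, y) \<in> T"
  shows "Gop y = Xop x"
proof -
  have x: "proj_onto K x = x" and y: "proj_onto K y = y" using mem[OF xy] proj_onto_self[OF K_sub] by auto
  have "(proj_onto K x - Gop x, proj_onto K y - Xop x) \<in> T"
    unfolding x y by (rule diff[OF xy Xop(1)])
  from Gop_Xop_eqI[OF Xop(2) this] show ?thesis by simp
qed

lemma Gop_zero_imp: "Gop x = 0 \<Longrightarrow> x \<in> K \<Longrightarrow> x = 0"
proof -
  assume g: "Gop x = 0" and x: "x \<in> K"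
  have "Xop x = 0" using Xop(1)[of x] unique[OF zero] unfolding g by metis
  then have "(0, x) \<in> T" using Xop(2)[of x] by (simp add: g proj_onto_self[OF K_sub x])
  then show "x = 0" using unique[OF zero] by metis
qed

lemma Gop_add: "Gop (x + y) = Gop x + Gop y" and Xop_add: "Xop (x + y) = Xop x + Xop y"
  using Gop_Xop_eqI[OF add[OF Xop(1) Xop(1)], of x y "x + y"] add[OF Xop(2) Xop(2), of x y]
  by (simp_all add: bclin_add[OF bclin_proj_onto(1)[OF K]] algebra_simps)

lemma Gop_scaleC: "Gop (scaleC c x) = scaleC c (Gop x)" and Xop_scaleC: "Xop (scaleC c x) = scaleC c (Xop x)"
  using Gop_Xop_eqI[OF scaleC[OF Xop(1)], of c x "scaleC c x"] scaleC[OF Xop(2), of c x]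
  by (simp_all add: bclin_scaleC[OF bclin_proj_onto(1)[OF K]] scaleC_diff_right)

lemma Gop_diff: "Gop (x - y) = Gop x - Gop y"
  using Gop_add[of x "scaleC (-1) y"] Gop_scaleC[of "-1" y] by (simp add: scaleC_minus_left)

text \<open>The inner product of \<open>g = Gop x\<close> and \<open>T^2 g\<close> is
  \<open>\<parallel>T g\<parallel>^2\<close>, so expanding the square of \<open>g + T^2 g\<close>
  has no negative term; this gives boundedness of \<open>Xop\<close>.\<close>

lemma Xop_norms: "(norm (Gop x))\<^sup>2 + 2 * (norm (Xop x))\<^sup>2 + (norm (proj_onto K x - Gop x))\<^sup>2 = (norm (proj_onto K x))\<^sup>2"
proof -
  have "cinner (Xop x) (Xop x) = cinner (Gop x) (proj_onto K x - Gop x)"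
    using sym[OF Xop(1) Xop(2)] .
  then have "Re (cinner (Gop x) (proj_onto K x - Gop x)) = (norm (Xop x))\<^sup>2"
    by (metis norm_sq_cinner)
  then show ?thesis using norm_add_sq[of "Gop x" "proj_onto K x - Gop x"] by simp
qed

text \<open>Writing the projected vector as \<open>g + T^2 g\<close>, the form of \<open>Xop\<close>
  becomes \<open><g, T g>\<close> plus \<open><T g, T (T g)>\<close>. Symmetry and positivity are
  inherited from \<open>T\<close> in each summand.\<close>

lemma Xop_operator:
  "bclin Xop" "cinner (Xop x) y = cinner x (Xop y)" "0 \<le> Re (cinner x (Xop x))"
proof -
  have "norm (Xop x) \<le> 1 * norm x" for x
  proof -
    have "2 * (norm (Xop x))\<^sup>2 \<le> (norm (proj_onto K x))\<^sup>2"
      using Xop_norms[of x] zero_le_power2[of "norm (Gop x)"] zero_le_power2[of "norm (proj_onto K x - Gop x)"] by linarith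
    then have "(norm (Xop x))\<^sup>2 \<le> (norm (proj_onto K x))\<^sup>2"
      using zero_le_power2[of "norm (Xop x)"] by linarith
    then have "norm (Xop x) \<le> norm (proj_onto K x)" by (rule power2_le_imp_le) simp
    then show ?thesis using bclin_proj_onto(2)[OF K, of x] by linarith
  qed
  then show "bclin Xop" using Xop_add Xop_scaleC unfolding bclin_def by blast
  have form: "cinner z (Xop x) = cinner (proj_onto K z) (Xop x)" for x z
    using proj_onto_self[OF K_sub, of "Xop x"] mem[OF Xop(1), of x] bclin_proj_onto(3)[OF K, of z "Xop x"] by simp
  have form': "cinner (Xop x) z = cinner (Xop x) (proj_onto K z)" for x z
    using form[of z x] by (metis cinner_commute)
  show "cinner (Xop x) y = cinner x (Xop y)" for x y
  proof -
    define gx hx kx where "gx = Gop x" and "hx = Xop x" and "kx = proj_onto K x - Gop x"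
    define gy hy ky where "gy = Gop y" and "hy = Xop y" and "ky = proj_onto K y - Gop y"
    have "cinner (Xop x) y = cinner hx (gy + ky)" by (simp add: form'[of x y] hx_def gy_def ky_def)
    also have "\<dots> = cinner hx gy + cinner hx ky" by (rule cinner_add_right)
    also have "cinner hx gy = cinner gx hy" unfolding hx_def gy_def gx_def hy_def by (rule sym[OF Xop(1) Xop(1)])
    also have "cinner hx ky = cinner kx hy" unfolding hx_def ky_def kx_def hy_def by (rule sym[OF Xop(2) Xop(2), symmetric])
    also have "cinner gx hy + cinner kx hy = cinner (gx + kx) hy" by (rule cinner_add_left[symmetric])
    also have "\<dots> = cinner x (Xop y)" by (simp add: form[of x y] gx_def kx_def hy_def)
    finally show ?thesis .
  qed
  show "0 \<le> Re (cinner x (Xop x))"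
  proof -
    define g k where "g = Gop x" and "k = proj_onto K x - Gop x"
    have "cinner x (Xop x) = cinner (g + k) (Xop x)" by (simp add: form[of x x] g_def k_def)
    then have "Re (cinner x (Xop x)) = Re (cinner g (Xop x)) + Re (cinner (Xop x) k)"
      by (simp add: cinner_simps Re_cinner_commute[of k])
    then show ?thesis using pos[OF Xop(1), of x] pos[OF Xop(2), of x] by (simp add: g_def k_def)
  qed
qed

text \<open>The right-hand side depends on \<open>T^2\<close> only, so two positive roots of the
  same operator have transforms \<open>Xop\<close> with the same square, to which the bounded
  uniqueness result applies.\<close>

lemma Xop_square: "Xop (Xop x) = Gop x - Gop (Gop x)"
proof -
  have "Gop (Xop x) = Xop (Gop x)" by (rule Gop_commute[OF Xop(1)])
  then have "(Xop (Gop x), Xop (Xop x)) \<in> T" using Xop(1)[of "Xop x"] by simp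
  moreover have "(Xop (Gop x), Gop x - Gop (Gop x)) \<in> T"
    using Xop(2)[of "Gop x"] proj_onto_self[OF K_sub, of "Gop x"] mem[OF Xop(1), of x] by simp
  ultimately show ?thesis by (rule unique)
qed

end

text \<open>Both transforms coincide for \<open>S\<close> and \<open>T\<close>. Given
  \<open>(x, y)\<close> in \<open>S\<close>, solve \<open>(T + 1) z = x + y\<close>. Applying the
  common \<open>Gop\<close> yields \<open>(T + 1) Gop x = (T + 1) Gop z\<close>, and injectivity of
  \<open>T + 1\<close> and of \<open>Gop\<close> on \<open>K\<close> gives
  \<open>x = z\<close>.\<close>

theorem positive_sqrt_unique:
  assumes S: "positive K S" and T: "positive K T" and eq: "S O S = T O T"
  shows "S = T"
proof -
  have incl: "S \<subseteq> T" if "positive K S" "positive K T" "S O S = T O T" for S T :: "'a rel"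
  proof
    interpret S: positive K S by fact
    interpret T: positive K T by fact
    have G: "S.Gop = T.Gop" unfolding S.Gop_def[abs_def] T.Gop_def[abs_def] that(3) ..
    have X: "S.Xop x = T.Xop x" for x
      by (rule bounded_positive_sqrt_unique[OF S.Xop_operator T.Xop_operator]) (simp add: S.Xop_square T.Xop_square G)
    fix p assume "p \<in> S"
    moreover obtain x y where p: "p = (x, y)" by fastforce
    ultimately have xy: "(x, y) \<in> S" by simp
    obtain z w where zw: "(z, w) \<in> T" "w + z = y + x"
      using T.pos_surj[of 1 "y + x"] S.mem[OF xy] csubspace_add[OF S.K_sub] by auto
    have "T.Gop (y + x) = T.Xop x + T.Gop x"
      using S.Gop_commute[OF xy] by (simp add: S.Gop_add G X flip: G)
    moreover have "T.Gop (w + z) = T.Xop z + T.Gop z"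
      using T.Gop_commute[OF zw(1)] by (simp add: T.Gop_add)
    ultimately have "T.Xop x + T.Gop x = T.Xop z + T.Gop z" using zw(2) by simp
    then have "T.Gop x = T.Gop z"
      by (intro T.pos_inj'[OF T.Xop(1) T.Xop(1), of 1]) auto
    then have "T.Gop (x - z) = 0" by (simp add: T.Gop_diff)
    moreover have "x - z \<in> K" using S.mem[OF xy] T.mem[OF zw(1)] csubspace_diff[OF S.K_sub] by blast
    ultimately have "x = z" using T.Gop_zero_imp[of "x - z"] by simp
    then show "p \<in> T" using zw p by simp
  qed
  show ?thesis using incl[OF S T eq] incl[OF T S eq[symmetric]] by blast
qed

section \<open>Absolute value and phase of a positive operator\<close>

context positive
begin

lemma op_abs_eq: "op_abs K T = T"
proof -
  have adj: "adjoint_on K T = T" using T by (simp add: selfadj_on_def)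
  have "positive_on K T" using T pos by (auto simp: positive_on_def)
  moreover have "S = T" if "positive_on K S \<and> S O S = T O T" for S
    using positive_sqrt_unique[OF positiveI[OF K] positive_axioms] that by blast
  ultimately show ?thesis unfolding op_abs_def adj by (intro the_equality) blast+
qed

text \<open>Any admissible \<open>U\<close> fixes the range of \<open>T\<close>. Its fixed vectors
  form a closed subspace, and a vector of \<open>K\<close> orthogonal to the range lies in the
  trivial kernel of \<open>T\<close>; so \<open>U\<close> is the identity on
  \<open>K\<close>.\<close>

lemma polar_phase_eq:
  assumes ker: "op_ker T = {0}"
  shows "polar_phase K T = {(x, x) | x. x \<in> K}" (is "_ = ?I")
  unfolding polar_phase_def op_abs_eq
proof (rule the_equality)
  have "bounded_total_on K ?I"
    using csubspace_0[OF K_sub] csubspace_add[OF K_sub] csubspace_scaleC[OF K_sub]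
    by (auto simp: bounded_total_on_def is_op_on_def op_dom_def intro!: exI[of _ 1])
  moreover have "T = T O ?I" using mem by auto
  ultimately show "bounded_total_on K ?I \<and> T = T O ?I" by blast
next
  fix U assume U: "bounded_total_on K U \<and> T = T O U"
  then have op: "is_op_on K U" and dom: "op_dom U = K" by (auto simp: bounded_total_on_def)
  obtain C where C: "\<And>x y. (x, y) \<in> U \<Longrightarrow> norm y \<le> C * norm x" using U by (auto simp: bounded_total_on_def)
  define M where "M = {x. (x, x) \<in> U}"
  have ran: "y \<in> M" if xy: "(x, y) \<in> T" for x y
  proof -
    have "(x, y) \<in> T O U" using xy U by blast
    then obtain y' where y': "(x, y') \<in> T" "(y', y) \<in> U" by auto
    then have "y' = y" using unique xy by blast
    then show ?thesis using y'(2) by (simp add: M_def)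
  qed
  have "closed M"
    unfolding closed_sequential_limits
  proof (intro allI impI, elim conjE)
    fix s l assume s: "\<forall>n. s n \<in> M" and l: "s \<longlonglongrightarrow> l"
    have "closed K" using K by (simp add: closed_csubspace_def)
    moreover have "s n \<in> K" for n using s is_op_on_mem[OF op] unfolding M_def by blast
    ultimately have "l \<in> K" using l closed_sequentially by blast
    then obtain u where u: "(l, u) \<in> U" using dom by (auto simp: op_dom_def)
    have "norm (s n - u) \<le> C * norm (s n - l)" for n
      using C[OF is_op_on_diff[OF op _ u]] s by (auto simp: M_def)
    then have ev: "\<forall>\<^sub>F n in sequentially. norm (s n - u) \<le> C * norm (s n - l)" by simp
    have "(\<lambda>n. C * norm (s n - l)) \<longlonglongrightarrow> C * 0"
      by (rule tendsto_mult[OF tendsto_const tendsto_norm_zero[OF LIM_zero[OF l]]])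
    then have "(\<lambda>n. C * norm (s n - l)) \<longlonglongrightarrow> 0" by simp
    from Lim_null_comparison[OF ev this] have "(\<lambda>n. s n - u) \<longlonglongrightarrow> 0" .
    then have "s \<longlonglongrightarrow> u" by (simp add: LIM_zero_iff)
    then have "u = l" using l LIMSEQ_unique by blast
    then show "l \<in> M" using u by (simp add: M_def)
  qed
  then have M: "closed_csubspace M"
    using is_op_on_zero[OF op] is_op_on_add[OF op] is_op_on_scaleC[OF op]
    by (auto simp: closed_csubspace_def csubspace_def M_def)
  have MK: "M \<subseteq> K" using is_op_on_mem[OF op] by (auto simp: M_def)
  have KM: "k \<in> M" if k: "k \<in> K" for k
  proof -
    define r where "r = k - proj_onto M k"
    have rK: "r \<in> K" unfolding r_def using csubspace_diff[OF K_sub k] proj_onto_mem[OF M] MK by blast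
    have "(r, 0) \<in> T"
    proof (rule memI[OF rK csubspace_0[OF K_sub]])
      fix x w assume "(x, w) \<in> T"
      then show "cinner w r = cinner x 0" using proj_onto_orth[OF M ran] by (simp add: r_def)
    qed
    then have "r = 0" using ker by (auto simp: op_ker_def)
    then show ?thesis using proj_onto_mem[OF M, of k] by (simp add: r_def)
  qed
  show "U = ?I"
  proof (intro set_eqI iffI; clarify)
    fix x y assume xy: "(x, y) \<in> U"
    then have "(x, x) \<in> U" using KM is_op_on_mem[OF op xy] by (simp add: M_def)
    then have "y = x" using is_op_on_unique[OF op xy] by blast
    then show "\<exists>z. (x, y) = (z, z) \<and> z \<in> K" using is_op_on_mem[OF op xy] by blast
  next
    fix x assume "x \<in> K" then show "(x, x) \<in> U" using KM by (simp add: M_def)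
  qed
qed

end

section \<open>A Mellin transform\<close>

text \<open>The logistic density: at \<open>z = ln \<lambda> - ln s\<close> it equals
  \<open>\<lambda>s/(s + \<lambda>)\<^sup>2\<close>, so dilation of \<open>\<lambda>\<close> becomes
  translation on the line.\<close>

definition logi :: "complex \<Rightarrow> complex" where
  "logi z = exp z / (1 + exp z)\<^sup>2"

lemma cos_half_pos: "\<bar>\<theta>\<bar> < pi \<Longrightarrow> 0 < (1 + cos \<theta>) / 2"
  using cos_monotone_0_pi[of "\<bar>\<theta>\<bar>" pi] by simp

text \<open>The right-hand side is exactly the convex combination of \<open>(s + l)^2\<close> and
  \<open>(s - l)^2\<close> with weights \<open>(1 + cos \<theta>)/2\<close> and
  \<open>(1 - cos \<theta>)/2\<close>. The first weight is positive precisely because the angle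
  stays below \<open>pi\<close>, and it is the constant in all later bounds.\<close>

lemma rotated_sum_lower_bound:
  fixes s l \<theta> :: real
  assumes "0 \<le> s" "0 \<le> l"
  shows "(1 + cos \<theta>) / 2 * (s + l)\<^sup>2 \<le> (cmod (of_real s + of_real l * exp (- \<i> * of_real \<theta>)))\<^sup>2"
proof -
  have e: "exp (- \<i> * complex_of_real \<theta>) = Complex (cos \<theta>) (- sin \<theta>)"
    by (simp add: exp_eq_polar complex_eq_iff Re_exp Im_exp)
  have "(cmod (of_real s + of_real l * exp (- \<i> * of_real \<theta>)))\<^sup>2 = (s + l * cos \<theta>)\<^sup>2 + (l * sin \<theta>)\<^sup>2"
    unfolding e by (simp add: cmod_power2)
  also have "\<dots> = s\<^sup>2 + 2 * s * l * cos \<theta> + l\<^sup>2 * ((sin \<theta>)\<^sup>2 + (cos \<theta>)\<^sup>2)"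
    by algebra
  also have "\<dots> = (1 + cos \<theta>) / 2 * (s + l)\<^sup>2 + (1 - cos \<theta>) / 2 * (s - l)\<^sup>2"
    by (simp add: power2_eq_square field_simps)
  finally show ?thesis using cos_le_one[of \<theta>] by simp
qed

lemma rotated_sum_nonzero:
  fixes s l \<theta> :: real
  assumes "\<bar>\<theta>\<bar> < pi" "0 < s" "0 < l"
  shows "of_real s + of_real l * exp (- \<i> * complex_of_real \<theta>) \<noteq> 0"
proof -
  have "0 < (1 + cos \<theta>) / 2 * (s + l)\<^sup>2"
    using cos_half_pos[OF assms(1)] assms by (intro mult_pos_pos zero_less_power add_pos_pos) auto
  then have "0 < (cmod (of_real s + of_real l * exp (- \<i> * complex_of_real \<theta>)))\<^sup>2"
    using rotated_sum_lower_bound[of s l \<theta>] assms by linarith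
  then show ?thesis by auto
qed

lemma logi_bound:
  assumes "\<bar>\<theta>\<bar> < pi"
  shows "cmod (logi (of_real x - \<i> * of_real \<theta>)) \<le> exp x / (1 + exp x)\<^sup>2 / ((1 + cos \<theta>) / 2)"
proof -
  have e: "exp (of_real x - \<i> * of_real \<theta>) = of_real (exp x) * exp (- \<i> * complex_of_real \<theta>)"
    by (simp add: exp_diff exp_minus exp_of_real divide_inverse)
  have n: "cmod (exp (of_real x - \<i> * of_real \<theta>)) = exp x" by simp
  have "(1 + cos \<theta>) / 2 * (1 + exp x)\<^sup>2 \<le> (cmod (1 + exp (of_real x - \<i> * of_real \<theta>)))\<^sup>2"
    using rotated_sum_lower_bound[of 1 "exp x" \<theta>] unfolding e by simp
  moreover have "0 < (1 + cos \<theta>) / 2 * (1 + exp x)\<^sup>2"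
    using cos_half_pos[OF assms] by (intro mult_pos_pos zero_less_power add_pos_pos) auto
  ultimately have "exp x / (cmod (1 + exp (of_real x - \<i> * of_real \<theta>)))\<^sup>2 \<le> exp x / ((1 + cos \<theta>) / 2 * (1 + exp x)\<^sup>2)"
    using cos_half_pos[OF assms] by (intro divide_left_mono mult_pos_pos) auto
  then show ?thesis unfolding logi_def norm_divide norm_power n by (simp add: mult.commute)
qed

lemma one_plus_exp_nonzero:
  assumes "\<bar>Im z\<bar> < pi"
  shows "1 + exp z \<noteq> 0"
proof
  assume "1 + exp z = 0"
  have z: "exp z = of_real (exp (Re z)) * exp (- \<i> * of_real (- Im z))"
    using exp_eq_polar[of z] by (simp add: cis_conv_exp)
  have "(1 + cos (- Im z)) / 2 * (1 + exp (Re z))\<^sup>2 \<le> (cmod (1 + exp z))\<^sup>2"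
    using rotated_sum_lower_bound[of 1 "exp (Re z)" "- Im z"] unfolding z by simp
  then have "(1 + cos (- Im z)) / 2 * (1 + exp (Re z))\<^sup>2 \<le> 0" using \<open>1 + exp z = 0\<close> by simp
  moreover have "0 < (1 + cos (- Im z)) / 2 * (1 + exp (Re z))\<^sup>2"
    using cos_half_pos[of "- Im z"] assms by (intro mult_pos_pos zero_less_power add_pos_pos) auto
  ultimately show False by linarith
qed

section \<open>Fourier integrals of the logistic density\<close>

lemma measurable_logi [measurable]: "logi \<in> borel_measurable borel"
  unfolding logi_def by measurable

text \<open>Euler's integral under \<open>t = exp v\<close>; the result is put in terms of
  \<open>lborel\<close> so that Fubini and translations apply.\<close>

lemma Gamma_lborel:
  assumes z: "Re z > 0"
  shows "integrable lborel (\<lambda>v. exp (z * of_real v - of_real (exp v)))"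
    "(LINT v|lborel. exp (z * of_real v - of_real (exp v))) = Gamma z"
proof -
  let ?f = "\<lambda>t::real. complex_of_real t powr (z - 1) / of_real (exp t)"
  let ?g = "\<lambda>v::real. exp (z * of_real v - of_real (exp v)) :: complex"
  have "(\<lambda>v::real. \<bar>exp v\<bar> *\<^sub>R ?f (exp v)) absolutely_integrable_on UNIV \<and>
      integral UNIV (\<lambda>v. \<bar>exp v\<bar> *\<^sub>R ?f (exp v)) = Gamma z \<longleftrightarrow>
      ?f absolutely_integrable_on exp ` UNIV \<and> integral (exp ` UNIV) ?f = Gamma z"
    by (rule has_absolute_integral_change_of_variables_real) (auto intro!: derivative_eq_intros injI)
  moreover have "range (exp :: real \<Rightarrow> real) = {0<..}"
    by (auto simp: image_iff) (metis exp_ln)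
  ultimately have *: "(\<lambda>v::real. \<bar>exp v\<bar> *\<^sub>R ?f (exp v)) absolutely_integrable_on UNIV \<and>
      integral UNIV (\<lambda>v. \<bar>exp v\<bar> *\<^sub>R ?f (exp v)) = Gamma z"
    using absolutely_integrable_Gamma_integral'[OF z] Gamma_integral_complex'[OF z] by (auto simp: integral_unique)
  have "\<bar>exp v\<bar> *\<^sub>R ?f (exp v) = ?g v" for v
  proof -
    have "\<bar>exp v\<bar> *\<^sub>R ?f (exp v) = exp (of_real v) * (exp ((z - 1) * of_real v) / exp (of_real (exp v)))"
      by (simp add: powr_def scaleR_conv_of_real Ln_of_real flip: exp_of_real)
    also have "\<dots> = ?g v" by (simp add: left_diff_distrib exp_diff)
    finally show ?thesis .
  qed
  with * have g: "set_integrable lebesgue UNIV ?g" "integral UNIV ?g = Gamma z" by simp_all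
  have meas: "?g \<in> borel_measurable lborel" by measurable
  show "integrable lborel ?g"
    using g(1) integrable_completion[OF meas] by (simp add: set_integrable_def)
  have "(LINT v|lebesgue. ?g v) = Gamma z"
    using set_lebesgue_integral_eq_integral(2)[OF g(1)] g(2) by (simp add: set_lebesgue_integral_def)
  then show "(LINT v|lborel. ?g v) = Gamma z" using integral_completion[OF meas] by simp
qed

text \<open>Convolving two Gamma integrals gives \<open>\<Gamma>(1 + it) \<Gamma>(1 - it)\<close> as the Fourier transform of \<open>logi\<close>.\<close>

lemma fourier_logi:
  shows integrable_fourier_logi: "integrable lborel (\<lambda>x. logi (of_real x) * exp (\<i> * of_real (t * x)))"
    and fourier_logi_nonzero: "(LINT x|lborel. logi (of_real x) * exp (\<i> * of_real (t * x))) \<noteq> 0"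
proof -
  define a b where "a = 1 + \<i> * complex_of_real t" and "b = 1 - \<i> * complex_of_real t"
  have re: "Re a > 0" "Re b > 0" by (simp_all add: a_def b_def)
  define \<phi> \<psi> where "\<phi> v = exp (a * complex_of_real v - of_real (exp v))"
    and "\<psi> v = exp (b * complex_of_real v - of_real (exp v))" for v
  have \<phi>: "integrable lborel \<phi>" "integral\<^sup>L lborel \<phi> = Gamma a"
    and \<psi>: "integrable lborel \<psi>" "integral\<^sup>L lborel \<psi> = Gamma b"
    using Gamma_lborel[OF re(1)] Gamma_lborel[OF re(2)] by (simp_all add: \<phi>_def[abs_def] \<psi>_def[abs_def])
  have meas [measurable]: "\<phi> \<in> borel_measurable borel" "\<psi> \<in> borel_measurable borel"
    unfolding \<phi>_def \<psi>_def by measurable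
  define h where "h x y = \<phi> (x + y) * \<psi> y" for x y
  have shift: "(LINT x|lborel. h x y) = Gamma a * \<psi> y" for y
  proof -
    have "(LINT x|lborel. \<phi> (y + 1 * x)) = Gamma a"
      using lborel_integral_real_affine[of 1 \<phi> y] \<phi>(2) by simp
    then show ?thesis by (simp add: h_def add.commute)
  qed
  have shift_norm: "(LINT x|lborel. norm (h x y)) = (LINT x|lborel. norm (\<phi> x)) * norm (\<psi> y)" for y
    using lborel_integral_real_affine[of 1 "\<lambda>x. norm (\<phi> x)" y] by (simp add: h_def norm_mult add.commute)
  have int_x: "integrable lborel (\<lambda>x. h x y)" for y
    using lborel_integrable_real_affine[OF \<phi>(1), of 1 y] by (simp add: h_def add.commute)
  have hm: "(\<lambda>(y, x). h x y) \<in> borel_measurable (lborel \<Otimes>\<^sub>M lborel)"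
    unfolding h_def by measurable
  have prod: "integrable (lborel \<Otimes>\<^sub>M lborel) (\<lambda>(y, x). h x y)"
    by (rule lborel_pair.Fubini_integrable[OF hm]) (use \<psi>(1) int_x in \<open>auto simp: shift_norm\<close>)
  \<comment> \<open>Since \<open>a + b = 2\<close> and
    \<open>exp (x + y) + exp y = (1 + exp x) exp y\<close>, translating \<open>y\<close> by
    \<open>ln (1 + exp x)\<close> leaves the integral of \<open>Gamma 2 = 1\<close> and the factor
    \<open>(1 + exp x)^(-2)\<close>.\<close>
  have inner: "(LINT y|lborel. h x y) = logi (of_real x) * exp (\<i> * of_real (t * x))" for x
  proof -
    let ?w = "1 + exp x"
    have w: "?w > 0" by (rule add_pos_pos) auto
    have "(LINT v|lborel. exp (2 * complex_of_real v - of_real (exp v))) = 1"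
      using Gamma_lborel(2)[of 2] Gamma_fact[of 1] by (simp add: numeral_2_eq_2)
    then have "(LINT y|lborel. exp (2 * complex_of_real (ln ?w + 1 * y) - of_real (exp (ln ?w + 1 * y)))) = 1"
      using lborel_integral_real_affine[of 1 "\<lambda>v. exp (2 * complex_of_real v - of_real (exp v))" "ln ?w"] by simp
    moreover have "h x y * of_real (?w\<^sup>2) = exp (a * of_real x) * exp (2 * complex_of_real (ln ?w + 1 * y) - of_real (exp (ln ?w + 1 * y)))" for y
    proof -
      have "complex_of_real (?w\<^sup>2) = exp (2 * of_real (ln ?w))"
        using w by (simp add: exp_of_real[symmetric] exp_double power2_eq_square) (simp add: exp_of_real flip: exp_add)
      then have "h x y * of_real (?w\<^sup>2) = exp (a * of_real (x + y) - of_real (exp (x + y)) + (b * of_real y - of_real (exp y)) + 2 * of_real (ln ?w))"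
        by (simp add: h_def \<phi>_def \<psi>_def exp_add)
      also have "a * of_real (x + y) - of_real (exp (x + y)) + (b * of_real y - of_real (exp y)) + 2 * of_real (ln ?w)
        = a * of_real x + (2 * complex_of_real (ln ?w + 1 * y) - of_real (exp (ln ?w + 1 * y)))"
        using w by (simp add: a_def b_def exp_add algebra_simps)
      finally show ?thesis by (simp add: exp_add)
    qed
    ultimately have "(LINT y|lborel. h x y * of_real (?w\<^sup>2)) = exp (a * of_real x)" by simp
    then have "(LINT y|lborel. h x y) * of_real (?w\<^sup>2) = exp (a * of_real x)" by simp
    moreover have "complex_of_real (?w\<^sup>2) \<noteq> 0" using w by (simp only: of_real_eq_0_iff) simp
    ultimately have "(LINT y|lborel. h x y) = exp (a * of_real x) / of_real (?w\<^sup>2)" by (simp add: field_simps)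
    then show ?thesis by (simp add: logi_def a_def exp_of_real algebra_simps exp_add)
  qed
  have "integrable lborel (\<lambda>x. LINT y|lborel. h x y)"
    using lborel_pair.integrable_snd[OF prod] by simp
  then show "integrable lborel (\<lambda>x. logi (of_real x) * exp (\<i> * of_real (t * x)))" by (simp add: inner)
  have "(LINT x|lborel. LINT y|lborel. h x y) = (LINT y|lborel. LINT x|lborel. h x y)"
    by (rule lborel_pair.Fubini_integral[OF prod])
  then have "(LINT x|lborel. logi (of_real x) * exp (\<i> * of_real (t * x))) = Gamma a * Gamma b"
    by (simp add: inner shift \<psi>(2))
  moreover have "Gamma a \<noteq> 0" "Gamma b \<noteq> 0"
    using re unfolding Gamma_eq_zero_iff by (auto elim!: nonpos_Ints_cases)
  ultimately show "(LINT x|lborel. logi (of_real x) * exp (\<i> * of_real (t * x))) \<noteq> 0" by simp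
qed

lemma integrable_logi_real: "integrable lborel (\<lambda>x::real. exp x / (1 + exp x)\<^sup>2)"
proof -
  have "integrable lborel (\<lambda>x. norm (logi (of_real x) * exp (\<i> * of_real (0 * x))))"
    by (intro integrable_norm integrable_fourier_logi)
  moreover have "norm (logi (of_real x) * exp (\<i> * of_real (0 * x))) = exp x / (1 + exp x)\<^sup>2" for x
  proof -
    have "1 + complex_of_real (exp x) = of_real (1 + exp x)" by simp
    then have "cmod (1 + complex_of_real (exp x)) = 1 + exp x" by (metis abs_of_pos add_pos_pos exp_gt_zero norm_of_real zero_less_one)
    then show ?thesis by (simp add: logi_def norm_divide norm_power exp_of_real)
  qed
  ultimately show ?thesis by simp
qed

lemma integrable_logi:
  assumes "\<bar>\<theta>\<bar> < pi"
  shows "integrable lborel (\<lambda>x. logi (of_real x - \<i> * of_real \<theta>) * exp (\<i> * of_real (t * x)))"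
proof (rule Bochner_Integration.integrable_bound)
  show "integrable lborel (\<lambda>x::real. exp x / (1 + exp x)\<^sup>2 / ((1 + cos \<theta>) / 2))"
    by (intro integrable_divide integrable_logi_real)
  show "(\<lambda>x. logi (of_real x - \<i> * of_real \<theta>) * exp (\<i> * of_real (t * x))) \<in> borel_measurable lborel" by measurable
  show "AE x in lborel. norm (logi (of_real x - \<i> * of_real \<theta>) * exp (\<i> * of_real (t * x))) \<le> norm (exp x / (1 + exp x)\<^sup>2 / ((1 + cos \<theta>) / 2))"
  proof (rule AE_I2)
    fix x :: real
    have "norm (logi (of_real x - \<i> * of_real \<theta>) * exp (\<i> * of_real (t * x))) = cmod (logi (of_real x - \<i> * of_real \<theta>))"
      by (simp add: norm_mult)
    also have "\<dots> \<le> exp x / (1 + exp x)\<^sup>2 / ((1 + cos \<theta>) / 2)" by (rule logi_bound[OF assms])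
    finally show "norm (logi (of_real x - \<i> * of_real \<theta>) * exp (\<i> * of_real (t * x))) \<le> norm (exp x / (1 + exp x)\<^sup>2 / ((1 + cos \<theta>) / 2))"
      unfolding real_norm_def by (rule order_trans[OF _ abs_ge_self])
  qed
qed

lemma integral_symmetric_interval_limit:
  fixes f :: "real \<Rightarrow> complex"
  assumes f: "integrable lborel f"
  shows "(\<lambda>n. integral {- real n..real n} f) \<longlonglongrightarrow> (LINT x|lborel. f x)"
proof -
  have "integral {- real n..real n} f = (LINT x|lborel. indicator {- real n..real n} x *\<^sub>R f x)" for n
  proof -
    have "set_integrable lborel {- real n..real n} f"
      unfolding set_integrable_def by (intro integrable_mult_indicator f) simp
    from set_borel_integral_eq_integral(2)[OF this] show ?thesis by (simp add: set_lebesgue_integral_def)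
  qed
  moreover have "(\<lambda>n. LINT x|lborel. indicator {- real n..real n} x *\<^sub>R f x) \<longlonglongrightarrow> (LINT x|lborel. f x)"
  proof (rule integral_dominated_convergence[where w="\<lambda>x. norm (f x)"])
    show "AE x in lborel. (\<lambda>n. indicator {- real n..real n} x *\<^sub>R f x) \<longlonglongrightarrow> f x"
    proof (rule AE_I2)
      fix x :: real
      obtain N where "\<bar>x\<bar> \<le> real N" using real_arch_simple by blast
      then show "(\<lambda>n. indicator {- real n..real n} x *\<^sub>R f x) \<longlonglongrightarrow> f x"
        by (intro tendsto_eventually eventually_sequentiallyI[of N]) (auto simp: indicator_def)
    qed
    show "(\<lambda>x. indicator {- real n..real n} x *\<^sub>R f x) \<in> borel_measurable lborel" for n
      using f by measurable
  qed (use f in \<open>auto simp: indicator_def\<close>)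
  ultimately show ?thesis by simp
qed

text \<open>On the strip \<open>\<bar>Im z\<bar> < \<pi>\<close> the function \<open>logi(z) exp(itz)\<close> has a primitive, whose variation along vertical
  segments vanishes at infinity; hence its integral along a horizontal line does not depend on the line.\<close>

lemma logi_shift:
  assumes \<theta>: "\<bar>\<theta>\<bar> < pi"
  shows "(LINT x|lborel. logi (of_real x - \<i> * of_real \<theta>) * exp (\<i> * of_real (t * x)))
     = exp (- (of_real (t * \<theta>))) * (LINT x|lborel. logi (of_real x) * exp (\<i> * of_real (t * x)))"
proof -
  define H where "H z = logi z * exp (\<i> * of_real t * z)" for z
  let ?S = "{z. \<bar>Im z\<bar> < pi}"
  have Sint: "?S = {z. Im z < pi} \<inter> {z. Im z > - pi}" by auto
  have "convex ?S" unfolding Sint by (intro convex_Int convex_halfspace_Im_lt convex_halfspace_Im_gt)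
  moreover have "open ?S" unfolding Sint by (intro open_Int open_halfspace_Im_lt open_halfspace_Im_gt)
  moreover have "H holomorphic_on ?S"
    unfolding H_def logi_def using one_plus_exp_nonzero by (intro holomorphic_intros) auto
  ultimately obtain G where G: "\<And>z. z \<in> ?S \<Longrightarrow> (G has_field_derivative H z) (at z within ?S)"
    using holomorphic_convex_primitive' by blast
  have G': "(G has_field_derivative H z) (at z)" if "\<bar>Im z\<bar> < pi" for z
    using G[of z] that \<open>open ?S\<close> at_within_open[of z ?S] by simp
  have int: "integral {- real n..real n} (\<lambda>x. H (of_real x - \<i> * of_real v)) =
      G (of_real (real n) - \<i> * of_real v) - G (of_real (- real n) - \<i> * of_real v)" if v: "\<bar>v\<bar> < pi" for n v
  proof (rule integral_unique, rule fundamental_theorem_of_calculus)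
    fix x assume "x \<in> {- real n..real n}"
    have "((\<lambda>z. G (z - \<i> * of_real v)) has_field_derivative H (of_real x - \<i> * of_real v) * 1) (at (of_real x))"
      by (rule DERIV_chain2[OF G']) (use v in \<open>auto intro!: derivative_eq_intros\<close>)
    then show "((\<lambda>x. G (of_real x - \<i> * of_real v)) has_vector_derivative H (of_real x - \<i> * of_real v)) (at x within {- real n..real n})"
      by (intro has_vector_derivative_real_field) simp
  qed simp
  \<comment> \<open>A bound for \<open>H\<close> on the vertical segment at abscissa
    \<open>x\<close>, times its length \<open>|\<theta>|\<close>. On the segment \<open>cos\<close>
    is smallest at the end of height \<open>\<theta>\<close>, and the exponential is at most
    \<open>exp (|t| |\<theta>|)\<close>.\<close>
  define B where "B x = exp x / (1 + exp x)\<^sup>2 / ((1 + cos \<theta>) / 2) * exp (\<bar>t\<bar> * \<bar>\<theta>\<bar>) * \<bar>\<theta>\<bar>" for x :: real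
  have var: "cmod (G (of_real x - \<i> * of_real \<theta>) - G (of_real x - \<i> * of_real 0)) \<le> B x" for x
  proof -
    let ?a = "of_real x - \<i> * of_real \<theta>" and ?b = "of_real x - \<i> * of_real 0"
    have "cmod (G ?a - G ?b) \<le> (exp x / (1 + exp x)\<^sup>2 / ((1 + cos \<theta>) / 2) * exp (\<bar>t\<bar> * \<bar>\<theta>\<bar>)) * cmod (?a - ?b)"
    proof (rule field_differentiable_bound[of "closed_segment ?a ?b" G H])
      fix z assume "z \<in> closed_segment ?a ?b"
      then obtain u where u: "0 \<le> u" "u \<le> 1" "z = (1 - u) *\<^sub>R ?a + u *\<^sub>R ?b"
        by (auto simp: closed_segment_def)
      define v where "v = (1 - u) * \<theta>"
      have z: "z = of_real x - \<i> * of_real v"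
        unfolding u(3) v_def by (simp add: scaleR_conv_of_real algebra_simps)
      have v: "\<bar>v\<bar> \<le> \<bar>\<theta>\<bar>" unfolding v_def abs_mult using u by (intro mult_left_le_one_le) auto
      show "(G has_field_derivative H z) (at z within closed_segment ?a ?b)"
        by (rule has_field_derivative_at_within[OF G']) (use v \<theta> z in simp)
      have "cos \<bar>\<theta>\<bar> \<le> cos \<bar>v\<bar>" using v \<theta> by (intro cos_monotone_0_pi_le) auto
      then have "(1 + cos \<theta>) / 2 \<le> (1 + cos v) / 2" by simp
      then have "exp x / (1 + exp x)\<^sup>2 / ((1 + cos v) / 2) \<le> exp x / (1 + exp x)\<^sup>2 / ((1 + cos \<theta>) / 2)"
        using cos_half_pos[OF \<theta>] by (intro divide_left_mono mult_pos_pos) auto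
      moreover have "cmod (logi z) \<le> exp x / (1 + exp x)\<^sup>2 / ((1 + cos v) / 2)"
        unfolding z using v \<theta> by (intro logi_bound) simp
      moreover have "cmod (exp (\<i> * of_real t * z)) \<le> exp (\<bar>t\<bar> * \<bar>\<theta>\<bar>)"
      proof -
        have "Re (\<i> * of_real t * z) = t * v" by (simp add: z)
        also have "\<dots> \<le> \<bar>t\<bar> * \<bar>v\<bar>" by (metis abs_ge_self abs_mult)
        also have "\<dots> \<le> \<bar>t\<bar> * \<bar>\<theta>\<bar>" by (intro mult_left_mono v) simp
        finally show ?thesis by simp
      qed
      ultimately show "norm (H z) \<le> exp x / (1 + exp x)\<^sup>2 / ((1 + cos \<theta>) / 2) * exp (\<bar>t\<bar> * \<bar>\<theta>\<bar>)"
        unfolding H_def norm_mult using cos_half_pos[OF \<theta>] by (intro mult_mono) auto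
    qed auto
    then show ?thesis by (simp add: B_def norm_mult)
  qed
  have B0: "(\<lambda>n. B (real n) + B (- real n)) \<longlonglongrightarrow> 0"
  proof -
    have "(\<lambda>n. exp (real n) / (1 + exp (real n))\<^sup>2) \<longlonglongrightarrow> 0" "(\<lambda>n. exp (- real n) / (1 + exp (- real n))\<^sup>2) \<longlonglongrightarrow> 0"
      by real_asymp+
    then have "(\<lambda>n. B (real n) + B (- real n)) \<longlonglongrightarrow> 0 / ((1 + cos \<theta>) / 2) * exp (\<bar>t\<bar> * \<bar>\<theta>\<bar>) * \<bar>\<theta>\<bar> + 0 / ((1 + cos \<theta>) / 2) * exp (\<bar>t\<bar> * \<bar>\<theta>\<bar>) * \<bar>\<theta>\<bar>"
      unfolding B_def using cos_half_pos[OF \<theta>] by (intro tendsto_intros) auto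
    then show ?thesis by simp
  qed
  have Hint: "integrable lborel (\<lambda>x. H (of_real x - \<i> * of_real v))" and
    Heq: "H (of_real x - \<i> * of_real v) = exp (of_real (t * v)) * (logi (of_real x - \<i> * of_real v) * exp (\<i> * of_real (t * x)))"
    if "\<bar>v\<bar> < pi" for v x
  proof -
    \<comment> \<open>At height \<open>-v\<close> the oscillating factor of \<open>H\<close>
      acquires the real factor \<open>exp (t v)\<close>; equality of the integrals of
      \<open>H\<close> on two lines thereby yields the factor in the conclusion.\<close>
    have Heq: "H (of_real x - \<i> * of_real v) = exp (of_real (t * v)) * (logi (of_real x - \<i> * of_real v) * exp (\<i> * of_real (t * x)))" for x
    proof -
      have "\<i> * of_real t * (of_real x - \<i> * of_real v) = of_real (t * v) + \<i> * of_real (t * x)" by (simp add: algebra_simps)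
      then show ?thesis unfolding H_def by (simp only: exp_add mult.left_commute mult.commute)
    qed
    then show "H (of_real x - \<i> * of_real v) = exp (of_real (t * v)) * (logi (of_real x - \<i> * of_real v) * exp (\<i> * of_real (t * x)))" .
    show "integrable lborel (\<lambda>x. H (of_real x - \<i> * of_real v))"
      unfolding Heq by (intro integrable_mult_right integrable_logi that)
  qed
  have pi0: "\<bar>0::real\<bar> < pi" by simp
  have "(\<lambda>n. integral {- real n..real n} (\<lambda>x. H (of_real x - \<i> * of_real \<theta>)) - integral {- real n..real n} (\<lambda>x. H (of_real x - \<i> * of_real 0)))
      \<longlonglongrightarrow> (LINT x|lborel. H (of_real x - \<i> * of_real \<theta>)) - (LINT x|lborel. H (of_real x - \<i> * of_real 0))"
    by (intro tendsto_diff integral_symmetric_interval_limit Hint \<theta> pi0)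
  moreover have "(\<lambda>n. integral {- real n..real n} (\<lambda>x. H (of_real x - \<i> * of_real \<theta>)) - integral {- real n..real n} (\<lambda>x. H (of_real x - \<i> * of_real 0))) \<longlonglongrightarrow> 0"
  proof (rule Lim_null_comparison[OF _ B0], rule always_eventually, rule allI)
    fix n
    have "integral {- real n..real n} (\<lambda>x. H (of_real x - \<i> * of_real \<theta>)) - integral {- real n..real n} (\<lambda>x. H (of_real x - \<i> * of_real 0))
      = (G (of_real (real n) - \<i> * of_real \<theta>) - G (of_real (real n) - \<i> * of_real 0))
       - (G (of_real (- real n) - \<i> * of_real \<theta>) - G (of_real (- real n) - \<i> * of_real 0))"
      unfolding int[OF \<theta>] int[OF pi0] by simp
    also have "norm \<dots> \<le> B (real n) + B (- real n)"
      by (intro order_trans[OF norm_triangle_ineq4] add_mono var)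
    finally show "norm (integral {- real n..real n} (\<lambda>x. H (of_real x - \<i> * of_real \<theta>)) - integral {- real n..real n} (\<lambda>x. H (of_real x - \<i> * of_real 0))) \<le> B (real n) + B (- real n)" .
  qed
  ultimately have "(LINT x|lborel. H (of_real x - \<i> * of_real \<theta>)) - (LINT x|lborel. H (of_real x - \<i> * of_real 0)) = 0"
    by (rule LIMSEQ_unique)
  then have "exp (of_real (t * \<theta>)) * (LINT x|lborel. logi (of_real x - \<i> * of_real \<theta>) * exp (\<i> * of_real (t * x)))
      = (LINT x|lborel. logi (of_real x) * exp (\<i> * of_real (t * x)))"
    unfolding Heq[OF \<theta>] Heq[OF pi0] by simp
  then have "exp (- of_real (t * \<theta>)) * (exp (of_real (t * \<theta>)) * (LINT x|lborel. logi (of_real x - \<i> * of_real \<theta>) * exp (\<i> * of_real (t * x))))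
      = exp (- of_real (t * \<theta>)) * (LINT x|lborel. logi (of_real x) * exp (\<i> * of_real (t * x)))"
    by simp
  then show ?thesis unfolding mult.assoc[symmetric] exp_add[symmetric] by simp
qed

text \<open>With \<open>\<lambda> = exp y\<close> and \<open>q = exp (-\<i>\<theta>)\<close> this is
  \<open>\<lambda>qs/(s + \<lambda>q)\<^sup>2\<close> for \<open>s > 0\<close>.\<close>

definition mellin_kernel :: "real \<Rightarrow> real \<Rightarrow> real \<Rightarrow> complex" where
  "mellin_kernel \<theta> y s = (if 0 < s then logi (of_real (y - ln s) - \<i> * of_real \<theta>) else 0)"

definition ipow :: "real \<Rightarrow> real \<Rightarrow> complex" where
  "ipow t s = (if 0 < s then exp (\<i> * complex_of_real (t * ln s)) else 0)"

lemma bdd_borel_ipow: "bdd_borel (ipow t)"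
proof (rule bdd_borelI[where C=1])
  show "ipow t \<in> borel_measurable borel" unfolding ipow_def by measurable
qed (simp add: ipow_def)

text \<open>For fixed \<open>s > 0\<close>, translating \<open>y\<close> by \<open>ln s\<close>
  extracts \<open>s^(it)\<close> and leaves a constant independent of \<open>s\<close>, computed by
  \<open>logi_shift\<close>; Fubini exchanges this with the integral over the finite measure
  \<open>M\<close>.\<close>

lemma mellin_transform:
  assumes M: "finite_measure M" "sets M = sets (borel :: real measure)" and \<theta>: "\<bar>\<theta>\<bar> < pi"
  shows "integrable lborel (\<lambda>y. exp (\<i> * of_real (t * y)) * integral\<^sup>L M (mellin_kernel \<theta> y))"
    and "(LINT y|lborel. exp (\<i> * of_real (t * y)) * integral\<^sup>L M (mellin_kernel \<theta> y))
     = exp (- (of_real (t * \<theta>))) * (LINT x|lborel. logi (of_real x) * exp (\<i> * of_real (t * x))) * integral\<^sup>L M (ipow t)"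
proof -
  interpret M: finite_measure M by fact
  interpret P: pair_sigma_finite M lborel ..
  have [measurable_cong]: "sets M = sets borel" by fact
  define J where "J x = logi (of_real x - \<i> * of_real \<theta>) * exp (\<i> * of_real (t * x))" for x
  have J: "integrable lborel J" unfolding J_def[abs_def] by (rule integrable_logi[OF \<theta>])
  define c where "c = (LINT x|lborel. J x)"
  have c: "c = exp (- (of_real (t * \<theta>))) * (LINT x|lborel. logi (of_real x) * exp (\<i> * of_real (t * x)))"
    unfolding c_def J_def by (rule logi_shift[OF \<theta>])
  define f where "f s y = exp (\<i> * of_real (t * y)) * mellin_kernel \<theta> y s" for s y
  have fJ: "f s y = ipow t s * J (- ln s + 1 * y)" for s y
  proof (cases "0 < s")
    case True
    have "exp (\<i> * complex_of_real (t * y)) = exp (\<i> * of_real (t * ln s)) * exp (\<i> * of_real (t * (- ln s + 1 * y)))"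
      by (simp add: algebra_simps flip: exp_add)
    then show ?thesis using True unfolding f_def mellin_kernel_def ipow_def J_def by (simp add: ac_simps)
  qed (simp add: f_def mellin_kernel_def ipow_def)
  have fint: "integrable lborel (f s)" for s
    unfolding fJ[abs_def] by (intro integrable_mult_right lborel_integrable_real_affine J) simp
  have f: "(LINT y|lborel. f s y) = ipow t s * c" for s
    unfolding fJ[abs_def] c_def using lborel_integral_real_affine[of 1 J "- ln s"] by simp
  have fn: "(LINT y|lborel. norm (f s y)) = norm (ipow t s) * (LINT x|lborel. norm (J x))" for s
    unfolding fJ[abs_def] norm_mult using lborel_integral_real_affine[of 1 "\<lambda>x. norm (J x)" "- ln s"] by simp
  have bi: "integrable M (ipow t)"
    using bdd_borel_ipow[of t] by (intro M.integrable_const_bound[where B=1]) (auto simp: ipow_def bdd_borel_def)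
  have prod: "integrable (M \<Otimes>\<^sub>M lborel) (\<lambda>(s, y). f s y)"
  proof (rule P.Fubini_integrable)
    show "(\<lambda>(s, y). f s y) \<in> borel_measurable (M \<Otimes>\<^sub>M lborel)"
      unfolding f_def mellin_kernel_def by measurable
    show "integrable M (\<lambda>s. LINT y|lborel. norm (case (s, y) of (s, y) \<Rightarrow> f s y))"
      using integrable_norm[OF bi] by (simp add: fn)
    show "AE s in M. integrable lborel (\<lambda>y. case (s, y) of (s, y) \<Rightarrow> f s y)" using fint by simp
  qed
  have in1: "(LINT s|M. f s y) = exp (\<i> * of_real (t * y)) * integral\<^sup>L M (mellin_kernel \<theta> y)" for y
    unfolding f_def by simp
  show "integrable lborel (\<lambda>y. exp (\<i> * of_real (t * y)) * integral\<^sup>L M (mellin_kernel \<theta> y))"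
    using P.integrable_snd[OF prod] by (simp add: in1)
  have "(LINT y|lborel. LINT s|M. f s y) = (LINT s|M. LINT y|lborel. f s y)"
    by (rule P.Fubini_integral[OF prod])
  then show "(LINT y|lborel. exp (\<i> * of_real (t * y)) * integral\<^sup>L M (mellin_kernel \<theta> y))
     = exp (- (of_real (t * \<theta>))) * (LINT x|lborel. logi (of_real x) * exp (\<i> * of_real (t * x))) * integral\<^sup>L M (ipow t)"
    by (simp add: in1 f c)
qed

lemma bdd_borel_mellin_kernel:
  assumes "\<bar>\<theta>\<bar> < pi"
  shows "bdd_borel (mellin_kernel \<theta> y)"
proof (rule bdd_borelI[where C="1 / ((1 + cos \<theta>) / 2)"])
  show "mellin_kernel \<theta> y \<in> borel_measurable borel" unfolding mellin_kernel_def by measurable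
  show "cmod (mellin_kernel \<theta> y s) \<le> 1 / ((1 + cos \<theta>) / 2)" for s
  proof (cases "0 < s")
    case True
    have "exp x / (1 + exp x)\<^sup>2 \<le> 1" for x :: real
    proof -
      have "(1 + exp x)\<^sup>2 = 1 + 2 * exp x + (exp x)\<^sup>2" by (simp add: power2_eq_square algebra_simps)
      then have "exp x \<le> (1 + exp x)\<^sup>2" using exp_gt_zero[of x] zero_le_power2[of "exp x"] by linarith
      then show ?thesis by (simp add: divide_le_eq_1)
    qed
    then have "exp x / (1 + exp x)\<^sup>2 / ((1 + cos \<theta>) / 2) \<le> 1 / ((1 + cos \<theta>) / 2)" for x
      using cos_half_pos[OF assms] by (intro divide_right_mono) auto
    then show ?thesis using True logi_bound[OF assms, of "y - ln s"] unfolding mellin_kernel_def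
      by (simp add: order_trans)
  qed (use cos_half_pos[OF assms] in \<open>simp add: mellin_kernel_def\<close>)
qed

text \<open>The kernel is \<open>c s/(s + c)^2\<close>, and \<open>s = (s + c) - c\<close>
  eliminates the unbounded factor \<open>s\<close> in favour of \<open>1/(s + c)\<close> and its
  square.\<close>

lemma mellin_kernel_resolvent:
  fixes \<theta> y s :: real
  assumes "\<bar>\<theta>\<bar> < pi" and s: "0 < s"
  defines "c \<equiv> of_real (exp y) * exp (- \<i> * complex_of_real \<theta>)"
  shows "mellin_kernel \<theta> y s = c * (1 / (of_real s + c)) - c\<^sup>2 * (1 / (of_real s + c))\<^sup>2"
proof -
  have e: "exp (of_real (y - ln s) - \<i> * of_real \<theta>) = c / of_real s"
  proof -
    have "exp (of_real (y - ln s) - \<i> * of_real \<theta>) = exp (of_real y) / exp (of_real (ln s)) * exp (- \<i> * complex_of_real \<theta>)"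
      by (simp only: exp_add[symmetric] exp_diff[symmetric]) (simp add: algebra_simps)
    then show ?thesis using s unfolding exp_of_real by (simp add: c_def)
  qed
  have nz: "of_real s + c \<noteq> 0" unfolding c_def by (rule rotated_sum_nonzero) (use assms in auto)
  have "1 + c / of_real s = (of_real s + c) / of_real s" using s by (simp add: field_simps)
  then have "mellin_kernel \<theta> y s = c * of_real s / (of_real s + c)\<^sup>2"
    using s unfolding mellin_kernel_def logi_def e by (simp add: power2_eq_square)
  also have "\<dots> = c * (1 / (of_real s + c)) - c\<^sup>2 * (1 / (of_real s + c))\<^sup>2"
  proof -
    define d where "d = of_real s + c"
    have "of_real s = d - c" by (simp add: d_def)
    then show ?thesis
      using nz unfolding d_def[symmetric] by (simp add: power2_eq_square right_diff_distrib diff_divide_distrib)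
  qed
  finally show ?thesis .
qed

text \<open>Polarization turns the matrix element into four integrals against finite measures, to
  which the scalar transform applies.\<close>

lemma (in spectral) mellin_opr:
  assumes \<theta>: "\<bar>\<theta>\<bar> < pi"
  shows "(LINT y|lborel. exp (\<i> * of_real (t * y)) * cinner z (opr (mellin_kernel \<theta> y) x))
     = exp (- (of_real (t * \<theta>))) * (LINT x|lborel. logi (of_real x) * exp (\<i> * of_real (t * x))) * cinner z (opr (ipow t) x)"
proof -
  let ?w = "\<lambda>k. z + scaleC (\<i> ^ k) x"
  let ?c = "exp (- (of_real (t * \<theta>))) * (LINT x|lborel. logi (of_real x) * exp (\<i> * of_real (t * x)))"
  have "(LINT y|lborel. exp (\<i> * of_real (t * y)) * cinner z (opr (mellin_kernel \<theta> y) x))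
    = (LINT y|lborel. (\<Sum>k<4. (inverse \<i> ^ k / 4) * (exp (\<i> * of_real (t * y)) * integral\<^sup>L (spec_meas E (?w k)) (mellin_kernel \<theta> y))))"
    by (simp add: opr_polarized[OF bdd_borel_mellin_kernel[OF \<theta>]] sum_distrib_left sum_divide_distrib mult.left_commute)
  also have "\<dots> = (\<Sum>k<4. (inverse \<i> ^ k / 4) * (LINT y|lborel. exp (\<i> * of_real (t * y)) * integral\<^sup>L (spec_meas E (?w k)) (mellin_kernel \<theta> y)))"
    by (subst Bochner_Integration.integral_sum)
      (intro integrable_mult_right mellin_transform(1) finite_mu sets_mu \<theta>, simp)
  also have "\<dots> = (\<Sum>k<4. (inverse \<i> ^ k / 4) * (?c * integral\<^sup>L (spec_meas E (?w k)) (ipow t)))"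
    by (simp only: mellin_transform(2)[OF finite_mu sets_mu \<theta>])
  also have "\<dots> = ?c * cinner z (opr (ipow t) x)"
    by (simp add: opr_polarized[OF bdd_borel_ipow] sum_distrib_left sum_divide_distrib mult.left_commute)
  finally show ?thesis .
qed

section \<open>Imaginary powers and q-commutation\<close>

text \<open>Cut off at the non-positive half-line, where \<open>1/(s + c)\<close> may have a pole;
  by \<open>E_nonpos\<close> the spectral projection of that half-line vanishes on
  \<open>K\<close>.\<close>

definition resolvent_fun :: "complex \<Rightarrow> real \<Rightarrow> complex" where
  "resolvent_fun c s = (if 0 < s then 1 / (of_real s + c) else 0)"

lemma bdd_borel_resolvent_fun:
  fixes l \<theta> :: real
  assumes \<theta>: "\<bar>\<theta>\<bar> < pi" and l: "0 < l"
  shows "bdd_borel (resolvent_fun (of_real l * exp (- \<i> * complex_of_real \<theta>)))" (is "bdd_borel (resolvent_fun ?c)")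
proof (rule bdd_borelI[where C="1 / (sqrt ((1 + cos \<theta>) / 2) * l)"])
  show "resolvent_fun ?c \<in> borel_measurable borel" unfolding resolvent_fun_def by measurable
  fix s :: real
  have b: "0 < sqrt ((1 + cos \<theta>) / 2)" using cos_half_pos[OF \<theta>] by simp
  show "cmod (resolvent_fun ?c s) \<le> 1 / (sqrt ((1 + cos \<theta>) / 2) * l)"
  proof (cases "0 < s")
    case True
    have "(sqrt ((1 + cos \<theta>) / 2) * (s + l))\<^sup>2 \<le> (cmod (of_real s + ?c))\<^sup>2"
      using rotated_sum_lower_bound[of s l \<theta>] True l cos_half_pos[OF \<theta>] by (simp add: power_mult_distrib)
    then have "sqrt ((1 + cos \<theta>) / 2) * (s + l) \<le> cmod (of_real s + ?c)"
      by (rule power2_le_imp_le) simp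
    moreover have "sqrt ((1 + cos \<theta>) / 2) * l \<le> sqrt ((1 + cos \<theta>) / 2) * (s + l)"
      using b True by (intro mult_left_mono) auto
    ultimately have le: "sqrt ((1 + cos \<theta>) / 2) * l \<le> cmod (of_real s + ?c)" by linarith
    have "1 / cmod (of_real s + ?c) \<le> 1 / (sqrt ((1 + cos \<theta>) / 2) * l)"
      by (rule frac_le[OF zero_le_one order_refl mult_pos_pos[OF b l] le])
    then show ?thesis using True by (simp add: resolvent_fun_def norm_divide)
  next
    case False
    have "0 \<le> 1 / (sqrt ((1 + cos \<theta>) / 2) * l)" using b l by (intro divide_nonneg_nonneg mult_nonneg_nonneg) auto
    then show ?thesis using False by (simp add: resolvent_fun_def)
  qed
qed

lemma (in spectral) opr_mellin_kernel:
  fixes y \<theta> :: real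
  assumes \<theta>: "\<bar>\<theta>\<bar> < pi"
  defines "c \<equiv> of_real (exp y) * exp (- \<i> * complex_of_real \<theta>)"
  shows "opr (mellin_kernel \<theta> y) x =
    scaleC c (opr (resolvent_fun c) x) - scaleC (c\<^sup>2) (opr (resolvent_fun c) (opr (resolvent_fun c) x))"
proof -
  have b: "bdd_borel (resolvent_fun c)" unfolding c_def by (rule bdd_borel_resolvent_fun[OF \<theta>]) simp
  have "mellin_kernel \<theta> y = (\<lambda>s. c * resolvent_fun c s - c\<^sup>2 * (resolvent_fun c s * resolvent_fun c s))"
  proof
    fix s
    show "mellin_kernel \<theta> y s = c * resolvent_fun c s - c\<^sup>2 * (resolvent_fun c s * resolvent_fun c s)"
      using mellin_kernel_resolvent[OF \<theta>, of s y]
      by (cases "0 < s") (simp_all add: resolvent_fun_def c_def power2_eq_square mellin_kernel_def)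
  qed
  then show ?thesis
    using b by (simp add: opr_diff opr_scale opr_mult bdd_borel_scale bdd_borel_mult)
qed

text \<open>The kernels at angles 0 and \<open>\<theta>\<close> are intertwined by \<open>B\<close>.
  Pairing this with a graph pair \<open>(g, g')\<close> of \<open>B\<close> and integrating over
  \<open>y\<close> gives the same constant times \<open>exp (- t\<theta>)\<close> on the side of
  \<open>h\<close>. Cancelling the nonzero constant leaves the adjoint condition, which for
  self-adjoint \<open>B\<close> is membership in the graph.\<close>

lemma (in positive_spectral) resolvent_commute_imp_ipow_commute:
  fixes \<theta> t :: real
  assumes B: "selfadjoint K B" and \<theta>: "\<bar>\<theta>\<bar> < pi"
    and res: "\<And>l f h. 0 < l \<Longrightarrow> (f, h) \<in> B \<Longrightarrow>
      (opr (resolvent_fun (of_real l)) f,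
       scaleC (exp (- \<i> * complex_of_real \<theta>)) (opr (resolvent_fun (of_real l * exp (- \<i> * complex_of_real \<theta>))) h)) \<in> B"
    and fh: "(f, h) \<in> B"
  shows "(opr (ipow t) f, scaleC (exp (- of_real (t * \<theta>))) (opr (ipow t) h)) \<in> B"
proof -
  interpret B: selfadjoint K B by fact
  let ?q = "exp (- \<i> * complex_of_real \<theta>)"
  have pi0: "\<bar>0::real\<bar> < pi" by simp
  have kernel: "(opr (mellin_kernel 0 y) f, opr (mellin_kernel \<theta> y) h) \<in> B" for y
  proof -
    let ?l = "exp y"
    let ?r = "resolvent_fun (of_real ?l)" and ?s = "resolvent_fun (of_real ?l * ?q)"
    have bs: "bdd_borel ?s" by (rule bdd_borel_resolvent_fun[OF \<theta>]) simp
    have 1: "(opr ?r f, scaleC ?q (opr ?s h)) \<in> B" by (rule res[OF _ fh]) simp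
    \<comment> \<open>The hypothesis is applied to the graph pair it has just produced, so the
      squared resolvent is intertwined with a second factor of \<open>q\<close>; these factors match
      \<open>c\<close> and \<open>c\<^sup>2\<close> in the kernel at angle
      \<open>\<theta>\<close>.\<close>
    have 2: "(opr ?r (opr ?r f), scaleC ?q (opr ?s (scaleC ?q (opr ?s h)))) \<in> B" by (rule res[OF _ 1]) simp
    have "opr (mellin_kernel 0 y) f = scaleC (of_real ?l) (opr ?r f) - scaleC ((of_real ?l)\<^sup>2) (opr ?r (opr ?r f))"
      using opr_mellin_kernel[OF pi0, of y f] by simp
    moreover have "opr (mellin_kernel \<theta> y) h = scaleC (of_real ?l) (scaleC ?q (opr ?s h))
       - scaleC ((of_real ?l)\<^sup>2) (scaleC ?q (opr ?s (scaleC ?q (opr ?s h))))"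
      using opr_mellin_kernel[OF \<theta>, of y h]
      by (simp only: bclin_scaleC[OF bclin_opr[OF bs]] scaleC_scaleC power_mult_distrib) (simp add: power2_eq_square mult.assoc)
    ultimately show ?thesis by (simp only:) (intro B.diff B.scaleC 1 2)
  qed
  show ?thesis
  proof (rule B.memI)
    show "opr (ipow t) f \<in> K" by (rule opr_in_K[OF bdd_borel_ipow])
    show "scaleC (exp (- of_real (t * \<theta>))) (opr (ipow t) h) \<in> K"
      by (intro csubspace_scaleC[OF K_sub] opr_in_K[OF bdd_borel_ipow])
    fix g g' assume g: "(g, g') \<in> B"
    let ?c = "LINT x|lborel. logi (of_real x) * exp (\<i> * of_real (t * x))"
    have "cinner g' (opr (mellin_kernel 0 y) f) = cinner g (opr (mellin_kernel \<theta> y) h)" for y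
      by (rule B.sym[OF g kernel])
    then have "(LINT y|lborel. exp (\<i> * of_real (t * y)) * cinner g' (opr (mellin_kernel 0 y) f))
      = (LINT y|lborel. exp (\<i> * of_real (t * y)) * cinner g (opr (mellin_kernel \<theta> y) h))" by simp
    then have "?c * cinner g' (opr (ipow t) f) = exp (- (of_real (t * \<theta>))) * ?c * cinner g (opr (ipow t) h)"
      unfolding mellin_opr[OF pi0] mellin_opr[OF \<theta>] by simp
    then have "?c * cinner g' (opr (ipow t) f) = ?c * (exp (- (of_real (t * \<theta>))) * cinner g (opr (ipow t) h))"
      by (simp add: mult.left_commute mult.commute)
    then show "cinner g' (opr (ipow t) f) = cinner g (scaleC (exp (- of_real (t * \<theta>))) (opr (ipow t) h))"
      using fourier_logi_nonzero[of t] by (simp add: cinner_scaleC_right)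
  qed
qed

lemma (in selfadjoint) reduces_orth_sum:
  assumes "K = UNIV" and M: "reduces M T"
  shows "T = op_orth_sum (op_part M T) (op_part (orth_compl M) T)"
proof (intro set_eqI iffI)
  have Mc: "closed_csubspace M" and red: "\<And>x y. (x, y) \<in> T \<Longrightarrow> (proj_onto M x, proj_onto M y) \<in> T"
    using M by (auto simp: reduces_def)
  fix p
  {
    assume "p \<in> T"
    moreover obtain x y where p: "p = (x, y)" by fastforce
    ultimately have xy: "(x, y) \<in> T" by simp
    have "(proj_onto M x, proj_onto M y) \<in> op_part M T"
      using red[OF xy] proj_onto_mem[OF Mc] by (simp add: op_part_def)
    moreover have "(x - proj_onto M x, y - proj_onto M y) \<in> op_part (orth_compl M) T"
      using diff[OF xy red[OF xy]] diff_proj_in_orth_compl[OF Mc] by (simp add: op_part_def)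
    moreover have "p = (proj_onto M x + (x - proj_onto M x), proj_onto M y + (y - proj_onto M y))" using p by simp
    ultimately show "p \<in> op_orth_sum (op_part M T) (op_part (orth_compl M) T)"
      unfolding op_orth_sum_def by blast
  }
  {
    assume "p \<in> op_orth_sum (op_part M T) (op_part (orth_compl M) T)"
    then show "p \<in> T" using add by (auto simp: op_orth_sum_def op_part_def)
  }
qed

theorem mainTheorem10:
  fixes A B :: "'h::chilbert_space rel" and \<theta>0 :: real and q :: complex
  assumes q_def: "q = exp (- \<i> * complex_of_real \<theta>0)"
    and theta: "0 < \<bar>\<theta>0\<bar>" "\<bar>\<theta>0\<bar> < pi"
    and A_pos: "positive_on UNIV A" and A_ker: "op_ker A = {0}"
    and B_sa: "selfadj_on UNIV B"
    and core: "is_core (Dq q A B) B"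
    and res: "\<forall>l::real. l > 0 \<longrightarrow>
               op_scale q (B O resolvent (- (complex_of_real l * q)) A)
                 \<subseteq> resolvent (- complex_of_real l) A O B"
  shows "reduces (op_ker B) A \<and> reduces (op_ker B) B \<and>
         A = op_orth_sum (op_part (op_ker B) A) (op_part (orth_compl (op_ker B)) A) \<and>
         B = op_orth_sum (zero_op_on (op_ker B)) (op_part (orth_compl (op_ker B)) B) \<and>
         class_C0 \<theta>0 (orth_compl (op_ker B))
            (op_part (orth_compl (op_ker B)) A) (op_part (orth_compl (op_ker B)) B)"
proof -
  interpret A: positive UNIV A by (rule positiveI[OF closed_csubspace_UNIV A_pos])
  interpret B: selfadjoint UNIV B using B_sa closed_csubspace_UNIV by unfold_locales
  define N where "N = op_ker B"
  define K where "K = orth_compl N"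
  define A0 where "A0 = op_part K A"
  define B0 where "B0 = op_part K B"
  have N_iff: "x \<in> N \<longleftrightarrow> (x, 0) \<in> B" for x by (simp add: N_def op_ker_def)
  have Nc: "closed_csubspace N"
    unfolding closed_csubspace_def csubspace_def
  proof (intro conjI ballI allI)
    show "0 \<in> N" using B.zero by (simp add: N_iff)
    show "x + y \<in> N" if "x \<in> N" "y \<in> N" for x y using B.add[of x 0 y 0] that by (simp add: N_iff)
    show "scaleC c x \<in> N" if "x \<in> N" for c x using B.scaleC[of x 0 c] that by (simp add: N_iff)
    show "closed N"
      unfolding closed_sequential_limits using B.limit[of _ "\<lambda>n. 0"] by (auto simp: N_iff)
  qed
  note Ns = closed_csubspace_imp_csubspace[OF Nc]
  \<comment> \<open>The resolvent inclusion on vectors: if \<open>h = B f\<close> and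
    \<open>w = (A + \<lambda>q)^(-1) h\<close>, then \<open>v = (A + \<lambda>)^(-1) f\<close> lies
    in the domain of \<open>B\<close> and \<open>B v = q w\<close>.\<close>
  have res': "\<exists>v. (v, f - scaleC (of_real l) v) \<in> A \<and> (v, scaleC q w) \<in> B"
    if l: "0 < l" and fh: "(f, h) \<in> B" and w: "(w, h - scaleC (of_real l * q) w) \<in> A" for l :: real and f h w
  proof -
    have "(h, w) \<in> resolvent (- (complex_of_real l * q)) A"
      unfolding resolvent_def op_shift_def using w by (auto simp: scaleC_minus_left intro!: exI[of _ "h - scaleC (of_real l * q) w"])
    then have "(f, scaleC q w) \<in> op_scale q (B O resolvent (- (complex_of_real l * q)) A)"
      using fh by (auto simp: op_scale_def)
    then obtain v where v: "(f, v) \<in> resolvent (- complex_of_real l) A" "(v, scaleC q w) \<in> B"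
      using res l by blast
    then obtain y where "(v, y) \<in> A" "f = y + scaleC (of_real l) v"
      by (auto simp: resolvent_def op_shift_def scaleC_minus_left)
    then have "(v, f - scaleC (of_real l) v) \<in> A" by simp
    then show ?thesis using v(2) by blast
  qed
  have res_ker: "\<exists>v\<in>N. (v, f - v) \<in> A" if "f \<in> N" for f
    using res'[of 1 f 0 0] that A.zero by (auto simp: N_iff)
  have redA: "reduces N A"
    unfolding reduces_def
  proof (intro conjI Nc allI impI)
    fix x y assume xy: "(x, y) \<in> A"
    define n where "n = proj_onto N (x + y)"
    have nN: "n \<in> N" unfolding n_def by (rule proj_onto_mem[OF Nc])
    obtain v where v: "v \<in> N" "(v, n - v) \<in> A" using res_ker[OF nN] by blast
    have d: "(x - v, y - (n - v)) \<in> A" by (rule A.diff[OF xy v(2)])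
    \<comment> \<open>Here \<open>f = (A + 1) u\<close> with \<open>u\<close> in \<open>N\<close>;
      moving \<open>A + 1\<close> across the inner product gives \<open><u, x + y - n>\<close>,
      which vanishes since \<open>n\<close> projects \<open>x + y\<close> onto \<open>N\<close>. So
      \<open>v\<close> is the projection of \<open>x\<close>, and \<open>n - v\<close> that of
      \<open>y\<close>.\<close>
    have o1: "cinner f (x - v) = 0" if f: "f \<in> N" for f
    proof -
      obtain u where u: "u \<in> N" "(u, f - u) \<in> A" using res_ker[OF f] by blast
      have "cinner f (x - v) = cinner u (x - v) + cinner (f - u) (x - v)" by (simp flip: cinner_add_left)
      also have "cinner (f - u) (x - v) = cinner u (y - (n - v))" by (rule A.sym[OF u(2) d])
      also have "cinner u (x - v) + cinner u (y - (n - v)) = cinner u (x + y - n)"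
        by (simp add: algebra_simps flip: cinner_add_right)
      also have "\<dots> = 0" unfolding n_def by (rule proj_onto_orth[OF Nc u(1)])
      finally show ?thesis .
    qed
    have Px: "proj_onto N x = v" by (rule proj_onto_eqI[OF Ns v(1) o1])
    have Py: "proj_onto N y = n - v"
    proof (rule proj_onto_eqI[OF Ns])
      show "n - v \<in> N" by (rule csubspace_diff[OF Ns nN v(1)])
      show "cinner f (y - (n - v)) = 0" if f: "f \<in> N" for f
      proof -
        have "cinner f (x + y - n) = 0" unfolding n_def by (rule proj_onto_orth[OF Nc f])
        then show ?thesis using o1[OF f] by (simp add: cinner_simps algebra_simps)
      qed
    qed
    show "(proj_onto N x, proj_onto N y) \<in> A" using v(2) Px Py by simp
  qed
  have redB: "reduces N B"
    unfolding reduces_def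
  proof (intro conjI Nc allI impI)
    fix x y assume xy: "(x, y) \<in> B"
    have "cinner f (y - 0) = 0" if "f \<in> N" for f
      using B.sym[of f 0 x y] that xy by (simp add: N_iff)
    then have "proj_onto N y = 0" by (intro proj_onto_eqI[OF Ns] csubspace_0[OF Ns])
    then show "(proj_onto N x, proj_onto N y) \<in> B" using proj_onto_mem[OF Nc, of x] by (simp add: N_iff)
  qed
  have zero: "op_part N B = zero_op_on N"
    using B.unique by (fastforce simp: op_part_def zero_op_on_def N_iff)
  have Kc: "closed_csubspace K" unfolding K_def by (rule closed_csubspace_orth_compl)
  have A0_pos: "positive_on K A0"
    using A.reduced_part[OF refl redA] A.pos by (auto simp: positive_on_def A0_def K_def op_part_def)
  have B0_sa: "selfadj_on K B0"
    using B.reduced_part[OF refl redB] by (simp add: B0_def K_def)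
  have K0: "0 \<in> K" by (rule csubspace_0[OF closed_csubspace_imp_csubspace[OF Kc]])
  have A0_ker: "op_ker A0 = {0}"
    using A_ker K0 A.zero by (auto simp: op_ker_def A0_def op_part_def)
  have B0_ker: "op_ker B0 = {0}"
  proof -
    have "x = 0" if "(x, 0) \<in> B" "x \<in> K" for x
    proof -
      have "cinner x x = 0" using that N_iff by (simp add: K_def orth_compl_def)
      then show ?thesis by simp
    qed
    then show ?thesis using K0 B.zero by (auto simp: op_ker_def B0_def op_part_def)
  qed
  interpret A0: positive K A0 by (rule positiveI[OF Kc A0_pos])
  interpret B0: selfadjoint K B0 using Kc B0_sa by unfold_locales
  \<comment> \<open>The same choice term as in \<open>op_ipow\<close> once
    \<open>op_abs K A0\<close> has been evaluated to \<open>A0\<close>, so the calculus of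
    \<open>E\<close> computes the imaginary powers of the conclusion.\<close>
  define E where "E = (SOME E. spectral_measure_of K A0 E)"
  have E: "spectral_measure_of K A0 E" unfolding E_def by (rule someI_ex[OF A0.ex_spectral_measure])
  have E1: "spectral_measure_on K E" and E2: "A0 = fc K E (\<lambda>s. complex_of_real s)"
    using E by (simp_all add: spectral_measure_of_def)
  interpret S: positive_spectral K A0 E
    by (intro positive_spectral.intro positive_spectral_axioms.intro spectral.intro A0.positive_axioms Kc E1 E2 A0_ker)
  have ipow: "op_ipow K (op_abs K A0) t = {(x, S.opr (ipow t) x) | x. x \<in> K}" for t
  proof -
    have "op_ipow K (op_abs K A0) t = fc K E (ipow t)"
      unfolding A0.op_abs_eq op_ipow_def E_def ipow_def[abs_def] by simp
    also have "\<dots> = {(x, S.opr (ipow t) x) | x. x \<in> K}"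
      by (rule S.fc_bounded[OF bdd_borel_ipow]) (simp add: ipow_def)
    finally show ?thesis .
  qed
  have res0: "(S.opr (resolvent_fun (of_real l)) f,
       scaleC (exp (- \<i> * complex_of_real \<theta>0)) (S.opr (resolvent_fun (of_real l * exp (- \<i> * complex_of_real \<theta>0))) h)) \<in> B0"
    if l: "0 < l" and fh: "(f, h) \<in> B0" for l f h
  proof -
    have fK: "f \<in> K" and hK: "h \<in> K" using B0.mem[OF fh] by auto
    have fhB: "(f, h) \<in> B" using fh by (simp add: B0_def op_part_def)
    have pi0: "\<bar>0::real\<bar> < pi" by simp
    define w where "w = S.opr (resolvent_fun (of_real l * q)) h"
    define v where "v = S.opr (resolvent_fun (of_real l)) f"
    have bl: "bdd_borel (resolvent_fun (of_real l))" using bdd_borel_resolvent_fun[OF pi0 l] by simp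
    have "(w, h - scaleC (of_real l * q) w) \<in> A0"
      unfolding w_def q_def
    proof (rule S.T_resolvent[OF hK bdd_borel_resolvent_fun[OF theta(2) l]])
      show "resolvent_fun (of_real l * exp (- \<i> * complex_of_real \<theta>0)) s * (of_real s + of_real l * exp (- \<i> * complex_of_real \<theta>0)) = 1"
        if "0 < s" for s
        unfolding resolvent_fun_def using rotated_sum_nonzero[OF theta(2) that l] that by simp
    qed (simp add: resolvent_fun_def)
    then have "(w, h - scaleC (of_real l * q) w) \<in> A" by (simp add: A0_def op_part_def)
    from res'[OF l fhB this] obtain v' where v': "(v', f - scaleC (of_real l) v') \<in> A" "(v', scaleC q w) \<in> B"
      by blast
    have "(v, f - scaleC (of_real l) v) \<in> A0"
      unfolding v_def
    proof (rule S.T_resolvent[OF fK bl])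
      show "resolvent_fun (of_real l) s * (of_real s + of_real l) = 1" if "0 < s" for s
        unfolding resolvent_fun_def using rotated_sum_nonzero[OF pi0 that l] that by simp
    qed (simp add: resolvent_fun_def)
    then have vA: "(v, f - scaleC (of_real l) v) \<in> A" and vK: "v \<in> K" by (auto simp: A0_def op_part_def)
    \<comment> \<open>The resolvent of \<open>A0\<close>, given by the calculus, and that of
      \<open>A\<close>, given by the hypothesis, solve the same equation; injectivity of
      \<open>A + l\<close> identifies them and places the solution in \<open>K\<close>.\<close>
    have "v = v'" by (rule A.pos_inj'[OF vA v'(1) l]) simp
    then have "(v, scaleC q w) \<in> B0" using v'(2) vK by (simp add: B0_def op_part_def)
    then show ?thesis unfolding v_def w_def q_def .
  qed
  have "class_C0 \<theta>0 K A0 B0"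
    unfolding class_C0_def
  proof (intro conjI allI)
    show "selfadj_on K A0" using A0_pos by (simp add: positive_on_def)
    show "selfadj_on K B0" "op_ker A0 = {0}" "op_ker B0 = {0}" by fact+
    show "B0 O polar_phase K A0 \<subseteq> polar_phase K A0 O B0"
      unfolding A0.polar_phase_eq[OF A0_ker] using B0.mem by auto
    show "B0 O op_ipow K (op_abs K A0) t
        \<subseteq> op_scale (complex_of_real (exp (\<theta>0 * t))) (op_ipow K (op_abs K A0) t O B0)" for t
    proof
      fix p assume "p \<in> B0 O op_ipow K (op_abs K A0) t"
      then obtain f h where p: "p = (f, S.opr (ipow t) h)" and fh: "(f, h) \<in> B0" unfolding ipow by auto
      let ?z = "scaleC (exp (- of_real (t * \<theta>0))) (S.opr (ipow t) h)"
      have "(S.opr (ipow t) f, ?z) \<in> B0"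
        by (rule S.resolvent_commute_imp_ipow_commute[OF B0.selfadjoint_axioms theta(2) res0 fh])
      moreover have "(f, S.opr (ipow t) f) \<in> op_ipow K (op_abs K A0) t"
        unfolding ipow using B0.mem[OF fh] by blast
      ultimately have "(f, ?z) \<in> op_ipow K (op_abs K A0) t O B0" by blast
      \<comment> \<open>The factor \<open>exp (- t \<theta>0)\<close> stands on the side of
        \<open>B0\<close> applied to the power of \<open>f\<close>, so its reciprocal is the scale
        required by \<open>class_C0\<close>.\<close>
      moreover have "S.opr (ipow t) h = scaleC (complex_of_real (exp (\<theta>0 * t))) ?z"
      proof -
        have "complex_of_real (exp (\<theta>0 * t)) * exp (- of_real (t * \<theta>0)) = 1"
          unfolding exp_of_real[symmetric] by (simp add: mult.commute flip: exp_add)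
        then show ?thesis unfolding scaleC_scaleC by simp
      qed
      ultimately show "p \<in> op_scale (complex_of_real (exp (\<theta>0 * t))) (op_ipow K (op_abs K A0) t O B0)"
        unfolding p op_scale_def by blast
    qed
  qed
  then show ?thesis
    using redA redB A.reduces_orth_sum[OF refl redA] B.reduces_orth_sum[OF refl redB] zero
    unfolding A0_def B0_def K_def N_def by simp
qed

end
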